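(* Bounded-weight FGC admits a polynomial-time $2.4036$-approximation algorithm, i.e., for every fixed constant $M\in\mathbb{N}$ there is a polynomial-time algorithm which, for every FGC instance $I$ all of whose edge weights lie in $[1,M]$, outputs a feasible solution of weight at most $2.4036\cdot\mathrm{OPT}(I)$.
   Context: An instance $I=(G,w,\overline F)$ of Flexible Graph Connectivity (FGC) consists of a connected undirected loopless graph $G=(V,E)$ (parallel edges allowed), non-negative edge weights $w\in\mathbb{Q}_{\ge 0}^E$, and a set $\overline F\subseteq E$ of safe edges; $F:=E\setminus\overline F$ is the set of unsafe edges. A set $S\subseteq E$ is feasible if $(V,S\setminus\{f\})$ is connected for every $f\in F$. The task is to find a feasible $S$ of minimum weight; $\mathrm{OPT}(I)$ is this minimum. A bounded-weight instance is one whose weights all lie between $1$ and some fixed constant $M\in\mathbb{N}$. *)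

theory Defs
  imports Complex_Main "HOL-Library.Log_Nat" "HOL-Computational_Algebra.Polynomial"
begin

text \<open>
  Flexible Graph Connectivity. Edges are abstract names, so parallel edges are distinct names
  with the same set of ends.
\<close>

record ('v, 'e) fgc =
  verts :: "'v set"
  edges :: "'e set"
  ends :: "'e \<Rightarrow> 'v set"
  weight :: "'e \<Rightarrow> rat"
  safe :: "'e set"

definition unsafe :: "('v, 'e) fgc \<Rightarrow> 'e set" where
  "unsafe I = edges I - safe I"

definition adj_rel :: "('v, 'e) fgc \<Rightarrow> 'e set \<Rightarrow> ('v \<times> 'v) set" where
  "adj_rel I S = {(x, y). \<exists>e\<in>S. ends I e = {x, y}}"

text \<open>Connectedness of the spanning subgraph with edge set \<open>S\<close>.\<close>

definition connected_by :: "('v, 'e) fgc \<Rightarrow> 'e set \<Rightarrow> bool" where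
  "connected_by I S \<longleftrightarrow> (\<forall>u\<in>verts I. \<forall>v\<in>verts I. (u, v) \<in> (adj_rel I S)\<^sup>*)"

definition fgc_instance :: "('v, 'e) fgc \<Rightarrow> bool" where
  "fgc_instance I \<longleftrightarrow>
     finite (verts I) \<and> verts I \<noteq> {} \<and> finite (edges I) \<and>
     (\<forall>e\<in>edges I. ends I e \<subseteq> verts I \<and> card (ends I e) = 2) \<and>
     connected_by I (edges I) \<and>
     (\<forall>e\<in>edges I. 0 \<le> weight I e) \<and>
     safe I \<subseteq> edges I"

definition bounded_weight :: "nat \<Rightarrow> ('v, 'e) fgc \<Rightarrow> bool" where
  "bounded_weight M I \<longleftrightarrow> (\<forall>e\<in>edges I. 1 \<le> weight I e \<and> weight I e \<le> of_nat M)"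

text \<open>
  If there are no unsafe edges, the condition is vacuous: every set of edges is then feasible.
\<close>

definition feasible :: "('v, 'e) fgc \<Rightarrow> 'e set \<Rightarrow> bool" where
  "feasible I S \<longleftrightarrow> S \<subseteq> edges I \<and> (\<forall>f\<in>unsafe I. connected_by I (S - {f}))"

definition total_weight :: "('v, 'e) fgc \<Rightarrow> 'e set \<Rightarrow> rat" where
  "total_weight I S = (\<Sum>e\<in>S. weight I e)"

text \<open>Meaningful only if a feasible set exists, i.e. if no unsafe edge is a bridge of the graph.\<close>

definition OPT :: "('v, 'e) fgc \<Rightarrow> rat" where
  "OPT I = Min (total_weight I ` {S. feasible I S})"


text \<open>
  Algorithms are programs of a random access machine on natural numbers. Running time is measured
  by the logarithmic cost criterion (Cook and Reckhow; Aho, Hopcroft and Ullman): an instruction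
  is charged the binary lengths of all numbers and addresses it handles. Up to polynomials this
  is the running time on Turing machines, also in the presence of multiplication and division.
\<close>

datatype ram_instr =
    SetC nat nat      \<comment> \<open>\<open>X\<^sub>i := c\<close>\<close>
  | Add nat nat nat   \<comment> \<open>\<open>X\<^sub>i := X\<^sub>j + X\<^sub>k\<close>\<close>
  | Sub nat nat nat   \<comment> \<open>truncated subtraction\<close>
  | Mul nat nat nat
  | Div nat nat nat   \<comment> \<open>integer division\<close>
  | Load nat nat      \<comment> \<open>\<open>X\<^sub>i := X[X\<^sub>j]\<close>\<close>
  | Store nat nat     \<comment> \<open>\<open>X[X\<^sub>i] := X\<^sub>j\<close>\<close>
  | JmpZ nat nat      \<comment> \<open>go to instruction \<open>l\<close> if \<open>X\<^sub>i = 0\<close>\<close>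

type_synonym ram_prog = "ram_instr list"
type_synonym ram_mem = "nat \<Rightarrow> nat"

fun ram_exec :: "ram_instr \<Rightarrow> nat \<times> ram_mem \<Rightarrow> nat \<times> ram_mem" where
  "ram_exec (SetC i c) (pc, s) = (Suc pc, s(i := c))"
| "ram_exec (Add i j k) (pc, s) = (Suc pc, s(i := s j + s k))"
| "ram_exec (Sub i j k) (pc, s) = (Suc pc, s(i := s j - s k))"
| "ram_exec (Mul i j k) (pc, s) = (Suc pc, s(i := s j * s k))"
| "ram_exec (Div i j k) (pc, s) = (Suc pc, s(i := s j div s k))"
| "ram_exec (Load i j) (pc, s) = (Suc pc, s(i := s (s j)))"
| "ram_exec (Store i j) (pc, s) = (Suc pc, s(s i := s j))"
| "ram_exec (JmpZ i l) (pc, s) = (if s i = 0 then l else Suc pc, s)"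

text \<open>Number of binary digits, with one digit for zero.\<close>

definition bits :: "nat \<Rightarrow> nat" where
  "bits n = max 1 (floorlog 2 n)"

fun ram_cost :: "ram_instr \<Rightarrow> ram_mem \<Rightarrow> nat" where
  "ram_cost (SetC i c) s = bits i + bits c"
| "ram_cost (Add i j k) s = bits i + bits j + bits k + bits (s j) + bits (s k)"
| "ram_cost (Sub i j k) s = bits i + bits j + bits k + bits (s j) + bits (s k)"
| "ram_cost (Mul i j k) s = bits i + bits j + bits k + bits (s j) + bits (s k)"
| "ram_cost (Div i j k) s = bits i + bits j + bits k + bits (s j) + bits (s k)"
| "ram_cost (Load i j) s = bits i + bits j + bits (s j) + bits (s (s j))"
| "ram_cost (Store i j) s = bits i + bits j + bits (s i) + bits (s j)"
| "ram_cost (JmpZ i l) s = bits i + bits (s i)"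

text \<open>
  \<open>ram_run p c t s\<close>: from configuration \<open>c\<close>, the program \<open>p\<close> halts with memory \<open>s\<close> at
  total cost \<open>t\<close>. It halts when the program counter leaves the program.
\<close>

inductive ram_run :: "ram_prog \<Rightarrow> nat \<times> ram_mem \<Rightarrow> nat \<Rightarrow> ram_mem \<Rightarrow> bool"
  for p :: ram_prog where
  halt: "length p \<le> pc \<Longrightarrow> ram_run p (pc, s) 0 s"
| step: "pc < length p \<Longrightarrow> ram_run p (ram_exec (p ! pc) (pc, s)) t s' \<Longrightarrow>
         ram_run p (pc, s) (ram_cost (p ! pc) s + t) s'"

text \<open>
  A list is stored with its length in cell \<open>0\<close> and its entries in the cells from \<open>1\<close> on. For
  input, the other cells are \<open>0\<close>.
\<close>

definition ram_input :: "nat list \<Rightarrow> ram_mem" where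
  "ram_input xs i = (case i of 0 \<Rightarrow> length xs | Suc j \<Rightarrow> if j < length xs then xs ! j else 0)"

definition ram_output :: "ram_mem \<Rightarrow> nat list" where
  "ram_output s = map s [1..<Suc (s 0)]"

definition ram_computes :: "ram_prog \<Rightarrow> nat list \<Rightarrow> nat \<Rightarrow> nat list \<Rightarrow> bool" where
  "ram_computes p xs t ys \<longleftrightarrow> (\<exists>s. ram_run p (0, ram_input xs) t s \<and> ram_output s = ys)"

definition input_size :: "nat list \<Rightarrow> nat" where
  "input_size xs = (\<Sum>x\<leftarrow>xs. bits x)"


text \<open>
  Encoding of an instance, relative to enumerations \<open>vs\<close> and \<open>es\<close> of its vertices and edges:
  each edge is given by the positions of its two ends in \<open>vs\<close>, its weight as a reduced fraction,
  and a flag for safe edges. A solution is a list of positions in \<open>es\<close>.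
\<close>

definition enumerates :: "'a list \<Rightarrow> 'a set \<Rightarrow> bool" where
  "enumerates xs A \<longleftrightarrow> distinct xs \<and> set xs = A"

definition encode_edge :: "('v, 'e) fgc \<Rightarrow> 'v list \<Rightarrow> 'e \<Rightarrow> nat list" where
  "encode_edge I vs e =
     sorted_list_of_set {i. i < length vs \<and> vs ! i \<in> ends I e} @
     [nat (fst (quotient_of (weight I e))), nat (snd (quotient_of (weight I e))),
      if e \<in> safe I then 1 else 0]"

definition encode_fgc :: "('v, 'e) fgc \<Rightarrow> 'v list \<Rightarrow> 'e list \<Rightarrow> nat list" where
  "encode_fgc I vs es = [length vs, length es] @ concat (map (encode_edge I vs) es)"

definition decodes_to :: "'e list \<Rightarrow> nat list \<Rightarrow> 'e set \<Rightarrow> bool" where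
  "decodes_to es ys S \<longleftrightarrow> distinct ys \<and> set ys \<subseteq> {..<length es} \<and> S = (!) es ` set ys"

text \<open>
  \<open>p\<close> is a polynomial-time \<open>\<alpha>\<close>-approximation algorithm for the FGC instances in the class \<open>C\<close>.
  Vertices and edges may be named by any natural numbers, enumerated in any order. The time bound
  also covers instances without feasible solution, for which there is nothing to output.
\<close>

definition polytime_approx_algorithm ::
  "rat \<Rightarrow> ((nat, nat) fgc \<Rightarrow> bool) \<Rightarrow> ram_prog \<Rightarrow> bool" where
  "polytime_approx_algorithm \<alpha> C p \<longleftrightarrow>
     (\<exists>q :: nat poly. \<forall>I vs es.
        fgc_instance I \<longrightarrow> C I \<longrightarrow> enumerates vs (verts I) \<longrightarrow> enumerates es (edges I) \<longrightarrow>
        (\<exists>t ys. ram_computes p (encode_fgc I vs es) t ys \<and>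
                t \<le> poly q (input_size (encode_fgc I vs es)) \<and>
                ((\<exists>S. feasible I S) \<longrightarrow>
                 (\<exists>S. decodes_to es ys S \<and> feasible I S \<and> total_weight I S \<le> \<alpha> * OPT I))))"

end

theory Submission
  imports Defs
begin

text \<open>
  Replace every edge by its two directions, and a safe edge by two copies of each, and look for a
  cheapest set of arcs of which at least two enter every nonempty set of vertices without the root.
  Every cut then contains a safe edge or two edges underlying the arc set, so these edges are
  feasible. Conversely a feasible edge set yields an arc set of at most twice its cost: bridges
  are safe, and both copies are directed away from the root, while the other edges are taken in both
  directions. Costs are the integers \<open>\<lceil>5 w\<rceil>\<close>, which are at most \<open>6 w\<close> as \<open>w \<ge> 1\<close>; the loss of a
  factor \<open>6/5\<close> leads to the ratio \<open>12/5\<close>.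

  A cheapest arc set is a common base of two matroids of minimum cost: indegree two at every vertex,
  and at most \<open>2 |X| - 2\<close> arcs inside every nonempty set \<open>X\<close>. It is found by canceling negative cycles
  with as few steps as possible in the exchange graph. As the costs are bounded integers, polynomially
  many improvements suffice. Exchangeability is decided by reachability after the deletion of any two
  arcs, since exactly two arcs enter a tight set.
\<close>

section \<open>Twofold covers of vertex sets by directed arcs\<close>

text \<open>The weights are rationals with arbitrary denominators, so exact improvements come with
  no polynomial bound on their number; rounding to bounded integers is what makes plain cycle
  canceling fast enough. The scale 5 is the least integer k with 2 (1 + 1/k) <= 2.4036.

  Uncrossing shows that inclusion-minimal covers have indegree two everywhere, and only this turns
  the cut condition into two matroid conditions. Since the indegree condition is a partition
  matroid, the exchange graph can be contracted to the vertices, and its shortest-walk potentials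
  certify optimality.

  An arbitrary negative cycle may destroy sparsity when all its exchanges are made at once. On one
  with fewest steps the chords are ordered, so the exchanges can be made one after another.

  The machine imposes its own form: numbers are nonnegative and subtraction is truncated, so table
  entries are shifted; all loops share one bound, and programs do without multiplication, so that
  time and number lengths can be bounded from the program text.\<close>

locale arcs =
  fixes tl hd :: "'e \<Rightarrow> 'v" and V :: "'v set"
  assumes finV: "finite V"
begin

definition enters :: "'e set \<Rightarrow> 'v set \<Rightarrow> 'e set" where
  "enters B X = {e\<in>B. tl e \<notin> X \<and> hd e \<in> X}"

definition inner :: "'e set \<Rightarrow> 'v set \<Rightarrow> 'e set" where
  "inner B X = {e\<in>B. tl e \<in> X \<and> hd e \<in> X}"

definition covers :: "'e set \<Rightarrow> bool" where
  "covers B \<longleftrightarrow> (\<forall>X\<subseteq>V. X \<noteq> {} \<longrightarrow> 2 \<le> card (enters B X))"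

text \<open>Independence in the count matroid of the bound \<open>2 * card X - 2\<close>. This bound
  is modular on intersecting sets, which is what makes tight sets uncross.\<close>

definition sparse :: "'e set \<Rightarrow> bool" where
  "sparse B \<longleftrightarrow> (\<forall>X\<subseteq>V. X \<noteq> {} \<longrightarrow> card (inner B X) + 2 \<le> 2 * card X)"

definition tight :: "'e set \<Rightarrow> 'v set \<Rightarrow> bool" where
  "tight B X \<longleftrightarrow> X \<subseteq> V \<and> X \<noteq> {} \<and> card (inner B X) + 2 = 2 * card X"

definition regular :: "'e set \<Rightarrow> bool" where
  "regular B \<longleftrightarrow> finite B \<and> (\<forall>e\<in>B. tl e \<noteq> hd e \<and> hd e \<in> V) \<and>
     (\<forall>v\<in>V. card {e\<in>B. hd e = v} = 2)"

text \<open>The arc \<open>b\<close> lies on the circuit of \<open>a\<close> in the matroid of sparse arc sets.\<close>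

definition exch :: "'e set \<Rightarrow> 'e \<Rightarrow> 'e \<Rightarrow> bool" where
  "exch B a b \<longleftrightarrow> (\<forall>X. tight B X \<longrightarrow> tl a \<in> X \<longrightarrow> hd a \<in> X \<longrightarrow> tl b \<in> X \<and> hd b \<in> X)"

lemma finite_subV: "X \<subseteq> V \<Longrightarrow> finite X"
  using finV finite_subset by blast

lemma finite_inner: "finite B \<Longrightarrow> finite (inner B X)"
  by (simp add: inner_def)

lemma finite_enters: "finite B \<Longrightarrow> finite (enters B X)"
  by (simp add: enters_def)

lemma card_heads:
  assumes "regular B" "X \<subseteq> V"
  shows "card {e\<in>B. hd e \<in> X} = 2 * card X"
proof -
  have "card {e\<in>B. hd e \<in> X} = card (\<Union>v\<in>X. {e\<in>B. hd e = v})"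
    by (rule arg_cong[where f = card]) auto
  also have "\<dots> = (\<Sum>v\<in>X. card {e\<in>B. hd e = v})"
    using assms finite_subV[OF assms(2)] by (intro card_UN_disjoint) (auto simp: regular_def)
  also have "\<dots> = (\<Sum>v\<in>X. 2)"
    using assms by (intro sum.cong) (auto simp: regular_def)
  finally show ?thesis by simp
qed

lemma inner_plus_enters:
  assumes "regular B" "X \<subseteq> V"
  shows "card (inner B X) + card (enters B X) = 2 * card X"
proof -
  have fin: "finite B" using assms by (simp add: regular_def)
  have "card (inner B X) + card (enters B X) = card (inner B X \<union> enters B X)"
    using fin by (intro card_Un_disjoint[symmetric]) (auto simp: inner_def enters_def)
  also have "inner B X \<union> enters B X = {e\<in>B. hd e \<in> X}"
    by (auto simp: inner_def enters_def)
  finally show ?thesis using card_heads[OF assms] by simp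
qed

text \<open>Indegree two puts exactly \<open>2 * card X\<close> heads into \<open>X\<close>. Arcs
  entering \<open>X\<close> and arcs inside \<open>X\<close> share this number, so a lower bound on
  the former is an upper bound on the latter.\<close>

lemma covers_iff_sparse:
  assumes "regular B"
  shows "covers B \<longleftrightarrow> sparse B"
proof -
  have "2 \<le> card (enters B X) \<longleftrightarrow> card (inner B X) + 2 \<le> 2 * card X" if "X \<subseteq> V" for X
    using inner_plus_enters[OF assms that] by linarith
  then show ?thesis by (auto simp: covers_def sparse_def)
qed

lemma tight_iff_enters:
  assumes "regular B"
  shows "tight B X \<longleftrightarrow> X \<subseteq> V \<and> X \<noteq> {} \<and> card (enters B X) = 2"
  using inner_plus_enters[OF assms, of X] by (auto simp: tight_def)

lemma covers_mono:
  assumes "covers B" "B \<subseteq> B'" "finite B'"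
  shows "covers B'"
proof -
  have "card (enters B X) \<le> card (enters B' X)" for X
    using assms by (intro card_mono) (auto simp: enters_def)
  then show ?thesis using assms(1) unfolding covers_def by (meson order_trans)
qed

lemma enters_submodular:
  assumes "finite B"
  shows "card (enters B (X \<inter> Y)) + card (enters B (X \<union> Y)) \<le> card (enters B X) + card (enters B Y)"
proof -
  have f: "finite (enters B Z)" for Z using assms by (rule finite_enters)
  have "card (enters B (X \<inter> Y)) + card (enters B (X \<union> Y)) =
        card (enters B (X \<inter> Y) \<union> enters B (X \<union> Y)) + card (enters B (X \<inter> Y) \<inter> enters B (X \<union> Y))"
    using card_Un_Int[OF f f] .
  also have "\<dots> \<le> card (enters B X \<union> enters B Y) + card (enters B X \<inter> enters B Y)"
    using f by (intro add_mono card_mono) (auto simp: enters_def)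
  also have "\<dots> = card (enters B X) + card (enters B Y)"
    using card_Un_Int[OF f f] by simp
  finally show ?thesis .
qed

lemma inner_supermodular:
  assumes "finite B"
  shows "card (inner B X) + card (inner B Y) =
     card (inner B X \<union> inner B Y) + card (inner B (X \<inter> Y))"
proof -
  have "inner B X \<inter> inner B Y = inner B (X \<inter> Y)" by (auto simp: inner_def)
  then show ?thesis using card_Un_Int[OF finite_inner finite_inner, OF assms assms, of X Y] by simp
qed

text \<open>The counts of inner arcs are supermodular, while the bound \<open>2 * card X - 2\<close>
  is modular as long as the intersection is nonempty. Equality for \<open>X\<close> and
  \<open>Y\<close> therefore forces equality everywhere; in particular no arc of \<open>B\<close>
  joins \<open>X - Y\<close> and \<open>Y - X\<close>.\<close>

lemma tight_uncross:
  assumes "finite B" "sparse B" "tight B X" "tight B Y" "X \<inter> Y \<noteq> {}"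
  shows "tight B (X \<inter> Y)" "tight B (X \<union> Y)" "inner B (X \<union> Y) = inner B X \<union> inner B Y"
proof -
  have XY: "X \<subseteq> V" "Y \<subseteq> V" using assms by (auto simp: tight_def)
  have fX: "finite X" "finite Y" using XY finite_subV by auto
  have c: "card X + card Y = card (X \<union> Y) + card (X \<inter> Y)"
    using card_Un_Int[OF fX] .
  have sub: "inner B X \<union> inner B Y \<subseteq> inner B (X \<union> Y)" by (auto simp: inner_def)
  have le: "card (inner B X \<union> inner B Y) \<le> card (inner B (X \<union> Y))"
    using sub assms(1) by (intro card_mono finite_inner)
  have s1: "card (inner B (X \<inter> Y)) + 2 \<le> 2 * card (X \<inter> Y)"
  proof -
    have "X \<inter> Y \<subseteq> V" using XY by auto
    then show ?thesis using assms(2,5) unfolding sparse_def by blast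
  qed
  have s2: "card (inner B (X \<union> Y)) + 2 \<le> 2 * card (X \<union> Y)"
  proof -
    have "X \<union> Y \<subseteq> V" "X \<union> Y \<noteq> {}" using XY assms(5) by auto
    then show ?thesis using assms(2) unfolding sparse_def by blast
  qed
  note sm = inner_supermodular[OF assms(1), of X Y]
  have t: "card (inner B X) + 2 = 2 * card X" "card (inner B Y) + 2 = 2 * card Y"
    using assms by (auto simp: tight_def)
  show "tight B (X \<inter> Y)" "tight B (X \<union> Y)"
    using sm t c s1 s2 le XY assms(5) by (auto simp: tight_def)
  have "card (inner B X \<union> inner B Y) = card (inner B (X \<union> Y))"
    using sm t c s1 s2 le by linarith
  then show "inner B (X \<union> Y) = inner B X \<union> inner B Y"
    using card_subset_eq[OF finite_inner[OF assms(1)] sub] by simp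
qed

text \<open>By minimality every arc enters some set with exactly two entering arcs. Among such sets
  containing \<open>v\<close> take a smallest one, \<open>X\<close>. Uncrossing \<open>X\<close>
  with the set entered by an arc \<open>e\<close> with head \<open>v\<close> shows that
  \<open>X\<close> is contained in that set, so the tail of \<open>e\<close> is outside
  \<open>X\<close>. All arcs with head \<open>v\<close> thus enter \<open>X\<close>, and there are
  only two.\<close>

lemma minimal_cover_regular:
  assumes "finite B" "covers B" and min: "\<And>e. e \<in> B \<Longrightarrow> \<not> covers (B - {e})"
  shows "regular B"
proof -
  have ex: "\<exists>X\<subseteq>V. e \<in> enters B X \<and> card (enters B X) = 2" if e: "e \<in> B" for e
  proof -
    obtain X where X: "X \<subseteq> V" "X \<noteq> {}" "\<not> 2 \<le> card (enters (B - {e}) X)"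
      using min[OF e] by (auto simp: covers_def)
    have eq: "enters (B - {e}) X = enters B X - {e}" by (auto simp: enters_def)
    have g: "2 \<le> card (enters B X)" using assms(2) X by (auto simp: covers_def)
    have "e \<in> enters B X" using X(3) g eq by (metis Diff_empty Diff_insert0)
    moreover from this have "card (enters B X) = 2"
      using X(3) g eq card_Diff_singleton[of e "enters B X"] by simp
    ultimately show ?thesis using X(1) by blast
  qed
  have two: "card {e\<in>B. hd e = v} = 2" if v: "v \<in> V" for v
  proof -
    let ?I = "{e\<in>B. hd e = v}"
    have fI: "finite ?I" using assms(1) by simp
    have "2 \<le> card (enters B {v})" using assms(2) v by (auto simp: covers_def)
    also have "\<dots> \<le> card ?I" using fI by (intro card_mono) (auto simp: enters_def)
    finally have ge: "2 \<le> card ?I" .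
    then have "?I \<noteq> {}" by (metis card.empty not_numeral_le_zero)
    then obtain e0 where e0: "e0 \<in> B" "hd e0 = v" by auto
    let ?P = "\<lambda>X. X \<subseteq> V \<and> v \<in> X \<and> card (enters B X) = 2"
    have "\<exists>X. ?P X" using ex[OF e0(1)] e0(2) by (auto simp: enters_def)
    then obtain X where X: "?P X" and Xmin: "\<And>Y. ?P Y \<Longrightarrow> card X \<le> card Y"
      using ex_has_least_nat[of ?P _ card] by (metis (no_types, lifting))
    have "?I \<subseteq> enters B X"
    proof
      fix e assume e: "e \<in> ?I"
      obtain Y where Y: "Y \<subseteq> V" "e \<in> enters B Y" "card (enters B Y) = 2"
        using ex[of e] e by auto
      have vY: "v \<in> Y" using Y(2) e by (auto simp: enters_def)
      have "X \<inter> Y \<subseteq> V" "X \<inter> Y \<noteq> {}" "X \<union> Y \<subseteq> V" "X \<union> Y \<noteq> {}" using X Y vY by auto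
      then have "2 \<le> card (enters B (X \<inter> Y))" "2 \<le> card (enters B (X \<union> Y))"
        using assms(2) unfolding covers_def by blast+
      then have "card (enters B (X \<inter> Y)) = 2"
        using enters_submodular[OF assms(1), of X Y] X Y(3) by linarith
      then have "card X \<le> card (X \<inter> Y)" using Xmin[of "X \<inter> Y"] X vY by auto
      then have "X \<inter> Y = X" using finite_subV X by (metis Int_lower1 card_seteq)
      then show "e \<in> enters B X" using Y(2) e X by (auto simp: enters_def)
    qed
    then have "card ?I \<le> 2" using X card_mono[OF finite_enters[OF assms(1)]] by metis
    with ge show ?thesis by simp
  qed
  have "tl e \<noteq> hd e \<and> hd e \<in> V" if "e \<in> B" for e
    using ex[OF that] by (auto simp: enters_def)
  with two assms(1) show ?thesis by (auto simp: regular_def)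
qed

lemma cover_has_regular_subcover:
  assumes "finite B" "covers B"
  shows "\<exists>B'\<subseteq>B. covers B' \<and> regular B'"
proof -
  let ?P = "\<lambda>B'. B' \<subseteq> B \<and> covers B'"
  obtain B' where B': "?P B'" and m: "\<And>C. ?P C \<Longrightarrow> card B' \<le> card C"
    using ex_has_least_nat[of ?P B card] assms by (metis (no_types, lifting) order_refl)
  have fB: "finite B'" using B' assms(1) finite_subset by blast
  have "\<not> covers (B' - {e})" if e: "e \<in> B'" for e
  proof
    assume "covers (B' - {e})"
    then have "card B' \<le> card (B' - {e})" using m B' by blast
    then show False using e fB by (metis card_Diff1_less leD)
  qed
  then have "regular B'" using minimal_cover_regular[OF fB] B' by blast
  with B' show ?thesis by blast
qed

end

text \<open>\<open>K - f x\<close> counts the thresholds in \<open>{L<..K}\<close> that exceed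
  \<open>f x\<close>, so after swapping the sums, the total of \<open>K - f\<close> is the sum of
  the sizes of the level sets.\<close>

lemma sum_le_of_level_sets:
  fixes f :: "'a \<Rightarrow> int"
  assumes fin: "finite A" "finite B" and card: "card A = card B"
    and lev: "\<And>l. card {x\<in>A. f x < l} \<le> card {x\<in>B. f x < l}"
  shows "sum f B \<le> sum f A"
proof -
  obtain L K where LK: "\<forall>x\<in>A \<union> B. L \<le> f x \<and> f x \<le> K"
  proof (cases "A \<union> B = {}")
    case False
    then have "\<forall>x\<in>A \<union> B. Min (f ` (A \<union> B)) \<le> f x \<and> f x \<le> Max (f ` (A \<union> B))"
      using fin by auto
    with that show ?thesis by blast
  qed auto
  have layer: "(\<Sum>x\<in>S. K - f x) = (\<Sum>l\<in>{L<..K}. int (card {x\<in>S. f x < l}))"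
    if S: "finite S" "S \<subseteq> A \<union> B" for S
  proof -
    have "(\<Sum>x\<in>S. K - f x) = (\<Sum>x\<in>S. \<Sum>l\<in>{L<..K}. if f x < l then 1 else 0)"
    proof (intro sum.cong refl)
      fix x assume "x \<in> S"
      then have "L \<le> f x" "f x \<le> K" using LK S by auto
      then have "{l\<in>{L<..K}. f x < l} = {f x<..K}" by auto
      moreover have "(\<Sum>l\<in>{L<..K}. if f x < l then 1 else 0) = int (card {l\<in>{L<..K}. f x < l})"
        by (simp add: sum.If_cases Int_def)
      ultimately show "K - f x = (\<Sum>l\<in>{L<..K}. if f x < l then 1 else 0)"
        using \<open>f x \<le> K\<close> by simp
    qed
    also have "\<dots> = (\<Sum>l\<in>{L<..K}. \<Sum>x\<in>S. if f x < l then 1 else 0)" by (rule sum.swap)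
    also have "\<dots> = (\<Sum>l\<in>{L<..K}. int (card {x\<in>S. f x < l}))"
      using S(1) by (simp add: sum.If_cases Int_def)
    finally show ?thesis .
  qed
  have "(\<Sum>x\<in>A. K - f x) \<le> (\<Sum>x\<in>B. K - f x)"
    unfolding layer[OF fin(1) Un_upper1] layer[OF fin(2) Un_upper2] using lev by (intro sum_mono) simp
  then show ?thesis using card by (simp add: sum_subtractf)
qed

section \<open>Exchange-stable covers are cheapest\<close>

context arcs begin

text \<open>This is optimality of the greedy basis in the matroid of sparse sets, stated per
  threshold \<open>l\<close>: the cheap arcs of \<open>B\<close> span those of \<open>C\<close>. If
  some cheap arc of \<open>C\<close> outside \<open>B\<close> lies in no tight set, it is
  exchangeable with every arc of \<open>B\<close>, so all of \<open>B\<close> is cheap. Otherwise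
  \<open>V\<close> is partitioned into tight sets spanned by cheap arcs of \<open>B\<close>; inside
  each of them \<open>C\<close> has at most as many arcs as \<open>B\<close>, and the cheap arcs of
  \<open>C\<close> elsewhere belong to \<open>B\<close>.\<close>

lemma cheapest_if_exchange_stable:
  fixes f :: "'e \<Rightarrow> int"
  assumes B: "regular B" "covers B" and C: "regular C" "covers C"
    and st: "\<And>a b. a \<in> C - B \<Longrightarrow> b \<in> B \<Longrightarrow> exch B a b \<Longrightarrow> f b \<le> f a"
  shows "sum f B \<le> sum f C"
proof (rule sum_le_of_level_sets)
  have fB: "finite B" and fC: "finite C" using B C by (auto simp: regular_def)
  show "finite C" "finite B" by fact+
  have all: "{e\<in>B. hd e \<in> V} = B" "{e\<in>C. hd e \<in> V} = C" using B C by (auto simp: regular_def)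
  show cards: "card C = card B"
    using card_heads[OF B(1) order_refl] card_heads[OF C(1) order_refl] all by simp
  have sB: "sparse B" and sC: "sparse C" using B C covers_iff_sparse by auto
  fix l
  let ?C = "{x\<in>C. f x < l}" and ?B = "{x\<in>B. f x < l}"
  show "card ?C \<le> card ?B"
  proof (cases "\<exists>a\<in>?C - B. \<forall>X. tight B X \<longrightarrow> \<not> (tl a \<in> X \<and> hd a \<in> X)")
    case True
    then obtain a where a: "a \<in> ?C - B" "\<forall>X. tight B X \<longrightarrow> \<not> (tl a \<in> X \<and> hd a \<in> X)" by blast
    then have "f b < l" if "b \<in> B" for b
      using st[of a b] that by (auto simp: exch_def)
    then have "?B = B" by auto
    then show ?thesis using cards card_mono[OF fC, of ?C] by auto
  next
    case False
    \<comment> \<open>Tight sets in which all arcs of \<open>B\<close> are cheap. Singletons belong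
      to \<open>G\<close>, having no inner arc, and unions of intersecting members do as well, so
      the maximal members \<open>part v\<close> partition \<open>V\<close>.\<close>
    define G where "G = {Y. tight B Y \<and> inner B Y \<subseteq> ?B}"
    define part where "part v = \<Union>{Y\<in>G. v \<in> Y}" for v
    have finG: "finite G" using finV by (auto simp: G_def tight_def intro: finite_subset[of _ "Pow V"])
    have single: "{v} \<in> G" if "v \<in> V" for v
      using that B(1) by (auto simp: G_def tight_def inner_def regular_def)
    have GUn: "X \<union> Y \<in> G" if "X \<in> G" "Y \<in> G" "X \<inter> Y \<noteq> {}" for X Y
      using tight_uncross[OF fB sB, of X Y] that by (auto simp: G_def)
    have partG: "part v \<in> G" if v: "v \<in> V" for v
    proof -
      have "\<Union>F \<in> G \<and> v \<in> \<Union>F" if "finite F" "F \<noteq> {}" "F \<subseteq> {Y\<in>G. v \<in> Y}" for F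
        using that
      proof (induction F rule: finite_ne_induct)
        case (insert x F)
        then show ?case using GUn[of x "\<Union>F"] by auto
      qed auto
      moreover have "finite {Y\<in>G. v \<in> Y}" using finG by simp
      moreover have "{Y\<in>G. v \<in> Y} \<noteq> {}" using single[OF v] by blast
      ultimately show ?thesis unfolding part_def by blast
    qed
    have inpart: "v \<in> part v" if "v \<in> V" for v using single[OF that] by (auto simp: part_def)
    have Gpart: "Y \<subseteq> part v" if "Y \<in> G" "v \<in> Y" for Y v using that by (auto simp: part_def)
    have GV: "Y \<subseteq> V" if "Y \<in> G" for Y using that by (auto simp: G_def tight_def)
    have partV: "part v \<subseteq> V" if "v \<in> V" for v using GV[OF partG[OF that]] .
    have same: "part u = part v" if "u \<in> part v" "v \<in> V" for u v
    proof -
      have uV: "u \<in> V" using partV that by blast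
      have "part v \<subseteq> part u" using Gpart[OF partG[OF that(2)] that(1)] .
      moreover have "part u \<subseteq> part v"
        using Gpart[OF partG[OF uV], of v] inpart[OF that(2)] calculation by blast
      ultimately show ?thesis by blast
    qed
    define P where "P = part ` V"
    have disj: "X \<inter> Y = {}" if "X \<in> P" "Y \<in> P" "X \<noteq> Y" for X Y
      using that same unfolding P_def by (metis disjoint_iff imageE)
    have finP: "finite P" using finV by (simp add: P_def)
    have PG: "P \<subseteq> G" using partG by (auto simp: P_def)
    have innerP: "card (inner C Y) \<le> card (inner B Y)" if "Y \<in> P" for Y
    proof -
      have Y: "Y \<subseteq> V" "Y \<noteq> {}" "card (inner B Y) + 2 = 2 * card Y"
        using PG that by (auto simp: G_def tight_def)
      then have "card (inner C Y) + 2 \<le> 2 * card Y" using sC unfolding sparse_def by blast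
      then show ?thesis using Y(3) by simp
    qed
    have Pdisj: "\<forall>X\<in>P. \<forall>Y\<in>P. X \<noteq> Y \<longrightarrow> inner D X \<inter> inner D Y = {}" for D
      using disj by (fastforce simp: inner_def)
    have cU: "card (\<Union>Y\<in>P. inner D Y) = (\<Sum>Y\<in>P. card (inner D Y))" if "finite D" for D
      using Pdisj finP finite_inner[OF that] by (intro card_UN_disjoint) auto
    let ?J = "\<lambda>D. \<Union>Y\<in>P. inner D Y"
    have JB: "?J B \<subseteq> ?B" using PG by (auto simp: G_def)
    \<comment> \<open>A cheap arc \<open>a\<close> of \<open>C\<close> outside \<open>B\<close> has
      a least tight set around it. Every arc of \<open>B\<close> inside that set is exchangeable
      with \<open>a\<close>, hence cheap, so the set lies in a single part.\<close>
    have out: "?C - ?J C \<subseteq> ?B - ?J B"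
    proof
      fix a assume a: "a \<in> ?C - ?J C"
      have aB: "a \<in> B"
      proof (rule ccontr)
        assume aB: "a \<notin> B"
        let ?Q = "\<lambda>X. tight B X \<and> tl a \<in> X \<and> hd a \<in> X"
        have "\<exists>X. ?Q X" using False a aB by blast
        then obtain X where X: "?Q X" and Xm: "\<And>Y. ?Q Y \<Longrightarrow> card X \<le> card Y"
          using ex_has_least_nat[of ?Q _ card] by (metis (no_types, lifting))
        have Xsub: "X \<subseteq> Y" if Y: "?Q Y" for Y
        proof -
          have "?Q (X \<inter> Y)" using tight_uncross(1)[OF fB sB, of X Y] X Y by auto
          then have "card X \<le> card (X \<inter> Y)" by (rule Xm)
          moreover have "finite X" using X finite_subV by (auto simp: tight_def)
          ultimately have "X \<inter> Y = X" by (metis Int_lower1 card_seteq)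
          then show ?thesis by blast
        qed
        have "inner B X \<subseteq> ?B"
        proof
          fix b assume b: "b \<in> inner B X"
          then have "exch B a b" using Xsub by (auto simp: exch_def inner_def)
          then have "f b \<le> f a" using st[of a b] a aB b by (auto simp: inner_def)
          then show "b \<in> ?B" using a b by (auto simp: inner_def)
        qed
        then have XG: "X \<in> G" using X by (simp add: G_def)
        have hV: "hd a \<in> V" using X by (auto simp: tight_def)
        have "X \<subseteq> part (hd a)" using Gpart[OF XG] X by blast
        then have "a \<in> inner C (part (hd a))" using X a by (auto simp: inner_def)
        then show False using a hV by (auto simp: P_def)
      qed
      then show "a \<in> ?B - ?J B" using a by (auto simp: inner_def)
    qed
    have fJ: "finite (?J D)" if "finite D" for D using finP finite_inner[OF that] by simp
    have "card ?C \<le> card ((?C - ?J C) \<union> ?J C)"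
      using fC fJ[OF fC] by (intro card_mono) auto
    also have "\<dots> \<le> card (?C - ?J C) + card (?J C)" by (rule card_Un_le)
    also have "\<dots> \<le> card (?B - ?J B) + card (?J B)"
    proof (rule add_mono)
      show "card (?C - ?J C) \<le> card (?B - ?J B)" using out fB by (intro card_mono) auto
      show "card (?J C) \<le> card (?J B)"
        unfolding cU[OF fC] cU[OF fB] using innerP by (intro sum_mono) auto
    qed
    also have "\<dots> = card ?B" using card_Diff_subset[OF fJ[OF fB] JB] card_mono[OF _ JB] fB by simp
    finally show ?thesis .
  qed
qed

end

section \<open>Exchanging one arc and exchanging several arcs\<close>

context arcs begin

text \<open>Only sets containing both ends of \<open>a\<close> can gain an inner arc. Among them the
  tight ones also lose \<open>b\<close>, and the others have room for one more arc.\<close>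

lemma sparse_exchange:
  assumes "finite B" "sparse B" "a \<notin> B" "b \<in> B" "exch B a b"
  shows "sparse (insert a (B - {b}))"
  unfolding sparse_def
proof (intro allI impI)
  fix X assume X: "X \<subseteq> V" "X \<noteq> {}"
  let ?B = "insert a (B - {b})"
  have le: "card (inner B X) + 2 \<le> 2 * card X" using assms(2) X by (simp add: sparse_def)
  have f: "finite (inner B X)" using assms(1) by (rule finite_inner)
  show "card (inner ?B X) + 2 \<le> 2 * card X"
  proof (cases "tl a \<in> X \<and> hd a \<in> X")
    case False
    then have "inner ?B X \<subseteq> inner B X" by (auto simp: inner_def)
    from card_mono[OF f this] show ?thesis using le by linarith
  next
    case True
    show ?thesis
    proof (cases "tight B X")
      case True
      with \<open>tl a \<in> X \<and> hd a \<in> X\<close> assms(5) have "b \<in> inner B X"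
        using assms(4) by (auto simp: exch_def inner_def)
      have "inner ?B X = insert a (inner B X - {b})"
        using \<open>tl a \<in> X \<and> hd a \<in> X\<close> by (auto simp: inner_def)
      moreover have "a \<notin> inner B X - {b}" using assms(3) by (auto simp: inner_def)
      ultimately have "card (inner ?B X) = card (inner B X)"
        using f \<open>b \<in> inner B X\<close> card.remove[OF f \<open>b \<in> inner B X\<close>] by simp
      then show ?thesis using le by simp
    next
      case False
      then have "card (inner B X) + 3 \<le> 2 * card X" using le X by (auto simp: tight_def)
      moreover have "inner ?B X \<subseteq> insert a (inner B X)" by (auto simp: inner_def)
      then have "card (inner ?B X) \<le> card (insert a (inner B X))" using f by (intro card_mono) auto
      moreover have "\<dots> \<le> Suc (card (inner B X))" using f by (simp add: card_insert_if)
      ultimately show ?thesis by linarith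
    qed
  qed
qed

text \<open>
  Exchanging the pair of largest key first leaves the exchange relation between the remaining
  arcs untouched, because no other \<open>a i\<close> has \<open>b x\<close> on its circuit.
\<close>

lemma sparse_exchange_ordered:
  fixes key :: "'i \<Rightarrow> int"
  assumes "finite I" "finite B" "sparse B" "inj_on a I" "inj_on b I"
    and "\<And>i. i \<in> I \<Longrightarrow> a i \<notin> B \<and> b i \<in> B \<and> exch B (a i) (b i)"
    and "\<And>i j. i \<in> I \<Longrightarrow> j \<in> I \<Longrightarrow> i \<noteq> j \<Longrightarrow> exch B (a i) (b j) \<Longrightarrow> key j < key i"
  shows "sparse (B - b ` I \<union> a ` I)"
  using assms
proof (induction "card I" arbitrary: I B)
  case 0
  then show ?case by simp
next
  case (Suc n)
  have ne: "I \<noteq> {}" using Suc.hyps(2) by auto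
  have "Max (key ` I) \<in> key ` I" using ne Suc.prems(1) by (intro Max_in) auto
  then obtain x where x: "x \<in> I" "key x = Max (key ` I)" by auto
  then have xmax: "key j \<le> key x" if "j \<in> I" for j using that Suc.prems(1) by simp
  define I' where "I' = I - {x}"
  define B' where "B' = insert (a x) (B - {b x})"
  have x6: "a x \<notin> B" "b x \<in> B" "exch B (a x) (b x)" using Suc.prems(6)[OF x(1)] by auto
  have fB': "finite B'" using Suc.prems(2) by (simp add: B'_def)
  have sB': "sparse B'" unfolding B'_def
    by (rule sparse_exchange[OF Suc.prems(2,3) x6])
  \<comment> \<open>Since \<open>key x\<close> is largest, \<open>b x\<close> is not on the circuit
    of \<open>a i\<close>: some tight set around \<open>a i\<close> misses \<open>b x\<close>, and
    therefore also \<open>a x\<close>. The exchange at \<open>x\<close> does not affect it.\<close>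
  have sep: "\<exists>X. tight B X \<and> tight B' X \<and> tl (a i) \<in> X \<and> hd (a i) \<in> X
      \<and> \<not> (tl (a x) \<in> X \<and> hd (a x) \<in> X) \<and> \<not> (tl (b x) \<in> X \<and> hd (b x) \<in> X)" if i: "i \<in> I'" for i
  proof -
    have "\<not> exch B (a i) (b x)"
      using Suc.prems(7)[of i x] xmax[of i] i x(1) by (auto simp: I'_def)
    then obtain X where X: "tight B X" "tl (a i) \<in> X" "hd (a i) \<in> X" "\<not> (tl (b x) \<in> X \<and> hd (b x) \<in> X)"
      by (auto simp: exch_def)
    then have na: "\<not> (tl (a x) \<in> X \<and> hd (a x) \<in> X)" using x6(3) by (auto simp: exch_def)
    then have "inner B' X = inner B X" using X(4) by (auto simp: inner_def B'_def)
    then have "tight B' X" using X(1) by (simp add: tight_def)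
    with X na show ?thesis by blast
  qed
  \<comment> \<open>Inside the separating set \<open>X\<close> nothing changes, and by uncrossing,
    each tight set around \<open>a i\<close> may be replaced by its intersection with
    \<open>X\<close>, before the exchange as well as after it.\<close>
  have transfer: "exch B' (a i) e \<longleftrightarrow> exch B (a i) e" if i: "i \<in> I'" for i e
  proof -
    obtain X where X: "tight B X" "tight B' X" "tl (a i) \<in> X" "hd (a i) \<in> X"
      "\<not> (tl (a x) \<in> X \<and> hd (a x) \<in> X)" "\<not> (tl (b x) \<in> X \<and> hd (b x) \<in> X)"
      using sep[OF i] by blast
    have sub: "tight B' Y \<longleftrightarrow> tight B Y" if "Y \<subseteq> X" for Y
    proof -
      have "inner B' Y = inner B Y" using X(5,6) that by (auto simp: inner_def B'_def)
      then show ?thesis by (simp add: tight_def)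
    qed
    show ?thesis
    proof
      assume e: "exch B' (a i) e"
      show "exch B (a i) e" unfolding exch_def
      proof (intro allI impI)
        fix Y assume Y: "tight B Y" "tl (a i) \<in> Y" "hd (a i) \<in> Y"
        have "tight B (X \<inter> Y)" using tight_uncross(1)[OF Suc.prems(2,3) X(1) Y(1)] X Y by blast
        then have "tight B' (X \<inter> Y)" using sub by blast
        then show "tl e \<in> Y \<and> hd e \<in> Y" using e X Y unfolding exch_def by blast
      qed
    next
      assume e: "exch B (a i) e"
      show "exch B' (a i) e" unfolding exch_def
      proof (intro allI impI)
        fix Y assume Y: "tight B' Y" "tl (a i) \<in> Y" "hd (a i) \<in> Y"
        have "tight B' (X \<inter> Y)" using tight_uncross(1)[OF fB' sB' X(2) Y(1)] X Y by blast
        then have "tight B (X \<inter> Y)" using sub by blast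
        then show "tl e \<in> Y \<and> hd e \<in> Y" using e X Y unfolding exch_def by blast
      qed
    qed
  qed
  have ne_a: "a i \<noteq> a x" and ne_b: "b i \<noteq> b x" if "i \<in> I'" for i
    using that Suc.prems(4,5) x(1) by (auto simp: I'_def inj_on_def)
  have "sparse (B' - b ` I' \<union> a ` I')"
  proof (rule Suc.hyps(1))
    show "n = card I'" using Suc.hyps(2) Suc.prems(1) x(1) by (simp add: I'_def)
    show "finite I'" using Suc.prems(1) by (simp add: I'_def)
    show "inj_on a I'" "inj_on b I'" using Suc.prems(4,5) by (auto simp: I'_def inj_on_def)
    show "a i \<notin> B' \<and> b i \<in> B' \<and> exch B' (a i) (b i)" if "i \<in> I'" for i
      using Suc.prems(6)[of i] that ne_a[OF that] ne_b[OF that] transfer[OF that]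
      by (auto simp: I'_def B'_def)
    show "key j < key i" if "i \<in> I'" "j \<in> I'" "i \<noteq> j" "exch B' (a i) (b j)" for i j
      using Suc.prems(7)[of i j] that transfer[OF that(1)] by (auto simp: I'_def)
  qed (use fB' sB' in auto)
  moreover have "B' - b ` I' \<union> a ` I' = B - b ` I \<union> a ` I"
  proof -
    have bB: "b ` I \<subseteq> B" and aB: "a ` I \<inter> B = {}" using Suc.prems(6) by auto
    have I: "I = insert x I'" using x(1) by (auto simp: I'_def)
    show ?thesis using bB aB x6 unfolding I B'_def by auto
  qed
  ultimately show ?case by simp
qed

end

section \<open>Improving a cover along a negative closed walk\<close>

locale weighted_arcs = arcs tl hd V for tl hd :: "'e \<Rightarrow> 'v" and V +
  fixes c :: "'e \<Rightarrow> int" and E :: "'e set"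
  assumes finE: "finite E"
    and head_V: "\<And>e. e \<in> E \<Longrightarrow> tl e \<noteq> hd e \<Longrightarrow> hd e \<in> V"
begin

definition step :: "'e set \<Rightarrow> 'e \<Rightarrow> 'e \<Rightarrow> bool" where
  "step B a b \<longleftrightarrow> a \<in> E \<and> a \<notin> B \<and> tl a \<noteq> hd a \<and> b \<in> B \<and> exch B a b"

text \<open>The exchange graph of the two matroids, contracted. After leaving by \<open>b\<close>,
  the partition matroid only asks that the next entering arc has the same head, so a pair
  \<open>(a, b)\<close> acts as an edge from \<open>hd a\<close> to \<open>hd b\<close>.\<close>

fun walk :: "'e set \<Rightarrow> 'v \<Rightarrow> ('e \<times> 'e) list \<Rightarrow> 'v \<Rightarrow> bool" where
  "walk B u [] v \<longleftrightarrow> u = v"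
| "walk B u (p # ps) v \<longleftrightarrow> step B (fst p) (snd p) \<and> hd (fst p) = u \<and> walk B (hd (snd p)) ps v"

definition wt :: "('e \<times> 'e) list \<Rightarrow> int" where
  "wt ps = (\<Sum>p\<leftarrow>ps. c (fst p) - c (snd p))"

lemma wt_simps [simp]: "wt [] = 0" "wt (p # ps) = c (fst p) - c (snd p) + wt ps"
  "wt (ps @ qs) = wt ps + wt qs"
  by (simp_all add: wt_def)

lemma walk_append: "walk B u (ps @ qs) v \<longleftrightarrow> (\<exists>w. walk B u ps w \<and> walk B w qs v)"
  by (induction ps arbitrary: u) auto

lemma walk_start: "walk B u ps v \<Longrightarrow> ps \<noteq> [] \<Longrightarrow> u = hd (fst (ps ! 0))"
  by (cases ps) auto

lemma walk_steps: "walk B u ps v \<Longrightarrow> p \<in> set ps \<Longrightarrow> step B (fst p) (snd p)"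
  by (induction ps arbitrary: u) auto

lemma walk_heads_V: "walk B u ps v \<Longrightarrow> set (map (\<lambda>p. hd (fst p)) ps) \<subseteq> V"
  using walk_steps head_V by (fastforce simp: step_def)

text \<open>A walk with more than \<open>card V\<close> steps repeats a head; the closed part in
  between has nonnegative weight and is cut out.\<close>

lemma walk_shortcut:
  assumes nn: "\<And>u qs. walk B u qs u \<Longrightarrow> 0 \<le> wt qs" and "walk B u ps v"
  shows "\<exists>qs. walk B u qs v \<and> length qs \<le> card V \<and> wt qs \<le> wt ps"
  using assms(2)
proof (induction "length ps" arbitrary: ps rule: less_induct)
  case less
  show ?case
  proof (cases "length ps \<le> card V")
    case True
    then show ?thesis using less.prems by blast
  next
    case False
    let ?vs = "map (\<lambda>p. hd (fst p)) ps"
    have "\<not> distinct ?vs"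
    proof
      assume "distinct ?vs"
      then have "length ?vs = card (set ?vs)" by (rule distinct_card[symmetric])
      also have "\<dots> \<le> card V" using walk_heads_V[OF less.prems] finV by (intro card_mono)
      finally show False using False by simp
    qed
    then obtain xs y ys zs where d: "?vs = xs @ [y] @ ys @ [y] @ zs"
      using not_distinct_decomp by blast
    then obtain p1 p2 where p: "ps = p1 @ p2" "map (\<lambda>p. hd (fst p)) p1 = xs"
      "map (\<lambda>p. hd (fst p)) p2 = [y] @ ys @ [y] @ zs"
      by (auto simp: map_eq_append_conv)
    have "map (\<lambda>p. hd (fst p)) p2 = ([y] @ ys) @ ([y] @ zs)" using p(3) by simp
    then have "map (\<lambda>p. hd (fst p)) (take (Suc (length ys)) p2) = [y] @ ys"
      "map (\<lambda>p. hd (fst p)) (drop (Suc (length ys)) p2) = [y] @ zs"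
      by (simp_all add: take_map[symmetric] drop_map[symmetric])
    then obtain p3 p4 where q: "p2 = p3 @ p4" "map (\<lambda>p. hd (fst p)) p3 = [y] @ ys"
      "map (\<lambda>p. hd (fst p)) p4 = [y] @ zs"
      using append_take_drop_id by metis
    obtain w1 w2 where w: "walk B u p1 w1" "walk B w1 p3 w2" "walk B w2 p4 v"
      using less.prems p(1) q(1) by (auto simp: walk_append)
    have ne: "p3 \<noteq> []" "p4 \<noteq> []" using q by auto
    have "hd (fst (p3 ! 0)) = y" "hd (fst (p4 ! 0)) = y"
      using q(2,3) ne by (metis append_Cons length_greater_0_conv nth_Cons_0 nth_map)+
    then have "w1 = y" "w2 = y" using walk_start[OF w(2) ne(1)] walk_start[OF w(3) ne(2)] by auto
    then have w': "walk B u (p1 @ p4) v" "0 \<le> wt p3" using w nn[of y p3] by (auto simp: walk_append)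
    have "length (p1 @ p4) < length ps" using p(1) q(1) ne by simp
    then obtain qs where "walk B u qs v" "length qs \<le> card V" "wt qs \<le> wt (p1 @ p4)"
      using less.hyps w'(1) by blast
    moreover have "wt (p1 @ p4) \<le> wt ps" using w'(2) p(1) q(1) by simp
    ultimately show ?thesis by force
  qed
qed

text \<open>Every vertex is the head of exactly two arcs, so a potential on the heads adds the same
  constant to all regular sets and does not affect their comparison.\<close>

lemma sum_shift_regular:
  assumes "regular B"
  shows "(\<Sum>a\<in>B. c a + \<pi> (hd a)) = sum c B + (\<Sum>v\<in>V. 2 * \<pi> v)"
proof -
  have fB: "finite B" using assms by (simp add: regular_def)
  have "(\<Sum>a\<in>B. \<pi> (hd a)) = (\<Sum>v\<in>V. \<Sum>a\<in>{a\<in>B. hd a = v}. \<pi> (hd a))"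
    using assms finV by (intro sum.group[symmetric]) (auto simp: regular_def)
  also have "\<dots> = (\<Sum>v\<in>V. 2 * \<pi> v)"
    using assms by (intro sum.cong refl) (auto simp: regular_def)
  finally show ?thesis by (simp add: sum.distrib)
qed

text \<open>Without negative closed walks, the least weights of walks ending in a vertex are
  potentials. Adding them to the costs makes every single exchange unprofitable, so
  \<open>cheapest_if_exchange_stable\<close> applies, and the shift cancels.\<close>

lemma optimal_if_no_negative_walk:
  assumes nn: "\<And>u qs. walk B u qs u \<Longrightarrow> 0 \<le> wt qs"
    and B: "regular B" "covers B" "B \<subseteq> E" and C: "regular C" "covers C" "C \<subseteq> E"
  shows "sum c B \<le> sum c C"
proof -
  define S where "S v = {ps. (\<exists>u. walk B u ps v) \<and> length ps \<le> card V}" for v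
  \<comment> \<open>Walks may start anywhere, so the empty walk makes \<open>S v\<close> nonempty;
    the length bound makes it finite and loses nothing by \<open>walk_shortcut\<close>.\<close>
  define \<pi> where "\<pi> v = Min (wt ` S v)" for v
  have finS: "finite (S v)" for v
  proof (rule finite_subset)
    show "S v \<subseteq> {ps. set ps \<subseteq> E \<times> E \<and> length ps \<le> card V}"
      using walk_steps B(3) by (fastforce simp: S_def step_def)
    show "finite {ps. set ps \<subseteq> E \<times> E \<and> length ps \<le> card V}"
      using finE by (intro finite_lists_length_le) simp
  qed
  have neS: "S v \<noteq> {}" for v
  proof -
    have "[] \<in> S v" by (simp add: S_def)
    then show ?thesis by blast
  qed
  have edge: "\<pi> (hd b) \<le> \<pi> (hd a) + c a - c b" if st: "step B a b" for a b
  proof -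
    have "\<pi> (hd a) \<in> wt ` S (hd a)" unfolding \<pi>_def using finS neS by (intro Min_in) auto
    then obtain u ps where ps: "walk B u ps (hd a)" "\<pi> (hd a) = wt ps" by (auto simp: S_def)
    have "walk B u (ps @ [(a, b)]) (hd b)" using ps(1) st by (auto simp: walk_append)
    then have "\<exists>qs. walk B u qs (hd b) \<and> length qs \<le> card V \<and> wt qs \<le> wt (ps @ [(a, b)])"
      using nn by (intro walk_shortcut)
    then obtain qs where qs: "walk B u qs (hd b)" "length qs \<le> card V" "wt qs \<le> wt (ps @ [(a, b)])"
      by blast
    then have "\<pi> (hd b) \<le> wt qs" unfolding \<pi>_def using finS by (intro Min_le) (auto simp: S_def)
    then show ?thesis using qs(3) ps(2) by simp
  qed
  have "(\<Sum>a\<in>B. c a + \<pi> (hd a)) \<le> (\<Sum>a\<in>C. c a + \<pi> (hd a))"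
  proof (rule cheapest_if_exchange_stable[OF B(1,2) C(1,2)])
    fix a b assume "a \<in> C - B" "b \<in> B" "exch B a b"
    then have "step B a b" using C by (auto simp: step_def regular_def)
    then show "c b + \<pi> (hd b) \<le> c a + \<pi> (hd a)" using edge by force
  qed
  then show ?thesis using sum_shift_regular[OF B(1)] sum_shift_regular[OF C(1)] by simp
qed

text \<open>
  A chord \<open>(a i, b j)\<close> of a shortest negative closed walk cuts off a shorter closed walk, whose
  weight is therefore nonnegative. In terms of the partial sums of the walk this orders the pairs.
\<close>

lemma shortest_negative_walk_improves:
  assumes B: "regular B" "covers B" "B \<subseteq> E"
    and ps: "walk B s ps s" "wt ps < 0"
    and short: "\<And>u qs. walk B u qs u \<Longrightarrow> wt qs < 0 \<Longrightarrow> length ps \<le> length qs"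
  shows "length ps \<le> card V" "0 < length ps"
    "covers (B - snd ` set ps \<union> fst ` set ps)"
    "sum c (B - snd ` set ps \<union> fst ` set ps) < sum c B"
proof -
  define k where "k = length ps"
  define a where "a i = fst (ps ! i)" for i
  define b where "b i = snd (ps ! i)" for i
  \<comment> \<open>The value at \<open>k\<close> repeats the start, so that
    \<open>hd (b i) = vx (Suc i)\<close> also holds for the last pair.\<close>
  define vx where "vx i = (if i < k then hd (a i) else s)" for i
  have fB: "finite B" using B by (simp add: regular_def)
  show k0: "0 < length ps" using ps(2) by (cases ps) auto
  have kpos: "0 < k" using k0 by (simp add: k_def)
  have split: "walk B s (take i ps) (vx i) \<and> walk B (vx i) (drop i ps) s" if "i \<le> k" for i
  proof -
    have "walk B s (take i ps @ drop i ps) s" using ps(1) by simp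
    then obtain w where w: "walk B s (take i ps) w" "walk B w (drop i ps) s"
      unfolding walk_append by blast
    have "w = vx i"
    proof (cases "i < k")
      case True
      then have "drop i ps \<noteq> []" by (simp add: k_def)
      then have "w = hd (fst (drop i ps ! 0))" using walk_start[OF w(2)] by blast
      then show ?thesis using True by (simp add: vx_def a_def k_def)
    next
      case False
      then show ?thesis using w(2) that by (simp add: vx_def k_def)
    qed
    with w show ?thesis by simp
  qed
  have seg: "walk B (vx i) (drop i (take j ps)) (vx j)" if "i \<le> j" "j \<le> k" for i j
  proof -
    have "walk B s (take i (take j ps) @ drop i (take j ps)) (vx j)"
      unfolding append_take_drop_id using split[OF that(2)] by blast
    then obtain w where w: "walk B s (take i (take j ps)) w" "walk B w (drop i (take j ps)) (vx j)"
      unfolding walk_append by blast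
    have eq: "u = w" if "walk B s qs u" "walk B s qs w" for qs u w
      using that by (induction qs arbitrary: s) auto
    have "take i (take j ps) = take i ps" using that by (simp add: min_def)
    then have "w = vx i" using w(1) split[of i] that eq by simp
    with w(2) show ?thesis by simp
  qed
  have st: "step B (a i) (b i)" if "i < k" for i
    using walk_steps[OF ps(1), of "ps ! i"] that by (simp add: a_def b_def k_def)
  have hb: "hd (b i) = vx (Suc i)" if "i < k" for i
  proof -
    have "drop i (take (Suc i) ps) = [ps ! i]" using that
      by (metis k_def Cons_nth_drop_Suc drop_take take_Suc_Cons take0 Suc_diff_le diff_self_eq_0 order_refl)
    then show ?thesis using seg[of i "Suc i"] that by (simp add: b_def)
  qed
  have vx0: "vx 0 = s" using walk_start[OF ps(1)] kpos by (auto simp: vx_def a_def k_def)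
  have vxk: "vx k = s" by (simp add: vx_def)
  have nonneg: "0 \<le> wt qs" if "walk B u qs u" "length qs < k" for u qs
    using short[OF that(1)] that(2) by (force simp: k_def)
  define W where "W i = wt (take i ps)" for i
  have Wseg: "wt (drop i (take j ps)) = W j - W i" if "i \<le> j" for i j
  proof -
    have "take j ps = take i ps @ drop i (take j ps)"
      using that by (metis append_take_drop_id min.absorb1 take_take)
    then have "W j = W i + wt (drop i (take j ps))" unfolding W_def by (metis wt_simps(3))
    then show ?thesis by simp
  qed
  have Wk: "W k = wt ps" by (simp add: W_def k_def)
  have WSuc: "W (Suc i) = W i + c (a i) - c (b i)" if "i < k" for i
    using that by (simp add: W_def take_Suc_conv_app_nth k_def a_def b_def)
  \<comment> \<open>A repeated head would split the walk into two shorter closed walks, one of which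
    is negative.\<close>
  have inj_vx: "vx i \<noteq> vx j" if ij: "i < j" "j < k" for i j
  proof
    assume eq: "vx i = vx j"
    have "0 \<le> wt (drop i (take j ps))"
      using seg[of i j] eq ij by (intro nonneg[of "vx i"]) (auto simp: k_def)
    moreover have "walk B s (take i ps @ drop j ps) s"
      using split[of i] split[of j] eq ij by (auto simp: walk_append)
    then have "0 \<le> wt (take i ps @ drop j ps)" using ij by (intro nonneg[of s]) (auto simp: k_def)
    moreover have "wt (drop j ps) = W k - W j" using Wseg[of j k] ij by (simp add: k_def)
    ultimately show False using ps(2) Wseg[of i j] ij Wk by (simp add: W_def)
  qed
  have inj_a: "inj_on a {..<k}"
  proof (rule linorder_inj_onI)
    fix i j assume "i < j" "i \<in> {..<k}" "j \<in> {..<k}"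
    then show "a i \<noteq> a j" using inj_vx[of i j] by (auto simp: vx_def)
  qed auto
  have inj_b: "inj_on b {..<k}"
  proof (rule linorder_inj_onI)
    fix i j assume ij: "i < j" "i \<in> {..<k}" "j \<in> {..<k}"
    show "b i \<noteq> b j"
    proof (cases "Suc j < k")
      case True
      then show ?thesis using inj_vx[of "Suc i" "Suc j"] ij hb[of i] hb[of j] by auto
    next
      case False
      then have "Suc j = k" using ij by simp
      then have "hd (b j) = vx 0" using hb ij vxk vx0 by simp
      moreover have "vx 0 \<noteq> vx (Suc i)" using inj_vx[of 0 "Suc i"] ij \<open>Suc j = k\<close> by simp
      ultimately show ?thesis using hb[of i] ij by force
    qed
  qed auto
  have "card (vx ` {..<k}) = k"
  proof -
    have "inj_on vx {..<k}" using inj_vx by (intro linorder_inj_onI) auto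
    then show ?thesis by (simp add: card_image)
  qed
  moreover have "vx ` {..<k} \<subseteq> V" using st head_V by (auto simp: vx_def step_def)
  ultimately show "length ps \<le> card V" using card_mono[OF finV] by (metis k_def)
  \<comment> \<open>Equal to \<open>W i + c (a i)\<close>: the partial sum when \<open>a i\<close>
    is already counted and \<open>b i\<close> is not yet.\<close>
  define \<psi> where "\<psi> i = c (b i) + W (Suc i)" for i
  \<comment> \<open>The closed walk through the chord has weight \<open>\<psi> i - \<psi> j\<close>
    if \<open>j < i\<close>. If \<open>i < j\<close> it goes round through \<open>s\<close> and has
    weight \<open>\<psi> i - \<psi> j + W k\<close>; there \<open>W k < 0\<close> makes the
    inequality strict. Both are shorter than \<open>ps\<close>.\<close>
  have chord: "\<psi> j < \<psi> i \<or> \<psi> j = \<psi> i \<and> j < i"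
    if ij: "i < k" "j < k" "i \<noteq> j" "exch B (a i) (b j)" for i j
  proof -
    have s: "step B (a i) (b j)" using st[OF ij(1)] st[OF ij(2)] ij(4) by (simp add: step_def)
    show ?thesis
    proof (cases "j < i")
      case True
      let ?qs = "(a i, b j) # drop (Suc j) (take i ps)"
      have "walk B (vx i) ?qs (vx i)"
        using s hb[OF ij(2)] seg[of "Suc j" i] True ij by (simp add: vx_def)
      then have "0 \<le> wt ?qs" using True ij by (intro nonneg) (auto simp: k_def)
      then have "0 \<le> c (a i) - c (b j) + (W i - W (Suc j))" using Wseg[of "Suc j" i] True by simp
      then show ?thesis using WSuc[OF ij(1)] True by (auto simp: \<psi>_def)
    next
      case False
      let ?qs = "(a i, b j) # drop (Suc j) (take k ps) @ take i ps"
      have "walk B (vx (Suc j)) (drop (Suc j) (take k ps) @ take i ps) (vx i)"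
        unfolding walk_append using seg[of "Suc j" k] split[of i] ij vxk by auto
      then have "walk B (vx i) ?qs (vx i)" using s hb[OF ij(2)] ij by (simp add: vx_def)
      then have "0 \<le> wt ?qs" using False ij by (intro nonneg) (auto simp: k_def)
      then have "0 \<le> c (a i) - c (b j) + (W k - W (Suc j)) + W i"
        using Wseg[of "Suc j" k] ij by (simp add: W_def)
      then show ?thesis using WSuc[OF ij(1)] Wk ps(2) by (auto simp: \<psi>_def)
    qed
  qed
  \<comment> \<open>The lexicographic order of \<open>(\<psi> i, i)\<close> as a single integer:
    indices are below \<open>Suc k\<close>.\<close>
  have key: "\<psi> j * int (Suc k) + int j < \<psi> i * int (Suc k) + int i"
    if ij: "i < k" "j < k" "i \<noteq> j" "exch B (a i) (b j)" for i j
    using chord[OF ij]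
  proof
    assume "\<psi> j < \<psi> i"
    then have "(\<psi> j + 1) * int (Suc k) \<le> \<psi> i * int (Suc k)" by (intro mult_right_mono) auto
    then show ?thesis using ij by (simp add: algebra_simps)
  qed simp
  have "set ps = (\<lambda>i. ps ! i) ` {..<k}"
    by (metis k_def atLeast_upt list.set_map map_nth)
  then have imgs: "a ` {..<k} = fst ` set ps" "b ` {..<k} = snd ` set ps"
    by (simp_all add: a_def b_def image_image)
  let ?B = "B - b ` {..<k} \<union> a ` {..<k}"
  have aB: "a ` {..<k} \<inter> B = {}" and bB: "b ` {..<k} \<subseteq> B" using st by (auto simp: step_def)
  have sp: "sparse ?B"
  proof (rule sparse_exchange_ordered)
    show "sparse B" using B covers_iff_sparse by blast
    show "\<psi> j * int (Suc k) + int j < \<psi> i * int (Suc k) + int i"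
      if "i \<in> {..<k}" "j \<in> {..<k}" "i \<noteq> j" "exch B (a i) (b j)" for i j
      using key[of i j] that by auto
  qed (use fB inj_a inj_b st in \<open>auto simp: step_def\<close>)
  have reg: "regular ?B"
    unfolding regular_def
  proof (intro conjI ballI)
    show "finite ?B" using fB by simp
    fix v assume v: "v \<in> V"
    let ?a = "{i. i < k \<and> hd (a i) = v}" and ?b = "{i. i < k \<and> hd (b i) = v}"
    have "card ?b \<le> card ?a \<and> card ?a \<le> card ?b"
    proof
      \<comment> \<open>The removed arc \<open>b i\<close> and the next inserted arc, cyclically,
        have the same head. So insertions and removals balance at every vertex.\<close>
      have suc: "hd (b i) = hd (a (if Suc i = k then 0 else Suc i))" if "i < k" for i
        using hb[OF that] that vxk vx0 kpos by (auto simp: vx_def)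
      show "card ?b \<le> card ?a"
      proof (rule card_inj_on_le[of "\<lambda>i. if Suc i = k then 0 else Suc i"])
        show "inj_on (\<lambda>i. if Suc i = k then 0 else Suc i) ?b" by (auto simp: inj_on_def split: if_splits)
        show "(\<lambda>i. if Suc i = k then 0 else Suc i) ` ?b \<subseteq> ?a" using suc kpos by auto
      qed simp
      show "card ?a \<le> card ?b"
      proof (rule card_inj_on_le[of "\<lambda>i. if i = 0 then k - 1 else i - 1"])
        show "inj_on (\<lambda>i. if i = 0 then k - 1 else i - 1) ?a"
          by (auto simp: inj_on_def split: if_splits)
        show "(\<lambda>i. if i = 0 then k - 1 else i - 1) ` ?a \<subseteq> ?b"
        proof
          fix j assume "j \<in> (\<lambda>i. if i = 0 then k - 1 else i - 1) ` ?a"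
          then obtain i where i: "i < k" "hd (a i) = v" "j = (if i = 0 then k - 1 else i - 1)" by auto
          then show "j \<in> ?b" using suc[of j] kpos by (auto split: if_splits)
        qed
      qed simp
    qed
    moreover have "card (a ` ?a) = card ?a" "card (b ` ?b) = card ?b"
      using inj_a inj_b by (auto intro!: card_image intro: inj_on_subset)
    ultimately have cab: "card (a ` ?a) = card (b ` ?b)" by simp
    have "{e\<in>?B. hd e = v} = ({e\<in>B. hd e = v} - b ` ?b) \<union> a ` ?a" by auto
    moreover have "({e\<in>B. hd e = v} - b ` ?b) \<inter> a ` ?a = {}" using aB by auto
    moreover have "finite {e\<in>B. hd e = v}" using fB by simp
    moreover have "b ` ?b \<subseteq> {e\<in>B. hd e = v}" using bB by auto
    ultimately have "card {e\<in>?B. hd e = v} = card {e\<in>B. hd e = v} - card (b ` ?b) + card (a ` ?a)"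
      "card (b ` ?b) \<le> card {e\<in>B. hd e = v}"
      by (simp_all add: card_Un_disjoint card_Diff_subset finite_subset card_mono)
    then show "card {e\<in>?B. hd e = v} = 2" using cab v B by (simp add: regular_def)
  next
    fix e assume "e \<in> ?B"
    then show "tl e \<noteq> hd e" "hd e \<in> V" using B st head_V by (auto simp: regular_def step_def)
  qed
  show "covers (B - snd ` set ps \<union> fst ` set ps)" using covers_iff_sparse[OF reg] sp imgs by simp
  have "sum c ?B = sum c B - sum c (b ` {..<k}) + sum c (a ` {..<k})"
    using fB aB bB by (subst sum.union_disjoint) (auto simp: sum_diff)
  also have "\<dots> = sum c B + (\<Sum>i<k. c (a i) - c (b i))"
    using inj_a inj_b by (simp add: sum.reindex sum_subtractf)
  also have "(\<Sum>i<k. c (a i) - c (b i)) = wt ps"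
    unfolding wt_def by (simp add: sum_list_sum_nth a_def b_def k_def atLeast0LessThan)
  finally show "sum c (B - snd ` set ps \<union> fst ` set ps) < sum c B" using ps(2) imgs by simp
qed

text \<open>The guarantee covers every negative closed walk of \<open>k\<close> steps at
  \<open>s\<close>, because the algorithm uses whichever walk its table yields. \<open>C\<close> may
  be any cheaper cover: as costs are nonnegative, it is replaced by a regular subcover.\<close>

theorem improving_walk_exists:
  assumes B: "regular B" "covers B" "B \<subseteq> E" and C: "covers C" "C \<subseteq> E" "sum c C < sum c B"
    and pos: "\<And>e. e \<in> E \<Longrightarrow> 0 \<le> c e"
  shows "\<exists>k s. 0 < k \<and> k \<le> card V \<and> s \<in> V \<and> (\<exists>ps. walk B s ps s \<and> length ps = k \<and> wt ps < 0) \<and>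
    (\<forall>ps. walk B s ps s \<longrightarrow> length ps = k \<longrightarrow> wt ps < 0 \<longrightarrow>
       covers (B - snd ` set ps \<union> fst ` set ps) \<and>
       sum c (B - snd ` set ps \<union> fst ` set ps) < sum c B)"
proof -
  have "finite C" using C(2) finE finite_subset by blast
  then obtain D where D: "D \<subseteq> C" "covers D" "regular D"
    using cover_has_regular_subcover C(1) by blast
  have "sum c D \<le> sum c C" using D(1) C(2) pos \<open>finite C\<close> by (intro sum_mono2) auto
  then have "\<not> sum c B \<le> sum c D" using C(3) by simp
  then have "\<exists>u qs. walk B u qs u \<and> wt qs < 0"
    using optimal_if_no_negative_walk[OF _ B D(3,2)] D(1) C(2) by (meson not_less order_trans)
  then have "\<exists>k u qs. walk B u qs u \<and> wt qs < 0 \<and> length qs = k" by blast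
  then obtain k where k: "\<exists>u qs. walk B u qs u \<and> wt qs < 0 \<and> length qs = k"
    and kmin: "\<And>l. l < k \<Longrightarrow> \<not> (\<exists>u qs. walk B u qs u \<and> wt qs < 0 \<and> length qs = l)"
    using exists_least_iff[of "\<lambda>k. \<exists>u qs. walk B u qs u \<and> wt qs < 0 \<and> length qs = k"] by blast
  then obtain s qs where qs: "walk B s qs s" "wt qs < 0" "length qs = k" by blast
  have short: "length ps \<le> length rs" if "length ps = k" "walk B u rs u" "wt rs < 0" for u rs ps
  proof (rule ccontr)
    assume "\<not> length ps \<le> length rs"
    then have "length rs < k" using that(1) by simp
    from kmin[OF this] that(2,3) show False by blast
  qed
  note imp = shortest_negative_walk_improves[OF B]
  have k1: "0 < k" "k \<le> card V"
    using imp(1,2)[OF qs(1,2) short[OF qs(3)]] qs(3) by simp_all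
  have sV: "s \<in> V"
    using walk_heads_V[OF qs(1)] walk_start[OF qs(1)] qs(3) k1(1) by (force simp: in_set_conv_nth)
  have "covers (B - snd ` set ps \<union> fst ` set ps) \<and>
       sum c (B - snd ` set ps \<union> fst ` set ps) < sum c B"
    if "walk B s ps s" "length ps = k" "wt ps < 0" for ps
    using imp(3,4)[OF that(1,3) short[OF that(2)]] by simp
  then show ?thesis using k1 sV qs by (intro exI[of _ k] exI[of _ s]) auto
qed

end

section \<open>A structured language compiled to the random access machine\<close>

datatype loc = Var nat | Arr nat nat

type_synonym store = "loc \<Rightarrow> nat"

datatype exp = N nat | V nat | A nat exp | Plus exp exp | Minus exp exp

fun ev :: "exp \<Rightarrow> store \<Rightarrow> nat" where
  "ev (N n) \<sigma> = n"
| "ev (V x) \<sigma> = \<sigma> (Var x)"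
| "ev (A j e) \<sigma> = \<sigma> (Arr j (ev e \<sigma>))"
| "ev (Plus e f) \<sigma> = ev e \<sigma> + ev f \<sigma>"
| "ev (Minus e f) \<sigma> = ev e \<sigma> - ev f \<sigma>"

text \<open>
  \<open>For x c\<close> runs \<open>c\<close> with \<open>x = 0, 1, \<dots>\<close> exactly as many times as variable \<open>0\<close> says. All loops have
  this common bound, so the running time of a command is determined by its syntax.
\<close>

datatype com = Assign nat exp | Put nat exp exp | Seq com com (infixr ";;" 60) | If exp com com | For nat com

primrec exec :: "com \<Rightarrow> store \<Rightarrow> store" where
  "exec (Assign x e) = (\<lambda>\<sigma>. \<sigma>(Var x := ev e \<sigma>))"
| "exec (Put j e f) = (\<lambda>\<sigma>. \<sigma>(Arr j (ev e \<sigma>) := ev f \<sigma>))"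
| "exec (Seq c d) = (\<lambda>\<sigma>. exec d (exec c \<sigma>))"
| "exec (If e c d) = (\<lambda>\<sigma>. if ev e \<sigma> \<noteq> 0 then exec c \<sigma> else exec d \<sigma>)"
| "exec (For x c) = (\<lambda>\<sigma>. ((\<lambda>\<tau>. (exec c \<tau>)(Var x := Suc (exec c \<tau> (Var x)))) ^^ \<sigma> (Var 0))
      (\<sigma>(Var x := 0)))"

primrec wv :: "com \<Rightarrow> nat set" where
  "wv (Assign x e) = {x}"
| "wv (Put j e f) = {}"
| "wv (Seq c d) = wv c \<union> wv d"
| "wv (If e c d) = wv c \<union> wv d"
| "wv (For x c) = insert x (wv c)"

primrec wa :: "com \<Rightarrow> nat set" where
  "wa (Assign x e) = {}"
| "wa (Put j e f) = {j}"
| "wa (Seq c d) = wa c \<union> wa d"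
| "wa (If e c d) = wa c \<union> wa d"
| "wa (For x c) = wa c"

lemma exec_frame_var: "y \<notin> wv c \<Longrightarrow> exec c \<sigma> (Var y) = \<sigma> (Var y)"
proof (induction c arbitrary: \<sigma>)
  case (For x c)
  have "(((\<lambda>\<tau>. (exec c \<tau>)(Var x := Suc (exec c \<tau> (Var x)))) ^^ n) \<tau>) (Var y) = \<tau> (Var y)" for n \<tau>
    using For by (induction n) auto
  then show ?case using For.prems by simp
qed auto

lemma exec_frame_arr: "j \<notin> wa c \<Longrightarrow> exec c \<sigma> (Arr j i) = \<sigma> (Arr j i)"
proof (induction c arbitrary: \<sigma>)
  case (For x c)
  have "(((\<lambda>\<tau>. (exec c \<tau>)(Var x := Suc (exec c \<tau> (Var x)))) ^^ n) \<tau>) (Arr j i) = \<tau> (Arr j i)" for n \<tau>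
    using For by (induction n) auto
  then show ?case by simp
qed auto

text \<open>
  Memory layout: cell \<open>64 * row + col\<close>; row \<open>0\<close> holds the variables (columns below 48) and
  temporaries, column \<open>j\<close> of the other rows is the array \<open>j\<close>.
\<close>

definition rel :: "store \<Rightarrow> ram_mem \<Rightarrow> bool" where
  "rel \<sigma> s \<longleftrightarrow> (\<forall>x<48. s x = \<sigma> (Var x)) \<and> (\<forall>j<64. \<forall>i. s (64 * Suc i + j) = \<sigma> (Arr j i))"

text \<open>Turns the index in cell \<open>t\<close> into the address of that entry of array
  \<open>j\<close>. Six doublings take the place of a multiplication by 64, so that no instruction
  lengthens numbers by more than one digit.\<close>

definition addr :: "nat \<Rightarrow> nat \<Rightarrow> nat \<Rightarrow> ram_instr list" where
  "addr j t u = [SetC u 1, Add t t u, Add t t t, Add t t t, Add t t t, Add t t t, Add t t t, Add t t t,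
     SetC u j, Add t t u]"

text \<open>The value ends up in cell \<open>t\<close>; the cells from \<open>t\<close> to 63 serve
  as a stack. Clearing \<open>t\<close> and adding imitates a move instruction.\<close>

fun ce :: "nat \<Rightarrow> exp \<Rightarrow> ram_instr list" where
  "ce t (N n) = [SetC t n]"
| "ce t (V x) = [SetC t 0, Add t t x]"
| "ce t (A j e) = ce t e @ addr j t (Suc t) @ [Load t t]"
| "ce t (Plus e f) = ce t e @ ce (Suc t) f @ [Add t t (Suc t)]"
| "ce t (Minus e f) = ce t e @ ce (Suc t) f @ [Sub t t (Suc t)]"

fun wfe :: "nat \<Rightarrow> exp \<Rightarrow> bool" where
  "wfe t (N n) \<longleftrightarrow> t < 64"
| "wfe t (V x) \<longleftrightarrow> t < 64 \<and> x < 48"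
| "wfe t (A j e) \<longleftrightarrow> wfe t e \<and> t < 63 \<and> j < 64"
| "wfe t (Plus e f) \<longleftrightarrow> wfe t e \<and> wfe (Suc t) f"
| "wfe t (Minus e f) \<longleftrightarrow> wfe t e \<and> wfe (Suc t) f"

text \<open>Jump targets are absolute, hence the argument \<open>pc\<close>. An unconditional jump
  is a conditional one on cell 48 just set to zero. A loop ends when the truncated difference of
  cell 0 and the counter is zero.\<close>

fun cc :: "nat \<Rightarrow> com \<Rightarrow> ram_instr list" where
  "cc pc (Assign x e) = ce 48 e @ [SetC 49 0, Add x 48 49]"
| "cc pc (Put j e f) = ce 48 e @ addr j 48 49 @ ce 49 f @ [Store 48 49]"
| "cc pc (Seq c d) = cc pc c @ cc (pc + length (cc pc c)) d"
| "cc pc (If e c d) =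
     (let l = pc + length (ce 48 e) + 1; p = cc l c; q = cc (l + length p + 2) d
      in ce 48 e @ [JmpZ 48 (l + length p + 2)] @ p @
         [SetC 48 0, JmpZ 48 (l + length p + 2 + length q)] @ q)"
| "cc pc (For x c) =
     (let p = cc (pc + 3) c
      in [SetC x 0, Sub 48 0 x, JmpZ 48 (pc + length p + 7)] @ p @
         [SetC 48 1, Add x x 48, SetC 48 0, JmpZ 48 (pc + 1)])"

primrec wfc :: "com \<Rightarrow> bool" where
  "wfc (Assign x e) \<longleftrightarrow> x < 48 \<and> wfe 48 e"
| "wfc (Put j e f) \<longleftrightarrow> j < 64 \<and> wfe 48 e \<and> wfe 49 f"
| "wfc (Seq c d) \<longleftrightarrow> wfc c \<and> wfc d"
| "wfc (If e c d) \<longleftrightarrow> wfe 48 e \<and> wfc c \<and> wfc d"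
| "wfc (For x c) \<longleftrightarrow> x < 48 \<and> x \<noteq> 0 \<and> x \<notin> wv c \<and> wfc c"

primrec tm :: "com \<Rightarrow> nat \<Rightarrow> nat" where
  "tm (Assign x e) R = length (ce 48 e) + 2"
| "tm (Put j e f) R = length (ce 48 e) + length (ce 49 f) + 11"
| "tm (Seq c d) R = tm c R + tm d R"
| "tm (If e c d) R = length (ce 48 e) + 3 + tm c R + tm d R"
| "tm (For x c) R = 3 + R * (tm c R + 6)"

text \<open>A loop raises the degree by one. For two commands run on the same bound the exponents
  are simply added, which dominates both powers since the base is at least 1.\<close>

lemma tm_poly: "\<exists>K D. \<forall>R. tm c R \<le> K * Suc R ^ D"
proof (induction c)
  case (Assign x e)
  show ?case by (rule exI[of _ "length (ce 48 e) + 2"], rule exI[of _ 0]) simp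
next
  case (Put j e f)
  show ?case by (rule exI[of _ "length (ce 48 e) + length (ce 49 f) + 11"], rule exI[of _ 0]) simp
next
  case (Seq c d)
  then obtain K1 D1 K2 D2 where 1: "\<And>R. tm c R \<le> K1 * Suc R ^ D1" and 2: "\<And>R. tm d R \<le> K2 * Suc R ^ D2"
    by blast
  have "tm (Seq c d) R \<le> (K1 + K2) * Suc R ^ (D1 + D2)" for R
  proof -
    have "Suc R ^ D1 \<le> Suc R ^ (D1 + D2)" "Suc R ^ D2 \<le> Suc R ^ (D1 + D2)"
      by (intro power_increasing; simp)+
    then have "K1 * Suc R ^ D1 + K2 * Suc R ^ D2 \<le> K1 * Suc R ^ (D1 + D2) + K2 * Suc R ^ (D1 + D2)"
      by (intro add_mono mult_left_mono) auto
    then show ?thesis using 1[of R] 2[of R] unfolding tm.simps add_mult_distrib by linarith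
  qed
  then show ?case by blast
next
  case (If e c d)
  then obtain K1 D1 K2 D2 where 1: "\<And>R. tm c R \<le> K1 * Suc R ^ D1" and 2: "\<And>R. tm d R \<le> K2 * Suc R ^ D2"
    by blast
  have "tm (If e c d) R \<le> (length (ce 48 e) + 3 + K1 + K2) * Suc R ^ (D1 + D2)" for R
  proof -
    have "Suc R ^ D1 \<le> Suc R ^ (D1 + D2)" "Suc R ^ D2 \<le> Suc R ^ (D1 + D2)"
      by (intro power_increasing; simp)+
    then have "K1 * Suc R ^ D1 + K2 * Suc R ^ D2 \<le> K1 * Suc R ^ (D1 + D2) + K2 * Suc R ^ (D1 + D2)"
      by (intro add_mono mult_left_mono) auto
    moreover have "(length (ce 48 e) + 3) * 1 \<le> (length (ce 48 e) + 3) * Suc R ^ (D1 + D2)"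
      by (intro mult_left_mono) auto
    ultimately show ?thesis using 1[of R] 2[of R] unfolding tm.simps add_mult_distrib by linarith
  qed
  then show ?case by blast
next
  case (For x c)
  then obtain K D where 1: "\<And>R. tm c R \<le> K * Suc R ^ D" by blast
  have "tm (For x c) R \<le> (K + 9) * Suc R ^ Suc D" for R
  proof -
    have p: "1 \<le> Suc R ^ D" by simp
    have "R * (tm c R + 6) \<le> Suc R * (K * Suc R ^ D + 6 * Suc R ^ D)"
      using 1[of R] p by (intro mult_mono add_mono) auto
    moreover have "3 * 1 \<le> 3 * Suc R ^ Suc D" using one_le_power[of "Suc R" "Suc D"] by linarith
    ultimately show ?thesis by (simp add: algebra_simps)
  qed
  then show ?case by blast
qed

subsection \<open>Executing machine code\<close>

text \<open>Idling after the end of the program makes the step function total, so that pieces of a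
  run compose as powers of one function.\<close>

definition stp :: "ram_prog \<Rightarrow> nat \<times> ram_mem \<Rightarrow> nat \<times> ram_mem" where
  "stp p cf = (if fst cf < length p then ram_exec (p ! fst cf) cf else cf)"

definition code_at :: "ram_prog \<Rightarrow> nat \<Rightarrow> ram_instr list \<Rightarrow> bool" where
  "code_at p pc is \<longleftrightarrow> (\<exists>xs ys. p = xs @ is @ ys \<and> length xs = pc)"

lemma code_at_append:
  "code_at p pc (is @ js) \<longleftrightarrow> code_at p pc is \<and> code_at p (pc + length is) js"
proof
  assume "code_at p pc (is @ js)"
  then obtain xs ys where "p = xs @ (is @ js) @ ys" "length xs = pc" by (auto simp: code_at_def)
  then have "p = xs @ is @ (js @ ys) \<and> p = (xs @ is) @ js @ ys \<and> length (xs @ is) = pc + length is"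
    by simp
  then show "code_at p pc is \<and> code_at p (pc + length is) js"
    using \<open>length xs = pc\<close> unfolding code_at_def by blast
next
  assume "code_at p pc is \<and> code_at p (pc + length is) js"
  then obtain xs ys xs' ys' where d: "p = xs @ is @ ys" "length xs = pc" "p = xs' @ js @ ys'"
    "length xs' = pc + length is" unfolding code_at_def by blast
  then have "(xs @ is) @ ys = xs' @ js @ ys'" "length (xs @ is) = length xs'" by auto
  then have "ys = js @ ys'" by (metis append_eq_append_conv)
  then show "code_at p pc (is @ js)" using d by (auto simp: code_at_def)
qed

lemma code_at_Cons: "code_at p pc (i # is) \<longleftrightarrow> pc < length p \<and> p ! pc = i \<and> code_at p (Suc pc) is"
proof -
  have "code_at p pc [i] \<longleftrightarrow> pc < length p \<and> p ! pc = i"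
  proof
    assume "pc < length p \<and> p ! pc = i"
    then have "p = take pc p @ [i] @ drop (Suc pc) p" using id_take_nth_drop[of pc p] by simp
    then show "code_at p pc [i]" using \<open>pc < length p \<and> p ! pc = i\<close>
      unfolding code_at_def by (metis length_take min.absorb4)
  qed (auto simp: code_at_def)
  then show ?thesis using code_at_append[of p pc "[i]" "is"] by simp
qed

fun eff :: "ram_instr \<Rightarrow> ram_mem \<Rightarrow> ram_mem" where
  "eff i s = snd (ram_exec i (0, s))"

definition effs :: "ram_instr list \<Rightarrow> ram_mem \<Rightarrow> ram_mem" where
  "effs is s = fold eff is s"

fun nojump :: "ram_instr \<Rightarrow> bool" where
  "nojump (JmpZ i l) = False"
| "nojump _ = True"

lemma effs_simps [simp]: "effs [] s = s" "effs (i # is) s = effs is (eff i s)"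
  "effs (is @ js) s = effs js (effs is s)"
  by (simp_all add: effs_def)

lemma run_straight:
  assumes "code_at p pc is" "\<forall>i\<in>set is. nojump i"
  shows "(stp p ^^ length is) (pc, s) = (pc + length is, effs is s)"
  using assms
proof (induction "is" arbitrary: pc s)
  case (Cons i "is")
  have "stp p (pc, s) = (Suc pc, eff i s)"
    using Cons.prems by (cases i) (auto simp: stp_def code_at_Cons)
  then show ?case using Cons by (simp add: funpow_swap1 code_at_Cons del: eff.simps)
qed simp

lemma stp_jump:
  assumes "code_at p pc [JmpZ i l]"
  shows "stp p (pc, s) = (if s i = 0 then l else Suc pc, s)"
  using assms by (auto simp: stp_def code_at_Cons)

lemma nojump_addr: "i \<in> set (addr j t u) \<Longrightarrow> nojump i"
  by (auto simp: addr_def)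

lemma nojump_ce: "i \<in> set (ce t e) \<Longrightarrow> nojump i"
  by (induction t e rule: ce.induct) (auto simp: nojump_addr)

lemma length_addr: "length (addr j t u) = 10"
  by (simp add: addr_def)

lemma effs_addr:
  assumes "t \<noteq> u"
  shows "effs (addr j t u) s t = 64 * Suc (s t) + j"
    and "x \<noteq> t \<Longrightarrow> x \<noteq> u \<Longrightarrow> effs (addr j t u) s x = s x"
  using assms by (auto simp: addr_def)

lemma rel_cong:
  assumes "rel \<sigma> s" "\<And>x. x < 48 \<or> 64 \<le> x \<Longrightarrow> s' x = s x"
  shows "rel \<sigma> s'"
  using assms by (simp add: rel_def)

lemma wfe_bound: "wfe t e \<Longrightarrow> t < 64"
  by (induction t e rule: wfe.induct) auto

text \<open>That the cells below \<open>t\<close> survive is what preserves a left operand while the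
  right one is evaluated in \<open>Suc t\<close>.\<close>

lemma effs_ce:
  assumes "rel \<sigma> s" "wfe t e" "48 \<le> t"
  shows "effs (ce t e) s t = ev e \<sigma> \<and> (\<forall>x. x < t \<or> 64 \<le> x \<longrightarrow> effs (ce t e) s x = s x)"
  using assms
proof (induction t e arbitrary: s rule: ce.induct)
  case (3 t j e)
  let ?s = "effs (ce t e) s"
  have IH: "?s t = ev e \<sigma>" "\<forall>x. x < t \<or> 64 \<le> x \<longrightarrow> ?s x = s x" using 3 by auto
  have r: "?s (64 * Suc i + j) = \<sigma> (Arr j i)" for i using IH(2) 3 by (simp add: rel_def)
  let ?s' = "effs (addr j t (Suc t)) ?s"
  have a: "?s' t = 64 * Suc (ev e \<sigma>) + j" using IH by (simp add: effs_addr)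
  have f: "?s' x = s x" if "x < t \<or> 64 \<le> x" for x
    using effs_addr(2)[of t "Suc t" x j ?s] that IH(2) 3 by auto
  have "?s' (64 * Suc (ev e \<sigma>) + j) = \<sigma> (Arr j (ev e \<sigma>))"
    using f[of "64 * Suc (ev e \<sigma>) + j"] r[of "ev e \<sigma>"] IH(2) by simp
  then show ?case using a f 3 by auto
next
  case (4 t e f)
  let ?s = "effs (ce t e) s"
  have IH1: "?s t = ev e \<sigma>" "\<forall>x. x < t \<or> 64 \<le> x \<longrightarrow> ?s x = s x" using 4 by auto
  have "rel \<sigma> ?s" using IH1(2) 4 by (intro rel_cong[OF 4(3)]) auto
  then have "effs (ce (Suc t) f) ?s (Suc t) = ev f \<sigma> \<and>
      (\<forall>x. x < Suc t \<or> 64 \<le> x \<longrightarrow> effs (ce (Suc t) f) ?s x = ?s x)"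
    using 4 by auto
  then show ?case using IH1 4 wfe_bound[of t e] by auto
next
  case (5 t e f)
  let ?s = "effs (ce t e) s"
  have IH1: "?s t = ev e \<sigma>" "\<forall>x. x < t \<or> 64 \<le> x \<longrightarrow> ?s x = s x" using 5 by auto
  have "rel \<sigma> ?s" using IH1(2) 5 by (intro rel_cong[OF 5(3)]) auto
  then have "effs (ce (Suc t) f) ?s (Suc t) = ev f \<sigma> \<and>
      (\<forall>x. x < Suc t \<or> 64 \<le> x \<longrightarrow> effs (ce (Suc t) f) ?s x = ?s x)"
    using 5 by auto
  then show ?case using IH1 5 wfe_bound[of t e] by auto
qed (auto simp: rel_def)

lemma run_ce:
  assumes "code_at p pc (ce t e)" "rel \<sigma> s" "wfe t e" "48 \<le> t"
  shows "\<exists>s'. (stp p ^^ length (ce t e)) (pc, s) = (pc + length (ce t e), s') \<and> s' t = ev e \<sigma> \<and>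
     rel \<sigma> s' \<and> (\<forall>x. x < t \<or> 64 \<le> x \<longrightarrow> s' x = s x)"
proof (intro exI conjI)
  show "(stp p ^^ length (ce t e)) (pc, s) = (pc + length (ce t e), effs (ce t e) s)"
    using run_straight[OF assms(1)] nojump_ce by blast
  show "rel \<sigma> (effs (ce t e) s)"
    using effs_ce[OF assms(2-4)] assms(4) by (intro rel_cong[OF assms(2)]) auto
qed (use effs_ce[OF assms(2-4)] in auto)

lemma cell_inj: "64 * a + j = 64 * b + k \<longleftrightarrow> a = b \<and> j = k" if "j < 64" "k < (64::nat)"
proof
  assume "64 * a + j = 64 * b + k"
  then have "(64 * a + j) div 64 = (64 * b + k) div 64" "(64 * a + j) mod 64 = (64 * b + k) mod 64"
    by simp_all
  then show "a = b \<and> j = k" using that by simp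
qed simp

lemma rel_var_upd: "rel \<sigma> s \<Longrightarrow> x < 48 \<Longrightarrow> rel (\<sigma>(Var x := n)) (s(x := n))"
  by (auto simp: rel_def)

lemma rel_temp_upd: "rel \<sigma> s \<Longrightarrow> 48 \<le> x \<Longrightarrow> x < 64 \<Longrightarrow> rel \<sigma> (s(x := n))"
  by (auto simp: rel_def)

lemma rel_arr_upd:
  assumes "rel \<sigma> s" "j < 64"
  shows "rel (\<sigma>(Arr j i := n)) (s(64 * Suc i + j := n))"
proof -
  have 1: "64 * Suc i' + j' = 64 * Suc i + j \<longleftrightarrow> i' = i \<and> j' = j" if "j' < 64" for i' j'
    using cell_inj[OF that assms(2), of "Suc i'" "Suc i"] by simp
  have 2: "x \<noteq> 64 * Suc i + j" if "x < 48" for x using that by simp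
  show ?thesis using assms 1 2 unfolding rel_def fun_upd_def by simp
qed

lemma funpow_trans: "(f ^^ k) x = y \<Longrightarrow> (f ^^ l) y = z \<Longrightarrow> (f ^^ (k + l)) x = z"
  by (simp add: add.commute[of k] funpow_add)

text \<open>Variable 0 is never written, so all loops, however deeply nested, run with its initial
  value, and \<open>tm\<close> at this value bounds the number of instructions.\<close>

lemma run_cc:
  assumes "wfc c" "0 \<notin> wv c" "code_at p pc (cc pc c)" "rel \<sigma> s"
  shows "\<exists>k s'. k \<le> tm c (\<sigma> (Var 0)) \<and> (stp p ^^ k) (pc, s) = (pc + length (cc pc c), s') \<and>
    rel (exec c \<sigma>) s'"
  using assms
proof (induction c arbitrary: pc \<sigma> s)
  case (Assign x e)
  have w: "x < 48" "wfe 48 e" using Assign by auto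
  let ?is = "ce 48 e @ [SetC 49 0, Add x 48 49]"
  have "(stp p ^^ length ?is) (pc, s) = (pc + length ?is, effs ?is s)"
    using Assign.prems(3) nojump_ce by (intro run_straight) auto
  moreover have "rel (\<sigma>(Var x := ev e \<sigma>)) (effs ?is s)"
  proof -
    have e: "effs (ce 48 e) s 48 = ev e \<sigma>" "rel \<sigma> (effs (ce 48 e) s)"
      using effs_ce[OF Assign.prems(4) w(2)] by (auto intro: rel_cong[OF Assign.prems(4)])
    show ?thesis using rel_var_upd[OF rel_temp_upd[OF e(2), of 49 0] w(1)] e(1) by simp
  qed
  moreover have "length ?is \<le> tm (Assign x e) (\<sigma> (Var 0))" by simp
  ultimately show ?case unfolding cc.simps exec.simps by blast
next
  case (Put j e f)
  have w: "j < 64" "wfe 48 e" "wfe 49 f" using Put by auto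
  let ?s = "effs (ce 48 e) s"
  let ?s1 = "effs (addr j 48 49) ?s"
  let ?s2 = "effs (ce 49 f) ?s1"
  let ?is = "ce 48 e @ addr j 48 49 @ ce 49 f @ [Store 48 49]"
  have "\<forall>i\<in>set ?is. nojump i" using nojump_ce nojump_addr by fastforce
  then have "(stp p ^^ length ?is) (pc, s) = (pc + length ?is, effs ?is s)"
    using Put.prems(3) by (intro run_straight) simp_all
  moreover have "rel (\<sigma>(Arr j (ev e \<sigma>) := ev f \<sigma>)) (effs ?is s)"
  proof -
    have e: "?s 48 = ev e \<sigma>" "rel \<sigma> ?s"
      using effs_ce[OF Put.prems(4) w(2)] by (auto intro: rel_cong[OF Put.prems(4)])
    have a: "?s1 48 = 64 * Suc (ev e \<sigma>) + j" using effs_addr(1)[of 48 49 j ?s] e(1) by simp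
    have r1: "rel \<sigma> ?s1" by (rule rel_cong[OF e(2)]) (rule effs_addr(2), auto)
    have f: "?s2 49 = ev f \<sigma>" "rel \<sigma> ?s2" "?s2 48 = ?s1 48"
      using effs_ce[OF r1 w(3)] by (auto intro: rel_cong[OF r1])
    have "effs ?is s = ?s2(?s2 48 := ?s2 49)" by simp
    also have "\<dots> = ?s2(64 * Suc (ev e \<sigma>) + j := ev f \<sigma>)" using f a by simp
    finally show ?thesis using rel_arr_upd[OF f(2) w(1)] by simp
  qed
  moreover have "length ?is \<le> tm (Put j e f) (\<sigma> (Var 0))" by (simp add: length_addr)
  ultimately show ?case unfolding cc.simps exec.simps by blast
next
  case (Seq c d)
  let ?l = "length (cc pc c)"
  have c: "code_at p pc (cc pc c)" "code_at p (pc + ?l) (cc (pc + ?l) d)"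
    using Seq.prems(3) by (auto simp: code_at_append)
  obtain k s1 where 1: "k \<le> tm c (\<sigma> (Var 0))" "(stp p ^^ k) (pc, s) = (pc + ?l, s1)" "rel (exec c \<sigma>) s1"
    using Seq.IH(1)[OF _ _ c(1) Seq.prems(4)] Seq.prems by auto
  obtain k' s2 where 2: "k' \<le> tm d (exec c \<sigma> (Var 0))"
    "(stp p ^^ k') (pc + ?l, s1) = (pc + ?l + length (cc (pc + ?l) d), s2)" "rel (exec d (exec c \<sigma>)) s2"
    using Seq.IH(2)[OF _ _ c(2) 1(3)] Seq.prems by auto
  have "exec c \<sigma> (Var 0) = \<sigma> (Var 0)" using Seq.prems by (intro exec_frame_var) simp
  then show ?case using funpow_trans[OF 1(2) 2(2)] 1 2
    by (intro exI[of _ "k + k'"] exI[of _ s2]) (auto simp: add.assoc)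
next
  case (If e c d)
  define l where "l = pc + length (ce 48 e) + 1"
  define lc where "lc = length (cc l c)"
  define ld where "ld = length (cc (l + lc + 2) d)"
  have eq: "cc pc (If e c d) = ce 48 e @ [JmpZ 48 (l + lc + 2)] @ cc l c @
      [SetC 48 0] @ [JmpZ 48 (l + lc + 2 + ld)] @ cc (l + lc + 2) d"
    by (simp add: Let_def l_def lc_def ld_def)
  have len: "pc + length (cc pc (If e c d)) = l + lc + 2 + ld"
    unfolding eq by (simp add: l_def lc_def ld_def)
  have cd: "code_at p pc (ce 48 e)" "code_at p (pc + length (ce 48 e)) [JmpZ 48 (l + lc + 2)]"
    "code_at p l (cc l c)" "code_at p (l + lc) [SetC 48 0]"
    "code_at p (Suc (l + lc)) [JmpZ 48 (l + lc + 2 + ld)]"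
    "code_at p (l + lc + 2) (cc (l + lc + 2) d)"
    using If.prems(3) unfolding eq code_at_append by (simp_all add: l_def lc_def)
  obtain s1 where s1: "(stp p ^^ length (ce 48 e)) (pc, s) = (pc + length (ce 48 e), s1)"
    "s1 48 = ev e \<sigma>" "rel \<sigma> s1"
    using run_ce[OF cd(1) If.prems(4)] If.prems(1) by auto
  have j: "(stp p ^^ (length (ce 48 e) + 1)) (pc, s) = (if ev e \<sigma> = 0 then l + lc + 2 else l, s1)"
    by (rule funpow_trans[OF s1(1)]) (use stp_jump[OF cd(2)] s1(2) in \<open>simp add: l_def\<close>)
  show ?case
  proof (cases "ev e \<sigma> = 0")
    case True
    obtain k s2 where 2: "k \<le> tm d (\<sigma> (Var 0))"
      "(stp p ^^ k) (l + lc + 2, s1) = (l + lc + 2 + ld, s2)" "rel (exec d \<sigma>) s2"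
      using If.IH(2)[OF _ _ cd(6) s1(3)] If.prems by (auto simp: ld_def)
    have "(stp p ^^ (length (ce 48 e) + 1 + k)) (pc, s) = (l + lc + 2 + ld, s2)"
      by (rule funpow_trans[OF j]) (use True 2 in simp)
    then show ?thesis using True 2 unfolding len
      by (intro exI[of _ "length (ce 48 e) + 1 + k"] exI[of _ s2]) auto
  next
    case False
    obtain k s2 where 2: "k \<le> tm c (\<sigma> (Var 0))" "(stp p ^^ k) (l, s1) = (l + lc, s2)" "rel (exec c \<sigma>) s2"
      using If.IH(1)[OF _ _ cd(3) s1(3)] If.prems by (auto simp: lc_def)
    have "(stp p ^^ (length (ce 48 e) + 1 + k)) (pc, s) = (l + lc, s2)"
      by (rule funpow_trans[OF j]) (use False 2 in simp)
    moreover have "(stp p ^^ 1) (l + lc, s2) = (Suc (l + lc), s2(48 := 0))"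
      using run_straight[OF cd(4)] by simp
    moreover have "(stp p ^^ 1) (Suc (l + lc), s2(48 := 0)) = (l + lc + 2 + ld, s2(48 := 0))"
      using stp_jump[OF cd(5)] by simp
    ultimately have "(stp p ^^ (length (ce 48 e) + 1 + k + 1 + 1)) (pc, s) = (l + lc + 2 + ld, s2(48 := 0))"
      using funpow_trans by metis
    moreover have "rel (exec (If e c d) \<sigma>) (s2(48 := 0))"
      using False rel_temp_upd[OF 2(3), of 48 0] by simp
    moreover have "length (ce 48 e) + 1 + k + 1 + 1 \<le> tm (If e c d) (\<sigma> (Var 0))" using 2(1) by simp
    ultimately show ?thesis unfolding len by blast
  qed
next
  case (For x c)
  define lc where "lc = length (cc (pc + 3) c)"
  have eq: "cc pc (For x c) = [SetC x 0] @ [Sub 48 0 x] @ [JmpZ 48 (pc + lc + 7)] @ cc (pc + 3) c @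
         [SetC 48 1, Add x x 48, SetC 48 0] @ [JmpZ 48 (pc + 1)]"
    by (simp add: Let_def lc_def)
  have cd: "code_at p pc [SetC x 0]" "code_at p (pc + 1) [Sub 48 0 x]"
    "code_at p (pc + 2) [JmpZ 48 (pc + lc + 7)]" "code_at p (pc + 3) (cc (pc + 3) c)"
    "code_at p (pc + 3 + lc) [SetC 48 1, Add x x 48, SetC 48 0]" "code_at p (pc + 6 + lc) [JmpZ 48 (pc + 1)]"
    using For.prems(3) unfolding eq code_at_append by (simp_all add: lc_def numeral_3_eq_3 eval_nat_numeral)
  have len: "pc + length (cc pc (For x c)) = pc + lc + 7"
    unfolding eq by (simp add: lc_def)
  have w: "x < 48" "x \<noteq> 0" "x \<notin> wv c" "wfc c" "0 \<notin> wv c" using For.prems by auto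
  define body where "body = (\<lambda>\<tau>. (exec c \<tau>)(Var x := Suc (exec c \<tau> (Var x))))"
  define R where "R = \<sigma> (Var 0)"
  have test: "(stp p ^^ 2) (pc + 1, s) = (if \<tau> (Var 0) - \<tau> (Var x) = 0 then pc + lc + 7 else pc + 3,
       s(48 := \<tau> (Var 0) - \<tau> (Var x)))" if "rel \<tau> s" for s \<tau>
  proof -
    have v: "s 0 = \<tau> (Var 0)" "s x = \<tau> (Var x)" using that w by (auto simp: rel_def)
    have "(stp p ^^ 1) (pc + 1, s) = (pc + 2, s(48 := \<tau> (Var 0) - \<tau> (Var x)))"
      using run_straight[OF cd(2)] v by simp
    moreover have "(stp p ^^ 1) (pc + 2, s(48 := \<tau> (Var 0) - \<tau> (Var x))) =
       (if \<tau> (Var 0) - \<tau> (Var x) = 0 then pc + lc + 7 else pc + 3, s(48 := \<tau> (Var 0) - \<tau> (Var x)))"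
      using stp_jump[OF cd(3)] by simp
    ultimately have "(stp p ^^ (1 + 1)) (pc + 1, s) =
       (if \<tau> (Var 0) - \<tau> (Var x) = 0 then pc + lc + 7 else pc + 3, s(48 := \<tau> (Var 0) - \<tau> (Var x)))"
      by (rule funpow_trans)
    then show ?thesis by (simp only: one_add_one)
  qed
  \<comment> \<open>Taken at the loop test, address \<open>pc + 1\<close>. The 6 instructions
    besides the body are two for the test, three for increment and clearing, one for the jump
    back.\<close>
  have iter: "\<exists>k s'. k \<le> n * (tm c R + 6) \<and>
      (stp p ^^ k) (pc + 1, s) = (pc + 1, s') \<and> rel ((body ^^ n) \<tau>) s' \<and>
      (body ^^ n) \<tau> (Var 0) = R \<and> (body ^^ n) \<tau> (Var x) = n"
    if "n \<le> R" "rel \<tau> s" "\<tau> (Var 0) = R" "\<tau> (Var x) = 0" for n \<tau> s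
    using that(1)
  proof (induction n)
    case 0
    show ?case by (rule exI[of _ 0], rule exI[of _ s]) (use that in auto)
  next
    case (Suc n)
    let ?\<tau> = "(body ^^ n) \<tau>"
    obtain k s1 where 1: "k \<le> n * (tm c R + 6)" "(stp p ^^ k) (pc + 1, s) = (pc + 1, s1)"
      "rel ?\<tau> s1" "?\<tau> (Var 0) = R" "?\<tau> (Var x) = n" using Suc by auto
    have t: "(stp p ^^ 2) (pc + 1, s1) = (pc + 3, s1(48 := R - n))"
      using test[OF 1(3)] 1 Suc.prems by simp
    have "rel ?\<tau> (s1(48 := R - n))" using 1(3) by (intro rel_temp_upd) auto
    then obtain k' s2 where 2: "k' \<le> tm c R" "(stp p ^^ k') (pc + 3, s1(48 := R - n)) = (pc + 3 + lc, s2)"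
      "rel (exec c ?\<tau>) s2"
      using For.IH[OF w(4,5) cd(4)] 1(4) unfolding lc_def by metis
    have v: "exec c ?\<tau> (Var 0) = R" "exec c ?\<tau> (Var x) = n"
      using exec_frame_var w 1 by auto
    let ?s3 = "(s2(x := Suc n))(48 := 0)"
    have s2x: "s2 x = n" using 2(3) w(1) v by (simp add: rel_def)
    have "(stp p ^^ 3) (pc + 3 + lc, s2) = (pc + 6 + lc, ?s3)"
      using run_straight[OF cd(5), of s2] w s2x by (auto simp: numeral_3_eq_3 fun_eq_iff)
    moreover have "(stp p ^^ 1) (pc + 6 + lc, ?s3) = (pc + 1, ?s3)"
      using stp_jump[OF cd(6)] by simp
    ultimately have run: "(stp p ^^ (k + 2 + k' + 3 + 1)) (pc + 1, s) = (pc + 1, ?s3)"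
      using funpow_trans[OF funpow_trans[OF funpow_trans[OF funpow_trans[OF 1(2) t] 2(2)]]] by blast
    have bn: "(body ^^ Suc n) \<tau> = (exec c ?\<tau>)(Var x := Suc n)"
      using v by (simp add: body_def)
    have "(body ^^ Suc n) \<tau> (Var 0) = R" "(body ^^ Suc n) \<tau> (Var x) = Suc n"
      unfolding bn using v w(2) by simp_all
    moreover have "rel ((body ^^ Suc n) \<tau>) ?s3"
      unfolding bn using rel_temp_upd[OF rel_var_upd[OF 2(3) w(1)]] by auto
    moreover have "k + 2 + k' + 3 + 1 \<le> Suc n * (tm c R + 6)" using 1(1) 2(1) by simp
    ultimately show ?case using run by blast
  qed
  have s0: "(stp p ^^ 1) (pc, s) = (pc + 1, s(x := 0))" using run_straight[OF cd(1)] by simp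
  have r0: "rel (\<sigma>(Var x := 0)) (s(x := 0))" using rel_var_upd[OF For.prems(4) w(1)] .
  obtain k s1 where 1: "k \<le> R * (tm c R + 6)" "(stp p ^^ k) (pc + 1, s(x := 0)) = (pc + 1, s1)"
    "rel ((body ^^ R) (\<sigma>(Var x := 0))) s1" "(body ^^ R) (\<sigma>(Var x := 0)) (Var 0) = R"
    "(body ^^ R) (\<sigma>(Var x := 0)) (Var x) = R"
    using iter[OF order_refl r0] w(2) by (auto simp: R_def)
  have t: "(stp p ^^ 2) (pc + 1, s1) = (pc + lc + 7, s1(48 := 0))"
    using test[OF 1(3)] 1(4,5) by simp
  have "(stp p ^^ (1 + k + 2)) (pc, s) = (pc + lc + 7, s1(48 := 0))"
    by (rule funpow_trans[OF funpow_trans[OF s0 1(2)] t])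
  moreover have "exec (For x c) \<sigma> = (body ^^ R) (\<sigma>(Var x := 0))" by (simp add: body_def R_def)
  then have "rel (exec (For x c) \<sigma>) (s1(48 := 0))" using rel_temp_upd[OF 1(3), of 48 0] by simp
  moreover have "1 + k + 2 \<le> tm (For x c) (\<sigma> (Var 0))" using 1(1) by (simp add: R_def)
  ultimately show ?case unfolding len by blast
qed

lemma exec_For:
  assumes "x \<noteq> 0" "x \<notin> wv c" "0 \<notin> wv c" "\<sigma> (Var 0) = R" "P 0 (\<sigma>(Var x := 0))"
    and "\<And>i \<tau>. i < R \<Longrightarrow> P i \<tau> \<Longrightarrow> \<tau> (Var x) = i \<Longrightarrow> \<tau> (Var 0) = R \<Longrightarrow>
       P (Suc i) ((exec c \<tau>)(Var x := Suc i))"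
  shows "P R (exec (For x c) \<sigma>)"
proof -
  define body where "body = (\<lambda>\<tau>. (exec c \<tau>)(Var x := Suc (exec c \<tau> (Var x))))"
  define \<tau>\<^sub>0 where "\<tau>\<^sub>0 = \<sigma>(Var x := 0)"
  have t0: "P 0 \<tau>\<^sub>0" "\<tau>\<^sub>0 (Var x) = 0" "\<tau>\<^sub>0 (Var 0) = R" using assms by (auto simp: \<tau>\<^sub>0_def)
  have "P n ((body ^^ n) \<tau>\<^sub>0) \<and> (body ^^ n) \<tau>\<^sub>0 (Var x) = n \<and> (body ^^ n) \<tau>\<^sub>0 (Var 0) = R" if "n \<le> R" for n
    using that
  proof (induction n)
    case 0
    show ?case using t0 by simp
  next
    case (Suc n)
    let ?\<tau> = "(body ^^ n) \<tau>\<^sub>0"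
    have IH: "P n ?\<tau>" "?\<tau> (Var x) = n" "?\<tau> (Var 0) = R" using Suc by auto
    have v: "exec c ?\<tau> (Var x) = n" "exec c ?\<tau> (Var 0) = R"
      using exec_frame_var assms(2,3) IH by simp_all
    have b: "(body ^^ Suc n) \<tau>\<^sub>0 = (exec c ?\<tau>)(Var x := Suc n)"
      using v by (simp add: body_def)
    have "P (Suc n) ((exec c ?\<tau>)(Var x := Suc n))" using assms(6)[OF _ IH] Suc.prems by simp
    moreover have "((exec c ?\<tau>)(Var x := Suc n)) (Var x) = Suc n" by simp
    moreover have "((exec c ?\<tau>)(Var x := Suc n)) (Var 0) = R" using v assms(1) by simp
    ultimately show ?case unfolding b by blast
  qed
  from this[of R] have "P R ((body ^^ R) \<tau>\<^sub>0)" by simp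
  then show ?thesis using assms(4) by (simp only: exec.simps body_def \<tau>\<^sub>0_def)
qed

section \<open>Lengths of numbers and logarithmic cost\<close>

lemma bits_le: "n < 2 ^ k \<Longrightarrow> 1 \<le> k \<Longrightarrow> bits n \<le> k"
  by (simp add: bits_def floorlog_le_iff)

lemma less_bits: "n < 2 ^ bits n"
  using floorlog_leD[of 2 n "bits n"] by (simp add: bits_def)

text \<open>\<open>Mul\<close> is ruled out because squaring doubles the length of a number.
  \<open>Div\<close> only shrinks its operand; the prologue relies on it to undo the scaling of its
  pointer. Jump targets are not charged and need no bound.\<close>

fun lim :: "nat \<Rightarrow> ram_instr \<Rightarrow> bool" where
  "lim L (SetC i c) \<longleftrightarrow> i < 2 ^ L \<and> c < 2 ^ L"
| "lim L (Add i j k) \<longleftrightarrow> i < 2 ^ L \<and> j < 2 ^ L \<and> k < 2 ^ L"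
| "lim L (Sub i j k) \<longleftrightarrow> i < 2 ^ L \<and> j < 2 ^ L \<and> k < 2 ^ L"
| "lim L (Mul i j k) \<longleftrightarrow> False"
| "lim L (Div i j k) \<longleftrightarrow> i < 2 ^ L \<and> j < 2 ^ L \<and> k < 2 ^ L"
| "lim L (Load i j) \<longleftrightarrow> i < 2 ^ L \<and> j < 2 ^ L"
| "lim L (Store i j) \<longleftrightarrow> i < 2 ^ L \<and> j < 2 ^ L"
| "lim L (JmpZ i l) \<longleftrightarrow> i < 2 ^ L"

fun nomul :: "ram_instr \<Rightarrow> bool" where
  "nomul (Mul i j k) = False"
| "nomul _ = True"

lemma lim_mono: "lim L i \<Longrightarrow> L \<le> L' \<Longrightarrow> lim L' i"
  using power_increasing[of L L' "2::nat"] by (cases i) (auto intro: less_le_trans)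

lemma ex_lim: "nomul i \<Longrightarrow> \<exists>L. lim L i"
proof (cases i)
  case (SetC a b)
  show ?thesis unfolding SetC
    by (rule exI[of _ "a + b"]) (simp add: less_exp less_le_trans[OF less_exp power_increasing])
next
  case (Add a b c)
  show ?thesis unfolding Add
    by (rule exI[of _ "a + b + c"]) (simp add: less_le_trans[OF less_exp power_increasing])
next
  case (Sub a b c)
  show ?thesis unfolding Sub
    by (rule exI[of _ "a + b + c"]) (simp add: less_le_trans[OF less_exp power_increasing])
next
  case (Div a b c)
  show ?thesis unfolding Div
    by (rule exI[of _ "a + b + c"]) (simp add: less_le_trans[OF less_exp power_increasing])
next
  case (Load a b)
  show ?thesis unfolding Load
    by (rule exI[of _ "a + b"]) (simp add: less_le_trans[OF less_exp power_increasing])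
next
  case (Store a b)
  show ?thesis unfolding Store
    by (rule exI[of _ "a + b"]) (simp add: less_le_trans[OF less_exp power_increasing])
next
  case (JmpZ a b)
  show ?thesis unfolding JmpZ
    by (rule exI[of _ "a"]) (simp add: less_exp)
qed simp

lemma ex_lim_prog: "\<forall>i\<in>set p. nomul i \<Longrightarrow> \<exists>L\<ge>1. \<forall>i\<in>set p. lim L i"
proof (induction p)
  case (Cons i p)
  then obtain L where "1 \<le> L" "\<forall>i\<in>set p. lim L i" by auto
  moreover obtain L' where "lim L' i" using ex_lim[of i] Cons.prems by auto
  ultimately have "\<forall>k\<in>set (i # p). lim (L + L') k" using lim_mono by fastforce
  then show ?case using \<open>1 \<le> L\<close> by (meson trans_le_add1)
qed auto

lemma lim_step:
  assumes "lim L i" "\<forall>x. s x < 2 ^ L"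
  shows "snd (ram_exec i (pc, s)) x < 2 ^ Suc L"
proof -
  have s: "s y < 2 ^ L" for y using assms by simp
  then have s2: "s y < 2 ^ Suc L" for y using less_le_trans[OF s[of y], of "2 ^ Suc L"] by simp
  have "s j - s k < 2 ^ Suc L" "s j div s k < 2 ^ Suc L" for j k
    using s2[of j] by (auto intro: le_less_trans[OF diff_le_self] le_less_trans[OF div_le_dividend])
  moreover have "s j + s k < 2 ^ Suc L" for j k using s[of j] s[of k] by simp
  ultimately show ?thesis using assms s2 by (cases i) auto
qed

lemma lim_cost:
  assumes "lim L i" "\<forall>x. s x < 2 ^ L" "1 \<le> L"
  shows "ram_cost i s \<le> 5 * L"
proof -
  have s: "bits (s y) \<le> L" for y using assms bits_le by simp
  have b: "bits j \<le> L" if "j < 2 ^ L" for j using assms bits_le that by simp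
  show ?thesis
  proof (cases i)
    case (Add a c d)
    then show ?thesis using assms(1) b[of a] b[of c] b[of d] s[of c] s[of d] by simp
  next
    case (Sub a c d)
    then show ?thesis using assms(1) b[of a] b[of c] b[of d] s[of c] s[of d] by simp
  next
    case (Div a c d)
    then show ?thesis using assms(1) b[of a] b[of c] b[of d] s[of c] s[of d] by simp
  next
    case (SetC a c)
    then show ?thesis using assms(1) b[of a] b[of c] by simp
  next
    case (Load a c)
    then show ?thesis using assms(1) b[of a] b[of c] s[of c] s[of "s c"] by simp
  next
    case (Store a c)
    then show ?thesis using assms(1) b[of a] b[of c] s[of c] s[of a] by simp
  next
    case (JmpZ a c)
    then show ?thesis using assms(1) b[of a] s[of a] by simp
  qed (use assms in simp)
qed

text \<open>
  Without multiplication, the binary lengths grow by at most one per instruction, so a bound on the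
  number of instructions bounds the logarithmic cost.
\<close>

lemma run_cost:
  assumes "\<forall>i\<in>set p. lim L i" "1 \<le> L" "\<forall>x. s x < 2 ^ L"
    and "(stp p ^^ k) (pc, s) = (pc', s')" "length p \<le> pc'"
  shows "\<exists>t. ram_run p (pc, s) t s' \<and> t \<le> 5 * k * (L + k)"
  using assms
proof (induction k arbitrary: pc s L)
  case 0
  then show ?case using ram_run.halt[of p pc s] by auto
next
  case (Suc k)
  show ?case
  proof (cases "length p \<le> pc")
    case True
    then have "stp p (pc, s) = (pc, s)" by (simp add: stp_def)
    then have "(stp p ^^ n) (pc, s) = (pc, s)" for n by (induction n) auto
    then have "s' = s" using Suc.prems(4) by (metis snd_conv)
    then show ?thesis using ram_run.halt[of p pc s] True by auto
  next
    case False
    obtain pc1 s1 where 1: "ram_exec (p ! pc) (pc, s) = (pc1, s1)" by force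
    have st: "stp p (pc, s) = (pc1, s1)" using False 1 by (simp add: stp_def)
    have i: "lim L (p ! pc)" using Suc.prems(1) False by simp
    have "\<exists>t. ram_run p (pc1, s1) t s' \<and> t \<le> 5 * k * (Suc L + k)"
    proof (rule Suc.IH)
      show "\<forall>i\<in>set p. lim (Suc L) i" using Suc.prems(1) lim_mono by fastforce
      show "\<forall>x. s1 x < 2 ^ Suc L" using lim_step[OF i Suc.prems(3), of pc] 1 by simp
      show "(stp p ^^ k) (pc1, s1) = (pc', s')" using Suc.prems(4) st by (simp add: funpow_swap1)
    qed (use Suc.prems in auto)
    then obtain t where t: "ram_run p (pc1, s1) t s'" "t \<le> 5 * k * (Suc L + k)" by blast
    have "ram_run p (pc, s) (ram_cost (p ! pc) s + t) s'"
      using False t(1) 1 by (intro ram_run.step) auto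
    moreover have "ram_cost (p ! pc) s + t \<le> 5 * L + 5 * k * (Suc L + k)"
      using lim_cost[OF i Suc.prems(3,2)] t(2) by simp
    moreover have "\<dots> \<le> 5 * Suc k * (L + Suc k)" by (simp add: algebra_simps)
    ultimately show ?thesis by (meson order_trans)
  qed
qed

subsection \<open>Input and output\<close>

lemma run_block:
  assumes "code_at p pc is" "\<forall>i\<in>set is. nojump i" "length is = n" "pc + n = pc'" "\<And>x. effs is s x = s' x"
  shows "(stp p ^^ n) (pc, s) = (pc', s')"
proof -
  have "effs is s = s'" using assms(5) by blast
  then show ?thesis using run_straight[OF assms(1,2)] assms(3,4) by metis
qed

text \<open>
  The prologue moves the input cell \<open>p\<close> to cell \<open>64 * p\<close>. It only has the cells \<open>0\<close> and \<open>1\<close> at its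
  disposal, so the pointer is scaled in place; the first entry of the input is lost.
\<close>

definition prologue :: ram_prog where
  "prologue = [JmpZ 0 15] @ [Load 1 0, Add 0 0 0, Add 0 0 0, Add 0 0 0, Add 0 0 0, Add 0 0 0, Add 0 0 0,
     Store 0 1, SetC 1 64, Div 0 0 1, SetC 1 1, Sub 0 0 1, SetC 1 0] @ [JmpZ 1 0]"

text \<open>Cells are moved from the last one down. The target \<open>64 * q\<close> lies above
  \<open>q\<close>, so it can only overwrite an input cell that has been moved already. Cell 64 q is
  entry q - 1 of array 0, so list positions become array indices; cell 1, holding the number of
  vertices, is sacrificed as a register, hence \<open>2 <= i\<close>.\<close>

lemma run_prologue:
  assumes "code_at p 0 prologue" "s 0 = q"
  shows "\<exists>s'. (stp p ^^ (15 * q + 1)) (0, s) = (15, s') \<and> (\<forall>i. 2 \<le> i \<longrightarrow> i \<le> q \<longrightarrow> s' (64 * i) = s i) \<and>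
    (\<forall>x>64 * q. 2 \<le> x \<longrightarrow> s' x = s x)"
  using assms(2)
proof (induction q arbitrary: s)
  have cd: "code_at p 0 [JmpZ 0 15]"
    "code_at p 1 [Load 1 0, Add 0 0 0, Add 0 0 0, Add 0 0 0, Add 0 0 0, Add 0 0 0, Add 0 0 0,
     Store 0 1, SetC 1 64, Div 0 0 1, SetC 1 1, Sub 0 0 1, SetC 1 0]" "code_at p 14 [JmpZ 1 0]"
    using assms(1) unfolding prologue_def code_at_append by (simp_all add: eval_nat_numeral)
  {
    case 0
    show ?case using stp_jump[OF cd(1)] 0 by auto
  next
    case (Suc q)
    let ?s = "s(0 := q, 1 := 0, 64 * Suc q := s (Suc q))"
    have "(stp p ^^ 1) (0, s) = (1, s)" using stp_jump[OF cd(1)] Suc.prems by simp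
    moreover have "(stp p ^^ 13) (1, s) = (14, ?s)"
      by (rule run_block[OF cd(2)]) (use Suc.prems in auto)
    moreover have "(stp p ^^ 1) (14, ?s) = (0, ?s)" using stp_jump[OF cd(3)] by simp
    ultimately have a: "(stp p ^^ (1 + 13 + 1)) (0, s) = (0, ?s)" by (metis funpow_trans)
    have "?s 0 = q" by simp
    from Suc.IH[of ?s, OF this] obtain s' where s': "(stp p ^^ (15 * q + 1)) (0, ?s) = (15, s')"
      "\<forall>i. 2 \<le> i \<longrightarrow> i \<le> q \<longrightarrow> s' (64 * i) = ?s i" "\<forall>x>64 * q. 2 \<le> x \<longrightarrow> s' x = ?s x"
      by blast
    have "(stp p ^^ (15 * Suc q + 1)) (0, s) = (15, s')"
      using funpow_trans[OF a s'(1)] by (simp add: add.commute add.left_commute)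
    moreover have "s' (64 * i) = s i" if "2 \<le> i" "i \<le> Suc q" for i
      using s'(2,3) that by (cases "i = Suc q") auto
    moreover have "s' x = s x" if "64 * Suc q < x" "2 \<le> x" for x using s'(3) that by auto
    ultimately show ?case by blast
  }
qed

text \<open>
  The result list is taken from column 11. Column 12 marks its valid entries. The cells \<open>0\<close>, \<open>1\<close>, \<open>2\<close>
  serve as registers while the cells from \<open>3\<close> on are filled, and get their final values from
  the first row beyond, where columns 15, 0 and 14 hold copies of the length and the first two entries.
\<close>

definition epilogue :: "nat \<Rightarrow> ram_prog" where
  "epilogue b = [SetC 0 3] @
     [Add 1 0 0, Add 1 1 1, Add 1 1 1, Add 1 1 1, Add 1 1 1, Add 1 1 1, SetC 2 12, Add 2 1 2, Load 2 2] @
     [JmpZ 2 (b + 19)] @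
     [SetC 2 11, Add 1 1 2, Load 1 1, Store 0 1, SetC 1 1, Add 0 0 1, SetC 1 0] @ [JmpZ 1 (b + 1)] @
     [SetC 2 14, Add 2 1 2, Load 2 2, SetC 0 15, Add 0 1 0, Load 0 0, Load 1 1]"

text \<open>While cell \<open>r\<close> is written, only rows from \<open>r\<close> on, at addresses
  beyond \<open>64 * r\<close>, are still to be read, so nothing is destroyed too early. The loop
  stops in the first unmarked row, whose address is left in cell 1; the maximum with 3 covers
  outputs with fewer than three entries.\<close>

lemma run_epilogue_loop:
  assumes "code_at p b (epilogue b)" "n \<le> R"
    and out: "\<And>q. r \<le> q \<Longrightarrow> q \<le> R \<Longrightarrow> (s (64 * q + 12) = 0 \<longleftrightarrow> n < q)" and "3 \<le> r" "r \<le> R"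
    and "s 0 = r" "n < R \<and> r \<le> max 3 (Suc n)"
  shows "\<exists>k s'. k \<le> 18 * (Suc n - r) + 10 \<and> (stp p ^^ k) (b + 1, s) = (b + 19, s') \<and>
     s' 1 = 64 * max 3 (Suc n) \<and> (\<forall>q. r \<le> q \<longrightarrow> q \<le> n \<longrightarrow> s' q = s (64 * q + 11)) \<and>
     (\<forall>x. 3 \<le> x \<longrightarrow> x < r \<or> 64 * max 3 (Suc n) \<le> x \<longrightarrow> s' x = s x)"
  using assms(3-7)
proof (induction "Suc n - r" arbitrary: s r)
  have cd: "code_at p (b + 1) [Add 1 0 0, Add 1 1 1, Add 1 1 1, Add 1 1 1, Add 1 1 1, Add 1 1 1, SetC 2 12, Add 2 1 2, Load 2 2]"
    "code_at p (b + 10) [JmpZ 2 (b + 19)]"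
    "code_at p (b + 11) [SetC 2 11, Add 1 1 2, Load 1 1, Store 0 1, SetC 1 1, Add 0 0 1, SetC 1 0]"
    "code_at p (b + 18) [JmpZ 1 (b + 1)]"
    using assms(1) unfolding epilogue_def code_at_append by (simp_all add: eval_nat_numeral)
  have head: "(stp p ^^ 10) (b + 1, s) = (if s (64 * r + 12) = 0 then b + 19 else b + 11,
        s(1 := 64 * r, 2 := s (64 * r + 12)))"
    if "s 0 = r" for s r
  proof -
    have "(stp p ^^ 9) (b + 1, s) = (b + 10, s(1 := 64 * r, 2 := s (64 * r + 12)))"
      by (rule run_block[OF cd(1)]) (use that in auto)
    moreover have "(stp p ^^ 1) (b + 10, s(1 := 64 * r, 2 := s (64 * r + 12))) =
      (if s (64 * r + 12) = 0 then b + 19 else b + 11, s(1 := 64 * r, 2 := s (64 * r + 12)))"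
      using stp_jump[OF cd(2)] by simp
    ultimately have "(stp p ^^ (9 + 1)) (b + 1, s) = (if s (64 * r + 12) = 0 then b + 19 else b + 11,
        s(1 := 64 * r, 2 := s (64 * r + 12)))" by (rule funpow_trans)
    then show ?thesis by simp
  qed
  {
    case (0 r s)
    then have "s (64 * r + 12) = 0" using 0(2)[of r] by simp
    then have "(stp p ^^ 10) (b + 1, s) = (b + 19, s(1 := 64 * r, 2 := 0))" using head[of s r] 0(5) by simp
    moreover have "max 3 (Suc n) = r" using 0 by simp
    ultimately show ?case using 0
      by (intro exI[of _ 10] exI[of _ "s(1 := 64 * r, 2 := 0)"]) auto
  next
    case (Suc m r s)
    have rn: "r \<le> n" using Suc by simp
    then have nz: "s (64 * r + 12) \<noteq> 0" using Suc.prems by auto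
    let ?s = "s(0 := Suc r, 1 := 0, 2 := 11, r := s (64 * r + 11))"
    have "(stp p ^^ 10) (b + 1, s) = (b + 11, s(1 := 64 * r, 2 := s (64 * r + 12)))"
      using head[of s r] Suc.prems(4) nz by simp
    moreover have "(stp p ^^ 7) (b + 11, s(1 := 64 * r, 2 := s (64 * r + 12))) = (b + 18, ?s)"
      by (rule run_block[OF cd(3)]) (use Suc.prems in auto)
    moreover have "(stp p ^^ 1) (b + 18, ?s) = (b + 1, ?s)" using stp_jump[OF cd(4)] Suc.prems by simp
    ultimately have a: "(stp p ^^ (10 + 7 + 1)) (b + 1, s) = (b + 1, ?s)" by (metis funpow_trans)
    have "\<exists>k s'. k \<le> 18 * (Suc n - Suc r) + 10 \<and> (stp p ^^ k) (b + 1, ?s) = (b + 19, s') \<and>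
     s' 1 = 64 * max 3 (Suc n) \<and> (\<forall>q. Suc r \<le> q \<longrightarrow> q \<le> n \<longrightarrow> s' q = ?s (64 * q + 11)) \<and>
     (\<forall>x. 3 \<le> x \<longrightarrow> x < Suc r \<or> 64 * max 3 (Suc n) \<le> x \<longrightarrow> s' x = ?s x)"
    proof (rule Suc.hyps(1))
      show "m = Suc n - Suc r" using Suc.hyps(2) by simp
      show "?s (64 * q + 12) = 0 \<longleftrightarrow> n < q" if "Suc r \<le> q" "q \<le> R" for q
        using Suc.prems(1)[of q] that by simp
    qed (use Suc.prems rn in auto)
    then obtain k s' where k: "k \<le> 18 * (Suc n - Suc r) + 10" "(stp p ^^ k) (b + 1, ?s) = (b + 19, s')"
     "s' 1 = 64 * max 3 (Suc n)" "\<forall>q. Suc r \<le> q \<longrightarrow> q \<le> n \<longrightarrow> s' q = ?s (64 * q + 11)"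
     "\<forall>x. 3 \<le> x \<longrightarrow> x < Suc r \<or> 64 * max 3 (Suc n) \<le> x \<longrightarrow> s' x = ?s x" by blast
    have "(stp p ^^ (10 + 7 + 1 + k)) (b + 1, s) = (b + 19, s')" using funpow_trans[OF a k(2)] .
    moreover have "10 + 7 + 1 + k \<le> 18 * (Suc n - r) + 10" using k(1) rn by simp
    moreover have "s' q = s (64 * q + 11)" if "r \<le> q" "q \<le> n" for q
      using k(4,5) that Suc.prems(2) by (cases "q = r") auto
    moreover have "s' x = s x" if "3 \<le> x" "x < r \<or> 64 * max 3 (Suc n) \<le> x" for x
      using k(5) that rn by auto
    ultimately show ?case using k(3) by blast
  }
qed


lemma run_epilogue:
  assumes "code_at p b (epilogue b)" "3 \<le> R" "n < R"
    and mark: "\<And>i. i < R \<Longrightarrow> s (64 * Suc i + 12) = 0 \<longleftrightarrow> n \<le> i"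
    and out: "\<And>i. s (64 * Suc i + 11) = f i"
    and fin: "\<And>i. i < R \<Longrightarrow> s (64 * Suc i) = f 0" "\<And>i. i < R \<Longrightarrow> s (64 * Suc i + 14) = f 1"
      "\<And>i. i < R \<Longrightarrow> s (64 * Suc i + 15) = n"
  shows "\<exists>k s'. k \<le> 18 * R + 20 \<and> (stp p ^^ k) (b, s) = (b + 26, s') \<and> s' 0 = n \<and> (\<forall>q. 1 \<le> q \<longrightarrow> q \<le> n \<longrightarrow> s' q = f (q - 1))"
proof -
  have cd: "code_at p b [SetC 0 3]"
    "code_at p (b + 19) [SetC 2 14, Add 2 1 2, Load 2 2, SetC 0 15, Add 0 1 0, Load 0 0, Load 1 1]"
    using assms(1) unfolding epilogue_def code_at_append by (simp_all add: eval_nat_numeral)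
  have row: "s (64 * q + 11) = f (q - 1)" "q \<le> R \<Longrightarrow> s (64 * q + 12) = 0 \<longleftrightarrow> n < q"
    "q \<le> R \<Longrightarrow> s (64 * q) = f 0" "q \<le> R \<Longrightarrow> s (64 * q + 14) = f 1" "q \<le> R \<Longrightarrow> s (64 * q + 15) = n"
    if "1 \<le> q" for q
    using out[of "q - 1"] mark[of "q - 1"] fin[of "q - 1"] that by auto
  define s1 where "s1 = s(0 := 3)"
  have s1: "s1 x = s x" if "x \<noteq> 0" for x using that by (simp add: s1_def)
  have a: "(stp p ^^ 1) (b, s) = (b + 1, s1)"
    by (rule run_block[OF cd(1)]) (auto simp: s1_def)
  have "\<exists>k s'. k \<le> 18 * (Suc n - 3) + 10 \<and> (stp p ^^ k) (b + 1, s1) = (b + 19, s') \<and>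
     s' 1 = 64 * max 3 (Suc n) \<and> (\<forall>q. 3 \<le> q \<longrightarrow> q \<le> n \<longrightarrow> s' q = s1 (64 * q + 11)) \<and>
     (\<forall>x. 3 \<le> x \<longrightarrow> x < 3 \<or> 64 * max 3 (Suc n) \<le> x \<longrightarrow> s' x = s1 x)"
  proof (rule run_epilogue_loop[OF assms(1), of n R])
    show "s1 (64 * q + 12) = 0 \<longleftrightarrow> n < q" if "3 \<le> q" "q \<le> R" for q
      using row(2)[of q] that by (simp add: s1)
  qed (use assms in \<open>auto simp: s1_def\<close>)
  then obtain k s2 where k: "k \<le> 18 * (Suc n - 3) + 10" "(stp p ^^ k) (b + 1, s1) = (b + 19, s2)"
     "s2 1 = 64 * max 3 (Suc n)" "\<forall>q. 3 \<le> q \<longrightarrow> q \<le> n \<longrightarrow> s2 q = s1 (64 * q + 11)"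
     "\<forall>x. 3 \<le> x \<longrightarrow> x < 3 \<or> 64 * max 3 (Suc n) \<le> x \<longrightarrow> s2 x = s1 x" by blast
  define P where "P = max 3 (Suc n)"
  \<comment> \<open>Row \<open>P\<close> must be among the \<open>R\<close> rows prepared by
    \<open>fill\<close>; this is where \<open>n < R\<close> and \<open>3 <= R\<close> enter.\<close>
  have P: "3 \<le> P" "P \<le> R" using assms by (auto simp: P_def)
  have far: "s2 x = s x" if "64 * P \<le> x" for x
    using k(5) s1[of x] that P by (auto simp: P_def)
  have v: "s2 (64 * P) = f 0" "s2 (64 * P + 14) = f 1" "s2 (64 * P + 15) = n"
    using row(3-5)[of P] P far by simp_all
  have p1: "s2 1 = 64 * P" using k(3) by (simp add: P_def)
  define s3 where "s3 = s2(0 := n, 1 := f 0, 2 := f 1)"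
  have "(stp p ^^ 7) (b + 19, s2) = (b + 26, s3)"
    by (rule run_block[OF cd(2)]) (use v p1 P in \<open>auto simp: s3_def\<close>)
  then have "(stp p ^^ (1 + k + 7)) (b, s) = (b + 26, s3)"
    using funpow_trans[OF funpow_trans[OF a k(2)]] by blast
  moreover have "1 + k + 7 \<le> 18 * R + 20" using k(1) assms(3) by simp
  moreover have "s3 0 = n" by (simp add: s3_def)
  moreover have "s3 q = f (q - 1)" if "1 \<le> q" "q \<le> n" for q
  proof (cases "3 \<le> q")
    case True
    then show ?thesis using k(4) that s1[of "64 * q + 11"] row(1)[of q] by (simp add: s3_def)
  next
    case False
    then have "q = 1 \<or> q = 2" using that by auto
    then show ?thesis by (auto simp: s3_def)
  qed
  ultimately show ?thesis by blast
qed

subsection \<open>From commands to polynomial-time programs\<close>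

text \<open>The mark is 1 in the rows below the output length and 0 from there on, by truncated
  subtraction. Length and first two entries go into every row, as the row where the epilogue stops
  depends on the output.\<close>

definition fill :: com where
  "fill = For 2 (Seq (Put 12 (V 2) (Minus (N 1) (Minus (Plus (V 2) (N 1)) (V 1))))
     (Seq (Put 14 (V 2) (A 11 (N 1))) (Seq (Put 15 (V 2) (V 1)) (Put 0 (V 2) (A 11 (N 0))))))"

lemma exec_fill:
  assumes "\<sigma> (Var 0) = R"
  defines "\<tau> \<equiv> exec fill \<sigma>"
  shows "i < R \<Longrightarrow> \<tau> (Arr 12 i) = 0 \<longleftrightarrow> \<sigma> (Var 1) \<le> i" "\<tau> (Arr 11 i) = \<sigma> (Arr 11 i)"
    "i < R \<Longrightarrow> \<tau> (Arr 0 i) = \<sigma> (Arr 11 0)" "i < R \<Longrightarrow> \<tau> (Arr 14 i) = \<sigma> (Arr 11 1)"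
    "i < R \<Longrightarrow> \<tau> (Arr 15 i) = \<sigma> (Var 1)"
proof -
  let ?P = "\<lambda>n \<tau>. \<tau> (Var 1) = \<sigma> (Var 1) \<and> (\<forall>i. \<tau> (Arr 11 i) = \<sigma> (Arr 11 i)) \<and>
    (\<forall>i<n. (\<tau> (Arr 12 i) = 0 \<longleftrightarrow> \<sigma> (Var 1) \<le> i) \<and> \<tau> (Arr 0 i) = \<sigma> (Arr 11 0) \<and>
       \<tau> (Arr 14 i) = \<sigma> (Arr 11 1) \<and> \<tau> (Arr 15 i) = \<sigma> (Var 1))"
  have "?P R \<tau>" unfolding \<tau>_def fill_def
  proof (rule exec_For[where P = ?P])
    show "?P (Suc i) ((exec (Seq (Put 12 (V 2) (Minus (N 1) (Minus (Plus (V 2) (N 1)) (V 1))))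
      (Seq (Put 14 (V 2) (A 11 (N 1))) (Seq (Put 15 (V 2) (V 1)) (Put 0 (V 2) (A 11 (N 0)))))) \<tau>)(Var 2 := Suc i))"
      if "?P i \<tau>" "\<tau> (Var 2) = i" for i \<tau>
      using that by (simp add: less_Suc_eq) linarith
  qed (use assms(1) in auto)
  then show "i < R \<Longrightarrow> \<tau> (Arr 12 i) = 0 \<longleftrightarrow> \<sigma> (Var 1) \<le> i" "\<tau> (Arr 11 i) = \<sigma> (Arr 11 i)"
    "i < R \<Longrightarrow> \<tau> (Arr 0 i) = \<sigma> (Arr 11 0)" "i < R \<Longrightarrow> \<tau> (Arr 14 i) = \<sigma> (Arr 11 1)"
    "i < R \<Longrightarrow> \<tau> (Arr 15 i) = \<sigma> (Var 1)" by auto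
qed

lemma nomul_addr: "i \<in> set (addr j t u) \<Longrightarrow> nomul i"
  by (auto simp: addr_def)

lemma nomul_ce: "i \<in> set (ce t e) \<Longrightarrow> nomul i"
  by (induction t e rule: ce.induct) (auto simp: nomul_addr)

lemma nomul_cc: "i \<in> set (cc pc c) \<Longrightarrow> nomul i"
proof (induction c arbitrary: pc)
  case (If e c d)
  then show ?case unfolding cc.simps Let_def by (auto simp: nomul_ce)
qed (auto simp: nomul_ce nomul_addr Let_def)

lemma input_size_ge_length: "length xs \<le> input_size xs"
  by (induction xs) (auto simp: input_size_def bits_def)

lemma bits_le_input_size: "x \<in> set xs \<Longrightarrow> bits x \<le> input_size xs"
  by (induction xs) (auto simp: input_size_def)

lemma ram_input_bound: "ram_input xs i < 2 ^ input_size xs"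
proof (cases i)
  case 0
  have "length xs < 2 ^ length xs" by (rule less_exp)
  also have "\<dots> \<le> 2 ^ input_size xs" by (intro power_increasing input_size_ge_length) simp
  finally show ?thesis using 0 by (simp add: ram_input_def)
next
  case (Suc j)
  then show ?thesis using less_le_trans[OF less_bits power_increasing[OF bits_le_input_size[of "xs ! j" xs], of "2::nat"]]
    by (simp add: ram_input_def)
qed

text \<open>The common loop bound \<open>5 * m + k\<close> by additions: entry 1 of the input is the
  number \<open>m\<close> of edges, and each edge takes five numbers.\<close>

definition size_exp :: "nat \<Rightarrow> exp" where
  "size_exp k = Plus (Plus (Plus (A 0 (N 1)) (A 0 (N 1))) (Plus (A 0 (N 1)) (A 0 (N 1)))) (Plus (A 0 (N 1)) (N k))"

text \<open>The initial store is specified only on variable 0 and on the input array. Elsewhere it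
  holds remnants of the input, so a command has to initialize whatever else it reads.\<close>

theorem ram_program_of_com:
  assumes "wfc c" "0 \<notin> wv c" "3 \<le> k"
  shows "\<exists>p (q :: nat poly). \<forall>xs. length xs = 2 + 5 * xs ! 1 \<longrightarrow>
    (\<exists>\<sigma>. \<sigma> (Var 0) = 5 * xs ! 1 + k \<and> (\<forall>i. 1 \<le> i \<longrightarrow> i < length xs \<longrightarrow> \<sigma> (Arr 0 i) = xs ! i) \<and>
      (exec c \<sigma> (Var 1) < 5 * xs ! 1 + k \<longrightarrow>
        (\<exists>t. ram_computes p xs t (map (\<lambda>i. exec c \<sigma> (Arr 11 i)) [0..<exec c \<sigma> (Var 1)]) \<and>
          t \<le> poly q (input_size xs))))"
proof -
  define d where "d = Seq c fill"
  have wf: "wfc d" "0 \<notin> wv d" using assms by (auto simp: d_def fill_def)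
  define asg where "asg = ce 48 (size_exp k) @ [SetC 49 0, Add 0 48 49]"
  define l1 where "l1 = 15 + length asg"
  define l2 where "l2 = l1 + length (cc l1 d)"
  define p where "p = prologue @ asg @ cc l1 d @ epilogue l2"
  have "nomul i" if "i \<in> set p" for i
    using that unfolding p_def prologue_def asg_def epilogue_def by (auto simp: nomul_ce nomul_cc)
  then obtain L where L: "1 \<le> L" "\<forall>i\<in>set p. lim L i" using ex_lim_prog by blast
  obtain K D where KD: "\<And>R. tm d R \<le> K * Suc R ^ D" using tm_poly by blast
  \<comment> \<open>Instructions of prologue, assignment to variable 0, command and epilogue in
    terms of the input size \<open>x\<close>, which bounds the number of entries as well as their
    lengths. The polynomial \<open>q\<close> then is the cost bound of \<open>run_cost\<close> with
    \<open>x + L\<close> digits.\<close>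
  define steps where "steps = (\<lambda>x. 15 * x + 1 + length asg + K * (x + k + 1) ^ D + (18 * (x + k) + 20))"
  define q :: "nat poly" where "q = (let Q = [:1 + length asg, 15:] + smult K ([:k + 1, 1:] ^ D) + [:18 * k + 20, 18:]
     in 5 * Q * ([:L, 1:] + Q))"
  have q: "poly q x = 5 * steps x * (x + L + steps x)" for x
    by (simp add: q_def steps_def Let_def algebra_simps)
  have cd0: "code_at p 0 p" by (auto simp: code_at_def intro: exI[of _ "[]"])
  have lp: "length prologue = 15" by (simp add: prologue_def)
  have cd: "code_at p 0 prologue" "code_at p 15 asg" "code_at p l1 (cc l1 d)" "code_at p l2 (epilogue l2)"
    using cd0 unfolding p_def code_at_append by (simp_all add: lp l1_def l2_def)
  have len: "length p = l2 + 26" by (simp add: p_def lp l1_def l2_def epilogue_def)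
  show ?thesis
  proof (intro exI[of _ p] exI[of _ q] allI impI)
    fix xs :: "nat list" assume xs: "length xs = 2 + 5 * xs ! 1"
    define R where "R = 5 * xs ! 1 + k"
    define x where "x = input_size xs"
    have lx: "length xs \<le> x" using input_size_ge_length by (simp add: x_def)
    have "ram_input xs 0 = length xs" by (simp add: ram_input_def)
    from run_prologue[OF cd(1), of "ram_input xs" "length xs", OF this] obtain s1 where s1:
      "(stp p ^^ (15 * length xs + 1)) (0, ram_input xs) = (15, s1)"
      "\<forall>i. 2 \<le> i \<longrightarrow> i \<le> length xs \<longrightarrow> s1 (64 * i) = ram_input xs i" by blast
    define \<sigma>\<^sub>1 where "\<sigma>\<^sub>1 = (\<lambda>l. case l of Var v \<Rightarrow> s1 v | Arr j i \<Rightarrow> s1 (64 * Suc i + j))"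
    have r1: "rel \<sigma>\<^sub>1 s1" by (simp add: rel_def \<sigma>\<^sub>1_def)
    have in1: "\<sigma>\<^sub>1 (Arr 0 i) = xs ! i" if "1 \<le> i" "i < length xs" for i
      using s1(2)[rule_format, of "Suc i"] that by (simp add: \<sigma>\<^sub>1_def ram_input_def)
    have R1: "ev (size_exp k) \<sigma>\<^sub>1 = R" using in1[of 1] xs by (simp add: size_exp_def R_def)
    define \<sigma> where "\<sigma> = \<sigma>\<^sub>1(Var 0 := R)"
    have cd2: "code_at p 15 (cc 15 (Assign 0 (size_exp k)))" using cd(2) by (simp add: asg_def)
    define s2 where "s2 = effs asg s1"
    have st2: "(stp p ^^ length asg) (15, s1) = (l1, s2)"
      unfolding l1_def s2_def by (rule run_straight[OF cd(2)]) (auto simp: asg_def nojump_ce)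
    have r2: "rel \<sigma> s2"
    proof -
      have "wfe 48 (size_exp k)" by (simp add: size_exp_def)
      then have e: "effs (ce 48 (size_exp k)) s1 48 = R" "rel \<sigma>\<^sub>1 (effs (ce 48 (size_exp k)) s1)"
        using effs_ce[OF r1] R1 by (auto intro: rel_cong[OF r1])
      show ?thesis
        using rel_var_upd[OF rel_temp_upd[OF e(2), of 49 0], of 0 R] e(1) by (simp add: \<sigma>_def s2_def asg_def)
    qed
    have \<sigma>R: "\<sigma> (Var 0) = R" by (simp add: \<sigma>_def)
    obtain m s3 where 3: "m \<le> tm d R" "(stp p ^^ m) (l1, s2) = (l2, s3)" "rel (exec d \<sigma>) s3"
      using run_cc[OF wf cd(3) r2] \<sigma>R by (auto simp: l2_def)
    let ?\<tau> = "exec c \<sigma>"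
    have \<tau>R: "?\<tau> (Var 0) = R" using exec_frame_var assms(2) \<sigma>R by simp
    note fill = exec_fill[of ?\<tau> R, OF \<tau>R]
    have cell: "s3 (64 * Suc i + j) = exec fill ?\<tau> (Arr j i)" if "j < 64" for i j
      using 3(3) that by (simp add: rel_def d_def)
    show "\<exists>\<sigma>. \<sigma> (Var 0) = 5 * xs ! 1 + k \<and> (\<forall>i. 1 \<le> i \<longrightarrow> i < length xs \<longrightarrow> \<sigma> (Arr 0 i) = xs ! i) \<and>
      (exec c \<sigma> (Var 1) < 5 * xs ! 1 + k \<longrightarrow>
        (\<exists>t. ram_computes p xs t (map (\<lambda>i. exec c \<sigma> (Arr 11 i)) [0..<exec c \<sigma> (Var 1)]) \<and>
          t \<le> poly q (input_size xs)))"
    proof (intro exI[of _ \<sigma>] conjI allI impI)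
      show "\<sigma> (Var 0) = 5 * xs ! 1 + k" using \<sigma>R by (simp add: R_def)
      show "\<sigma> (Arr 0 i) = xs ! i" if "1 \<le> i" "i < length xs" for i using in1 that by (simp add: \<sigma>_def)
      let ?n = "?\<tau> (Var 1)"
      assume "?n < 5 * xs ! 1 + k"
      then have n: "?n < R" by (simp add: R_def)
      have "\<exists>k s'. k \<le> 18 * R + 20 \<and> (stp p ^^ k) (l2, s3) = (l2 + 26, s') \<and> s' 0 = ?n \<and>
         (\<forall>q. 1 \<le> q \<longrightarrow> q \<le> ?n \<longrightarrow> s' q = ?\<tau> (Arr 11 (q - 1)))"
      proof (rule run_epilogue[OF cd(4) _ n, where f = "\<lambda>i. ?\<tau> (Arr 11 i)"])
        show "3 \<le> R" using assms(3) by (simp add: R_def)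
      qed (use cell[of 12] cell[of 11] cell[of 0] cell[of 14] cell[of 15] fill in auto)
      then obtain m' s4 where 4: "m' \<le> 18 * R + 20" "(stp p ^^ m') (l2, s3) = (l2 + 26, s4)" "s4 0 = ?n"
        "\<forall>q. 1 \<le> q \<longrightarrow> q \<le> ?n \<longrightarrow> s4 q = ?\<tau> (Arr 11 (q - 1))" by blast
      let ?k = "15 * length xs + 1 + length asg + m + m'"
      have run: "(stp p ^^ ?k) (0, ram_input xs) = (l2 + 26, s4)"
        using funpow_trans[OF funpow_trans[OF funpow_trans[OF s1(1) st2] 3(2)] 4(2)] .
      have "\<exists>t. ram_run p (0, ram_input xs) t s4 \<and> t \<le> 5 * ?k * (x + L + ?k)"
      proof (rule run_cost[OF _ _ _ run])
        show "\<forall>i\<in>set p. lim (x + L) i" using L(2) lim_mono by fastforce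
        show "\<forall>y. ram_input xs y < 2 ^ (x + L)"
          using less_le_trans[OF ram_input_bound[of xs, folded x_def] power_increasing[of x "x + L" "2::nat"]] by simp
      qed (use L len in auto)
      then obtain t where t: "ram_run p (0, ram_input xs) t s4" "t \<le> 5 * ?k * (x + L + ?k)" by blast
      have Rx: "R \<le> x + k" using xs lx by (simp add: R_def)
      have "?k \<le> steps x"
      proof -
        have "m \<le> K * Suc R ^ D" using 3(1) KD[of R] by linarith
        also have "\<dots> \<le> K * (x + k + 1) ^ D" using Rx by (intro mult_left_mono power_mono) auto
        finally have "m \<le> K * (x + k + 1) ^ D" .
        then show ?thesis unfolding steps_def using lx 4(1) Rx by simp
      qed
      then have "5 * ?k * (x + L + ?k) \<le> 5 * steps x * (x + L + steps x)" by (intro mult_mono) auto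
      then have "t \<le> poly q (input_size xs)" using t(2) unfolding q x_def by simp
      moreover have "ram_output s4 = map (\<lambda>i. ?\<tau> (Arr 11 i)) [0..<?n]"
        unfolding ram_output_def 4(3) using 4(4) by (intro nth_equalityI) (auto simp del: upt_Suc)
      ultimately show "\<exists>t. ram_computes p xs t (map (\<lambda>i. ?\<tau> (Arr 11 i)) [0..<?n]) \<and> t \<le> poly q (input_size xs)"
        using t(1) unfolding ram_computes_def by blast
    qed
  qed
qed

section \<open>Instances of flexible graph connectivity as arcs\<close>

lemma nth_concat_fixed_length:
  assumes "\<And>x. x \<in> set xs \<Longrightarrow> length (f x) = l" "i < length xs" "j < l"
  shows "concat (map f xs) ! (l * i + j) = f (xs ! i) ! j"
  using assms
proof (induction xs arbitrary: i)
  case (Cons x xs)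
  then show ?case by (cases i) (auto simp: nth_append)
qed simp

lemma adj_rel_sym: "(x, y) \<in> adj_rel I S \<Longrightarrow> (y, x) \<in> adj_rel I S"
  by (auto simp: adj_rel_def insert_commute)

lemma adj_rtrancl_sym: "(x, y) \<in> (adj_rel I S)\<^sup>* \<Longrightarrow> (y, x) \<in> (adj_rel I S)\<^sup>*"
  by (metis adj_rel_sym sym_def sym_rtrancl symD)

lemma adj_rel_mono: "S \<subseteq> S' \<Longrightarrow> adj_rel I S \<subseteq> adj_rel I S'"
  by (auto simp: adj_rel_def)

lemma connected_by_mono: "connected_by I S \<Longrightarrow> S \<subseteq> S' \<Longrightarrow> connected_by I S'"
  using rtrancl_mono[OF adj_rel_mono[of S S' I]] by (auto simp: connected_by_def)

lemma connected_by_root: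
  assumes "\<And>x. x \<in> verts I \<Longrightarrow> (r, x) \<in> (adj_rel I S)\<^sup>*"
  shows "connected_by I S"
  unfolding connected_by_def using assms adj_rtrancl_sym by (meson rtrancl_trans)

text \<open>
  The arcs \<open>0\<close> and \<open>1\<close> lead from the source \<open>0\<close> to the root \<open>1\<close>. Edge \<open>e\<close> has the arcs \<open>2 + 4e + k\<close>:
  its two directions, and for a safe edge a second copy of each. Unused numbers and arcs into the
  root are loops.
\<close>

definition arc_ok :: "(nat \<Rightarrow> nat) \<Rightarrow> (nat \<Rightarrow> nat) \<Rightarrow> (nat \<Rightarrow> bool) \<Rightarrow> nat \<Rightarrow> nat \<Rightarrow> nat \<Rightarrow> bool" where
  "arc_ok U W sf m e k \<longleftrightarrow> e < m \<and> (k < 2 \<or> sf e) \<and> (if even k then W e else U e) \<noteq> 0"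

definition arc_tl :: "(nat \<Rightarrow> nat) \<Rightarrow> (nat \<Rightarrow> nat) \<Rightarrow> (nat \<Rightarrow> bool) \<Rightarrow> nat \<Rightarrow> nat \<Rightarrow> nat" where
  "arc_tl U W sf m i = (if i < 2 then 0 else let e = (i - 2) div 4; k = (i - 2) mod 4 in
     if arc_ok U W sf m e k then Suc (if even k then U e else W e) else 0)"

definition arc_hd :: "(nat \<Rightarrow> nat) \<Rightarrow> (nat \<Rightarrow> nat) \<Rightarrow> (nat \<Rightarrow> bool) \<Rightarrow> nat \<Rightarrow> nat \<Rightarrow> nat" where
  "arc_hd U W sf m i = (if i < 2 then 1 else let e = (i - 2) div 4; k = (i - 2) mod 4 in
     if arc_ok U W sf m e k then Suc (if even k then W e else U e) else 0)"

definition arc_cost :: "(nat \<Rightarrow> nat) \<Rightarrow> nat \<Rightarrow> nat \<Rightarrow> nat" where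
  "arc_cost cst m i = (if i < 2 \<or> m \<le> (i - 2) div 4 then 0 else cst ((i - 2) div 4))"

lemma arc_simps:
  assumes "k < 4"
  shows "arc_tl U W sf m (2 + 4 * e + k) = (if arc_ok U W sf m e k then Suc (if even k then U e else W e) else 0)"
    "arc_hd U W sf m (2 + 4 * e + k) = (if arc_ok U W sf m e k then Suc (if even k then W e else U e) else 0)"
    "arc_cost cst m (2 + 4 * e + k) = (if e < m then cst e else 0)"
  using assms by (auto simp: arc_tl_def arc_hd_def arc_cost_def Let_def)

lemma arc_cases:
  obtains "i < (2::nat)" | e k where "i = 2 + 4 * e + k" "k < 4"
proof (cases "i < 2")
  case False
  then have "i = 2 + 4 * ((i - 2) div 4) + (i - 2) mod 4" by simp
  then show ?thesis using that(2) by (metis mod_less_divisor zero_less_numeral)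
qed

locale fgc_input =
  fixes I :: "('v, 'e) fgc" and vs :: "'v list" and es :: "'e list"
  assumes inst: "fgc_instance I" and vs: "enumerates vs (verts I)" and es: "enumerates es (edges I)"
begin

definition "n = length vs"
definition "m = length es"
definition "U e = encode_edge I vs (es ! e) ! 0"
definition "W e = encode_edge I vs (es ! e) ! 1"
definition "sf e \<longleftrightarrow> es ! e \<in> safe I"
definition "cst e = nat \<lceil>5 * weight I (es ! e)\<rceil>"

abbreviation "T \<equiv> arc_tl U W sf m"
abbreviation "H \<equiv> arc_hd U W sf m"
abbreviation "C \<equiv> arc_cost cst m"
abbreviation "r \<equiv> vs ! 0"

lemma es_edges: "e < m \<Longrightarrow> es ! e \<in> edges I"
  using es nth_mem[of e es] unfolding enumerates_def m_def by blast

lemma ends_index: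
  assumes "e < m"
  shows "encode_edge I vs (es ! e) = [U e, W e, nat (fst (quotient_of (weight I (es ! e)))),
      nat (snd (quotient_of (weight I (es ! e)))), if sf e then 1 else 0]"
    and "U e < n" "W e < n" "U e \<noteq> W e" "ends I (es ! e) = {vs ! U e, vs ! W e}"
proof -
  let ?P = "{i. i < length vs \<and> vs ! i \<in> ends I (es ! e)}"
  have d: "distinct vs" "set vs = verts I" using vs by (auto simp: enumerates_def)
  have E: "ends I (es ! e) \<subseteq> verts I" "card (ends I (es ! e)) = 2"
    using inst es_edges[OF assms] by (auto simp: fgc_instance_def)
  have img: "(!) vs ` ?P = ends I (es ! e)"
    using E(1) d(2) by (auto simp: image_iff) (metis in_set_conv_nth subsetD)
  have inj: "inj_on ((!) vs) ?P" using d(1) by (auto simp: inj_on_def nth_eq_iff_index_eq)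
  have cP: "card ?P = 2" using card_image[OF inj] img E(2) by simp
  let ?L = "sorted_list_of_set ?P"
  have L: "length ?L = 2" "set ?L = ?P" "distinct ?L" using cP by auto
  have "\<exists>a b. ?L = [a, b]"
  proof -
    obtain a ys where "?L = a # ys" using L(1) by (cases ?L) auto
    moreover then obtain b where "ys = [b]" using L(1) by (cases ys) auto
    ultimately show ?thesis by blast
  qed
  then obtain a b where ab: "?L = [a, b]" by blast
  have u: "U e = a" "W e = b" using ab by (simp_all add: U_def W_def encode_edge_def)
  show "encode_edge I vs (es ! e) = [U e, W e, nat (fst (quotient_of (weight I (es ! e)))),
      nat (snd (quotient_of (weight I (es ! e)))), if sf e then 1 else 0]"
    using ab u by (simp add: encode_edge_def sf_def)
  have P: "?P = {a, b}" "a \<noteq> b" using L(2,3) ab by auto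
  then show "U e < n" "W e < n" "U e \<noteq> W e" using u by (auto simp: n_def)
  show "ends I (es ! e) = {vs ! U e, vs ! W e}" using img P u by auto
qed

lemma encode_nth:
  assumes "e < m"
  shows "encode_fgc I vs es ! (2 + 5 * e) = U e" "encode_fgc I vs es ! (3 + 5 * e) = W e"
    "encode_fgc I vs es ! (4 + 5 * e) = nat (fst (quotient_of (weight I (es ! e))))"
    "encode_fgc I vs es ! (5 + 5 * e) = nat (snd (quotient_of (weight I (es ! e))))"
    "encode_fgc I vs es ! (6 + 5 * e) = (if sf e then 1 else 0)"
proof -
  have l: "length (encode_edge I vs x) = 5" if x: "x \<in> set es" for x
  proof -
    obtain e where "e < m" "x = es ! e" using x by (auto simp: in_set_conv_nth m_def)
    then show ?thesis using ends_index(1) by simp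
  qed
  have "encode_fgc I vs es ! (2 + (5 * e + j)) = encode_edge I vs (es ! e) ! j" if "j < 5" for j
    using nth_concat_fixed_length[of es "encode_edge I vs" 5 e j, OF l] that assms by (simp add: encode_fgc_def m_def)
  from this[of 0] this[of 1] this[of 2] this[of 3] this[of 4] ends_index(1)[OF assms]
  show "encode_fgc I vs es ! (2 + 5 * e) = U e" "encode_fgc I vs es ! (3 + 5 * e) = W e"
    "encode_fgc I vs es ! (4 + 5 * e) = nat (fst (quotient_of (weight I (es ! e))))"
    "encode_fgc I vs es ! (5 + 5 * e) = nat (snd (quotient_of (weight I (es ! e))))"
    "encode_fgc I vs es ! (6 + 5 * e) = (if sf e then 1 else 0)"
    by (simp_all add: eval_nat_numeral)
qed

lemma encode_length: "length (encode_fgc I vs es) = 2 + 5 * m" "encode_fgc I vs es ! 1 = m"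
proof -
  have "length (concat (map (encode_edge I vs) ys)) = 5 * length ys" if "set ys \<subseteq> set es" for ys
    using that
  proof (induction ys)
    case (Cons y ys)
    then obtain e where "e < m" "y = es ! e" by (auto simp: in_set_conv_nth m_def)
    then show ?case using ends_index(1)[of e] Cons by simp
  qed simp
  from this[of es] show "length (encode_fgc I vs es) = 2 + 5 * m" by (simp add: encode_fgc_def m_def)
qed (simp add: encode_fgc_def m_def)

lemma vs_facts: "0 < n" "distinct vs" "set vs = verts I" "r \<in> verts I"
proof -
  show "distinct vs" "set vs = verts I" using vs by (auto simp: enumerates_def)
  then show "0 < n" using inst by (auto simp: fgc_instance_def n_def)
  then show "r \<in> verts I" using nth_mem[of 0 vs] \<open>set vs = verts I\<close> unfolding n_def by blast
qed

lemma verts_index: "x \<in> verts I \<Longrightarrow> \<exists>i<n. x = vs ! i"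
  using vs_facts(3) by (metis in_set_conv_nth n_def)

lemma vs_eq: "i < n \<Longrightarrow> j < n \<Longrightarrow> vs ! i = vs ! j \<longleftrightarrow> i = j"
  using vs_facts(2) by (simp add: n_def nth_eq_iff_index_eq)

lemma heads_bound: "T i \<le> n" "H i \<le> n" "T i \<noteq> H i \<Longrightarrow> 1 \<le> H i"
proof -
  show "T i \<le> n"
  proof (cases i rule: arc_cases)
    case (2 e k)
    then show ?thesis using ends_index(2,3)[of e] arc_simps(1)[OF 2(2)] by (auto simp: arc_ok_def Suc_le_eq)
  qed (simp add: arc_tl_def)
  show "H i \<le> n"
  proof (cases i rule: arc_cases)
    case (2 e k)
    then show ?thesis using ends_index(2,3)[of e] arc_simps(2)[OF 2(2)] by (auto simp: arc_ok_def Suc_le_eq)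
  qed (use vs_facts(1) in \<open>simp add: arc_hd_def\<close>)
  show "1 \<le> H i" if "T i \<noteq> H i"
  proof (cases i rule: arc_cases)
    case (2 e k)
    then show ?thesis using that arc_simps(1,2)[OF 2(2)] by (auto split: if_splits)
  qed (simp add: arc_hd_def)
qed

text \<open>\<open>l\<close> selects the copy of the edge. Arcs into the root do not exist, hence
  \<open>z ~= 0\<close>.\<close>

lemma arc_between:
  assumes "e < m" "ends I (es ! e) = {vs ! y, vs ! z}" "y < n" "z < n" "z \<noteq> 0" "l = 0 \<or> l = 1 \<and> sf e"
  shows "\<exists>k<4. k div 2 = l \<and> T (2 + 4 * e + k) = Suc y \<and> H (2 + 4 * e + k) = Suc z"
proof -
  note ei = ends_index[OF assms(1)]
  have "y = U e \<and> z = W e \<or> y = W e \<and> z = U e"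
    using assms(2-4) ei(2-5) by (auto simp: doubleton_eq_iff vs_eq)
  then show ?thesis
  proof
    assume a: "y = U e \<and> z = W e"
    have "arc_ok U W sf m e (2 * l)" using a assms by (auto simp: arc_ok_def)
    then show ?thesis using arc_simps[of "2 * l"] a assms(6) by (intro exI[of _ "2 * l"]) auto
  next
    assume a: "y = W e \<and> z = U e"
    have "arc_ok U W sf m e (2 * l + 1)" using a assms by (auto simp: arc_ok_def)
    then show ?thesis using arc_simps[of "2 * l + 1"] a assms(6) by (intro exI[of _ "2 * l + 1"]) auto
  qed
qed

lemma incident_edge:
  assumes "0 < j" "j < n"
  shows "\<exists>e y. e < m \<and> y < n \<and> ends I (es ! e) = {vs ! y, vs ! j}"
proof -
  have "vs ! j \<in> verts I" using assms(2) nth_mem[of j vs] vs_facts(3) unfolding n_def by blast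
  moreover have "connected_by I (edges I)" using inst by (simp add: fgc_instance_def)
  ultimately have "(r, vs ! j) \<in> (adj_rel I (edges I))\<^sup>*" using vs_facts(4) by (simp add: connected_by_def)
  moreover have "r \<noteq> vs ! j" using vs_eq[of 0 j] assms by simp
  ultimately obtain y where "(y, vs ! j) \<in> adj_rel I (edges I)" by (blast elim: rtranclE)
  then obtain d where d: "d \<in> edges I" "ends I d = {y, vs ! j}" unfolding adj_rel_def by blast
  have "y \<in> verts I" using inst d by (auto simp: fgc_instance_def)
  moreover have "d \<in> set es" using d(1) es unfolding enumerates_def by blast
  then obtain e where "e < m" "es ! e = d" unfolding in_set_conv_nth m_def by blast
  moreover obtain i where "i < n" "y = vs ! i" using \<open>y \<in> verts I\<close> verts_index by blast
  ultimately show ?thesis using d(2) by blast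
qed

text \<open>The root is the head of the source arcs, any other vertex is one because the graph is
  connected. So programs may run through the heads of arcs instead of the vertices, and the number
  of vertices is bounded in terms of that of the edges.\<close>

lemma heads_range: "2 + 4 * m \<le> R \<Longrightarrow> H ` {i. i < R \<and> T i \<noteq> H i} = {0<..n}"
proof (intro equalityI subsetI)
  fix j assume R: "2 + 4 * m \<le> R" and j: "j \<in> {0<..n}"
  show "j \<in> H ` {i. i < R \<and> T i \<noteq> H i}"
  proof (cases "j = 1")
    case True
    then show ?thesis using R by (intro image_eqI[of _ _ 0]) (auto simp: arc_tl_def arc_hd_def)
  next
    case False
    then have "0 < j - 1" "j - 1 < n" using j by auto
    then obtain e y where e: "e < m" "y < n" "ends I (es ! e) = {vs ! y, vs ! (j - 1)}"
      using incident_edge by blast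
    then obtain k where k: "k < 4" "T (2 + 4 * e + k) = Suc y" "H (2 + 4 * e + k) = j"
      using arc_between[of e y "j - 1" 0] j False \<open>j - 1 < n\<close> by auto
    have "vs ! U e \<noteq> vs ! W e" using ends_index(2-4)[OF e(1)] vs_eq by blast
    then have "vs ! y \<noteq> vs ! (j - 1)" using e(3) ends_index(5)[OF e(1)] by (metis doubleton_eq_iff)
    then have "j \<noteq> Suc y" by auto
    then have "T (2 + 4 * e + k) \<noteq> H (2 + 4 * e + k)" using k by simp
    moreover have "2 + 4 * e + k < R" using R e(1) k(1) by simp
    ultimately show ?thesis using k(3) by blast
  qed
qed (use heads_bound in force)

end

section \<open>Covers by arcs versus feasible edge sets\<close>

locale fgc_cover = fgc_input I vs es for I :: "('v, 'e) fgc" and vs :: "'v list" and es :: "'e list" +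
  fixes R :: nat
  assumes R: "3 + 4 * m \<le> R"

sublocale fgc_cover \<subseteq> weighted_arcs T H "{0<..n}" "\<lambda>i. int (C i)" "{..<R}"
proof
  show "H i \<in> {0<..n}" if "T i \<noteq> H i" for i using heads_bound(2)[of i] heads_bound(3)[OF that] by simp
qed auto

context fgc_cover begin

definition chosen :: "nat set \<Rightarrow> 'e set" where
  "chosen B = {es ! e | e. e < m \<and> (\<exists>k<4. 2 + 4 * e + k \<in> B)}"

lemma es_eq: "e < m \<Longrightarrow> e' < m \<Longrightarrow> es ! e = es ! e' \<longleftrightarrow> e = e'"
  using es by (simp add: enumerates_def m_def nth_eq_iff_index_eq)

lemma arc_adj:
  assumes "e < m" "k < 4" "T (2 + 4 * e + k) \<noteq> H (2 + 4 * e + k)" "es ! e \<in> S"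
  shows "1 \<le> T (2 + 4 * e + k)" "(vs ! (T (2 + 4 * e + k) - 1), vs ! (H (2 + 4 * e + k) - 1)) \<in> adj_rel I S"
proof -
  have ok: "arc_ok U W sf m e k" using assms(3) arc_simps[OF assms(2)] by (auto split: if_splits)
  then show "1 \<le> T (2 + 4 * e + k)" using arc_simps[OF assms(2)] by auto
  have "ends I (es ! e) = {vs ! (T (2 + 4 * e + k) - 1), vs ! (H (2 + 4 * e + k) - 1)}"
    using ends_index(5)[OF assms(1)] ok arc_simps[OF assms(2)] by auto
  then show "(vs ! (T (2 + 4 * e + k) - 1), vs ! (H (2 + 4 * e + k) - 1)) \<in> adj_rel I S"
    using assms(4) unfolding adj_rel_def by blast
qed

text \<open>Let \<open>X\<close> be the vertices cut off from the root when \<open>f\<close> is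
  removed. An arc of \<open>B\<close> entering \<open>X\<close> must belong to \<open>f\<close>,
  since otherwise its edge would connect its head to the root. An unsafe edge has just two opposite
  arcs, of which at most one enters \<open>X\<close>, but a cover has two.\<close>

lemma chosen_feasible:
  assumes "B \<subseteq> {..<R}" "covers B"
  shows "feasible I (chosen B)"
  unfolding feasible_def
proof (intro conjI ballI)
  show "chosen B \<subseteq> edges I" using es_edges by (auto simp: chosen_def)
  fix f assume f: "f \<in> unsafe I"
  then have "f \<in> set es" using es by (auto simp: unsafe_def enumerates_def)
  then obtain e0 where e0: "e0 < m" "es ! e0 = f" by (auto simp: in_set_conv_nth m_def)
  have nsf: "\<not> sf e0" using f e0 by (simp add: sf_def unsafe_def)
  define D where "D = chosen B - {f}"
  define X where "X = {j\<in>{0<..n}. (r, vs ! (j - 1)) \<notin> (adj_rel I D)\<^sup>*}"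
  have "X = {}"
  proof (rule ccontr)
    assume ne: "X \<noteq> {}"
    have "X \<subseteq> {0<..n}" by (auto simp: X_def)
    then have two: "2 \<le> card (enters B X)" using assms(2) ne unfolding covers_def by blast
    have ent: "\<exists>k<2. i = 2 + 4 * e0 + k" if i: "i \<in> enters B X" for i
    proof -
      have iX: "i \<in> B" "T i \<notin> X" "H i \<in> X" using i by (auto simp: enters_def)
      then have neq: "T i \<noteq> H i" by auto
      show ?thesis
      proof (cases i rule: arc_cases)
        case 1
        then have "H i = 1" by (simp add: arc_hd_def)
        then show ?thesis using iX(3) by (simp add: X_def)
      next
        case (2 e k)
        have ok: "arc_ok U W sf m e k" using neq arc_simps[OF 2(2)] 2(1) by (auto split: if_splits)
        then have e: "e < m" by (simp add: arc_ok_def)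
        have "es ! e = f"
        proof (rule ccontr)
          assume "es ! e \<noteq> f"
          then have "es ! e \<in> D" using e iX(1) 2 by (auto simp: D_def chosen_def)
          then have a: "1 \<le> T i" "(vs ! (T i - 1), vs ! (H i - 1)) \<in> adj_rel I D"
            using arc_adj[OF e 2(2)] neq 2(1) by auto
          have "(r, vs ! (T i - 1)) \<in> (adj_rel I D)\<^sup>*" using iX(2) a(1) heads_bound(1)[of i] by (auto simp: X_def)
          then have "(r, vs ! (H i - 1)) \<in> (adj_rel I D)\<^sup>*" using a(2) by (rule rtrancl_into_rtrancl)
          then show False using iX(3) by (simp add: X_def)
        qed
        then have "e = e0" using e e0 es_eq by blast
        moreover have "k < 2" using ok nsf calculation by (auto simp: arc_ok_def)
        ultimately show ?thesis using 2(1) by blast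
      qed
    qed
    let ?a = "2 + 4 * e0 + 0" and ?b = "2 + 4 * e0 + 1"
    have sub: "enters B X \<subseteq> {?a, ?b}"
    proof
      fix i assume "i \<in> enters B X"
      then obtain k where "k < 2" "i = 2 + 4 * e0 + k" using ent by blast
      then show "i \<in> {?a, ?b}" by (auto simp: less_2_cases_iff)
    qed
    have "\<not> (?a \<in> enters B X \<and> ?b \<in> enters B X)"
    proof
      assume "?a \<in> enters B X \<and> ?b \<in> enters B X"
      then have *: "T ?a \<notin> X" "H ?a \<in> X" "T ?b \<notin> X" "H ?b \<in> X" by (auto simp: enters_def)
      then have "arc_ok U W sf m e0 0" "arc_ok U W sf m e0 1"
        using arc_simps(2)[of 0 U W sf m e0] arc_simps(2)[of 1 U W sf m e0] by (auto simp: X_def split: if_splits)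
      then show False
        using * arc_simps(1,2)[of 0 U W sf m e0] arc_simps(1,2)[of 1 U W sf m e0] by auto
    qed
    then have "enters B X \<subseteq> {?a} \<or> enters B X \<subseteq> {?b}" using sub by blast
    then have "card (enters B X) \<le> 1" using card_mono[of "{?a}"] card_mono[of "{?b}"] by auto
    then show False using two by simp
  qed
  have all: "(r, vs ! i) \<in> (adj_rel I D)\<^sup>*" if "i < n" for i
  proof (rule ccontr)
    assume "(r, vs ! i) \<notin> (adj_rel I D)\<^sup>*"
    then have "Suc i \<in> X" using that by (simp add: X_def)
    with \<open>X = {}\<close> show False by blast
  qed
  then show "connected_by I (chosen B - {f})"
    using verts_index all unfolding D_def by (intro connected_by_root[of I r]) blast
qed

lemma cst_bounds:
  assumes "e < m" "1 \<le> weight I (es ! e)"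
  shows "5 * weight I (es ! e) \<le> of_nat (cst e)" "of_nat (cst e) \<le> 6 * weight I (es ! e)"
proof -
  have p: "0 \<le> \<lceil>5 * weight I (es ! e)\<rceil>" using assms(2) by (simp add: zero_le_ceiling)
  have eq: "of_nat (cst e) = (of_int \<lceil>5 * weight I (es ! e)\<rceil> :: rat)" using p by (simp add: cst_def)
  show "5 * weight I (es ! e) \<le> of_nat (cst e)" unfolding eq by (rule le_of_int_ceiling)
  have "(of_int \<lceil>5 * weight I (es ! e)\<rceil> :: rat) < 5 * weight I (es ! e) + 1"
    using ceiling_correct[of "5 * weight I (es ! e)"] by linarith
  then show "of_nat (cst e) \<le> 6 * weight I (es ! e)" unfolding eq using assms(2) by linarith
qed

text \<open>One arc of \<open>B\<close> per chosen edge, picked by \<open>g\<close>, already pays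
  for that edge; further arcs of \<open>B\<close> only add to the right-hand side.\<close>

lemma chosen_weight:
  assumes "B \<subseteq> {..<R}" and w: "\<forall>e\<in>edges I. 1 \<le> weight I e"
  shows "5 * total_weight I (chosen B) \<le> of_nat (\<Sum>i\<in>B. C i)"
proof -
  define J where "J = {e. e < m \<and> (\<exists>k<4. 2 + 4 * e + k \<in> B)}"
  have fB: "finite B" using assms(1) finite_subset by blast
  have J: "chosen B = (!) es ` J" by (auto simp: chosen_def J_def)
  have fJ: "finite J" by (simp add: J_def)
  have inj: "inj_on ((!) es) J" using es_eq by (auto simp: inj_on_def J_def)
  have "\<exists>g. \<forall>e\<in>J. g e < 4 \<and> 2 + 4 * e + g e \<in> B" by (rule bchoice) (auto simp: J_def)
  then obtain g where g: "\<forall>e\<in>J. g e < 4 \<and> 2 + 4 * e + g e \<in> B" by blast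
  have injg: "inj_on (\<lambda>e. 2 + 4 * e + g e) J"
  proof (rule inj_onI)
    fix x y assume *: "x \<in> J" "y \<in> J" "2 + 4 * x + g x = 2 + 4 * y + g y"
    then have "g x < 4" "g y < 4" using g by auto
    then show "x = y" using *(3) by linarith
  qed
  have "5 * total_weight I (chosen B) = (\<Sum>e\<in>J. 5 * weight I (es ! e))"
    unfolding total_weight_def J by (simp add: sum.reindex[OF inj] sum_distrib_left)
  also have "\<dots> \<le> (\<Sum>e\<in>J. of_nat (C (2 + 4 * e + g e)))"
  proof (rule sum_mono)
    fix e assume e: "e \<in> J"
    then have "e < m" "g e < 4" using g by (auto simp: J_def)
    then show "5 * weight I (es ! e) \<le> of_nat (C (2 + 4 * e + g e))"
      using cst_bounds(1)[of e] w es_edges arc_simps(3)[of "g e" cst m e] by simp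
  qed
  also have "\<dots> = of_nat (\<Sum>e\<in>J. C (2 + 4 * e + g e))" by simp
  also have "\<dots> \<le> of_nat (\<Sum>i\<in>B. C i)"
  proof -
    have "(\<Sum>e\<in>J. C (2 + 4 * e + g e)) = (\<Sum>i\<in>(\<lambda>e. 2 + 4 * e + g e) ` J. C i)"
      using sum.reindex[OF injg, of C] by (simp add: comp_def)
    also have "\<dots> \<le> (\<Sum>i\<in>B. C i)" using g fB by (intro sum_mono2) auto
    finally show ?thesis by (rule of_nat_mono)
  qed
  finally show ?thesis .
qed

lemma crossing_edge:
  assumes D: "D \<subseteq> edges I" "connected_by I D" and X: "X \<subseteq> {0<..n}" "X \<noteq> {}" "1 \<notin> X"
  shows "\<exists>e y z. e < m \<and> es ! e \<in> D \<and> y < n \<and> z < n \<and> Suc y \<notin> X \<and> Suc z \<in> X \<and>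
     ends I (es ! e) = {vs ! y, vs ! z} \<and> (r, vs ! y) \<in> (adj_rel I (D - {es ! e}))\<^sup>*"
proof -
  define Z where "Z = {vs ! (j - 1) | j. j \<in> X}"
  have inZ: "vs ! i \<in> Z \<longleftrightarrow> Suc i \<in> X" if "i < n" for i
  proof
    assume "vs ! i \<in> Z"
    then obtain j where j: "j \<in> X" "vs ! i = vs ! (j - 1)" by (auto simp: Z_def)
    moreover have "j \<in> {0<..n}" using j(1) X(1) by blast
    then have "j - 1 < n" "1 \<le> j" by auto
    ultimately show "Suc i \<in> X" using vs_eq[OF that] by auto
  next
    assume "Suc i \<in> X"
    then show "vs ! i \<in> Z" unfolding Z_def by (intro CollectI exI[of _ "Suc i"]) simp
  qed
  define D' where "D' = {d\<in>D. ends I d \<inter> Z = {}}"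
  define Y where "Y = {y. (r, y) \<in> (adj_rel I D')\<^sup>*}"
  have rZ: "r \<notin> Z" using inZ[of 0] vs_facts(1) X(3) by simp
  have YZ: "y \<notin> Z" if "y \<in> Y" for y
  proof -
    have "(r, y) \<in> (adj_rel I D')\<^sup>*" using that by (simp add: Y_def)
    then show ?thesis using rZ by (induction) (auto simp: adj_rel_def D'_def)
  qed
  have Yv: "y \<in> verts I" if "y \<in> Y" for y
  proof -
    have "(r, y) \<in> (adj_rel I D')\<^sup>*" using that by (simp add: Y_def)
    then show ?thesis
    proof (induction)
      case (step y z)
      then obtain d where "d \<in> D" "ends I d = {y, z}" by (auto simp: adj_rel_def D'_def)
      then show ?case using inst D(1) by (auto simp: fgc_instance_def)
    qed (rule vs_facts(4))
  qed
  have "\<exists>d\<in>D. \<exists>y z. ends I d = {y, z} \<and> y \<in> Y \<and> z \<in> Z"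
  proof (rule ccontr)
    assume no: "\<not> ?thesis"
    have closed: "x \<in> Y" if "(r, x) \<in> (adj_rel I D)\<^sup>*" for x
      using that
    proof (induction)
      case base
      show ?case by (simp add: Y_def)
    next
      case (step y z)
      then obtain d where d: "d \<in> D" "ends I d = {y, z}" by (auto simp: adj_rel_def)
      then have "z \<notin> Z" using no step by blast
      then have "d \<in> D'" using d YZ[OF step(3)] by (auto simp: D'_def)
      then have "(y, z) \<in> adj_rel I D'" using d(2) by (auto simp: adj_rel_def)
      then show ?case using step(3) unfolding Y_def by (simp add: rtrancl_into_rtrancl)
    qed
    obtain j where j: "j \<in> X" using X(2) by blast
    then have "j \<in> {0<..n}" using X(1) by blast
    then have j1: "j - 1 < n" "1 \<le> j" by auto
    have "vs ! (j - 1) \<in> verts I" using nth_mem[of "j - 1" vs] j1(1) vs_facts(3) unfolding n_def by blast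
    then have "(r, vs ! (j - 1)) \<in> (adj_rel I D)\<^sup>*" using D(2) vs_facts(4) unfolding connected_by_def by blast
    then have "vs ! (j - 1) \<in> Y" by (rule closed)
    then show False using YZ inZ[OF j1(1)] j j1(2) by auto
  qed
  then obtain d y z where d: "d \<in> D" "ends I d = {y, z}" "y \<in> Y" "z \<in> Z" by blast
  have "d \<in> set es" using d(1) D(1) es unfolding enumerates_def by blast
  then obtain e where e: "e < m" "es ! e = d" unfolding in_set_conv_nth m_def by blast
  obtain i where i: "i < n" "y = vs ! i" using Yv[OF d(3)] verts_index by blast
  have "z \<in> verts I" using inst D(1) d(1,2) by (auto simp: fgc_instance_def)
  then obtain k where k: "k < n" "z = vs ! k" using verts_index by blast
  have "D' \<subseteq> D - {d}" using d(2,4) by (auto simp: D'_def)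
  then have "(r, y) \<in> (adj_rel I (D - {d}))\<^sup>*"
    using d(3) rtrancl_mono[OF adj_rel_mono[of D' "D - {d}" I]] unfolding Y_def by blast
  then show ?thesis using d e i k inZ[OF i(1)] inZ[OF k(1)] YZ[OF d(3)] by blast
qed

text \<open>Bridges of \<open>S\<close> are safe, as removing an unsafe edge keeps \<open>S\<close>
  connected. A set \<open>X\<close> without the root is crossed by some edge of \<open>S\<close>. If
  it is a bridge, its two copies directed away from the root enter \<open>X\<close>. If not,
  \<open>S\<close> without it is connected and has another crossing edge, which again is a bridge or
  contributes a second arc. If \<open>X\<close> contains the root, the source arcs enter. The factor
  12 is two arcs per edge times the rounding bound 6.\<close>

lemma covers_from_feasible:
  assumes S: "feasible I S" "unsafe I \<noteq> {}" and w: "\<forall>e\<in>edges I. 1 \<le> weight I e"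
  shows "\<exists>B\<subseteq>{..<R}. covers B \<and> of_nat (\<Sum>i\<in>B. C i) \<le> 12 * total_weight I S"
proof -
  obtain f0 where f0: "f0 \<in> unsafe I" using S(2) by blast
  have SE: "S \<subseteq> edges I" using S(1) by (simp add: feasible_def)
  have conn: "connected_by I S"
    using S(1) f0 by (intro connected_by_mono[of I "S - {f0}" S]) (auto simp: feasible_def)
  define br where "br e \<longleftrightarrow> \<not> connected_by I (S - {es ! e})" for e
  define near where "near e x \<longleftrightarrow> (r, vs ! (x - 1)) \<in> (adj_rel I (S - {es ! e}))\<^sup>*" for e x
  define P where "P e k \<longleftrightarrow> (if br e then near e (T (2 + 4 * e + k)) \<and> \<not> near e (H (2 + 4 * e + k))
      \<and> T (2 + 4 * e + k) \<noteq> 0 else k < 2)" for e k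
  define J where "J = {e. e < m \<and> es ! e \<in> S}"
  define K where "K e = {k. k < 4 \<and> P e k}" for e
  define B where "B = {0, 1} \<union> (\<Union>e\<in>J. (\<lambda>k. 2 + 4 * e + k) ` K e)"
  have brsf: "sf e" if "e \<in> J" "br e" for e
    using that S(1) SE by (auto simp: br_def feasible_def J_def sf_def unsafe_def)
  have fJ: "finite J" by (simp add: J_def)
  have fK: "finite (K e)" for e by (simp add: K_def)
  have cK: "card (K e) \<le> 2" if "e \<in> J" for e
  proof (cases "br e")
    case False
    then have "K e \<subseteq> {..<2}" by (auto simp: K_def P_def)
    from card_mono[OF _ this] show ?thesis by simp
  next
    case True
    have *: "\<not> (k \<in> K e \<and> l \<in> K e)" if "even k" "odd l" for k l
    proof
      assume kl: "k \<in> K e \<and> l \<in> K e"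
      then have b: "k < 4" "l < 4" by (auto simp: K_def)
      have kP: "P e k" "P e l" using kl by (auto simp: K_def)
      then have "arc_ok U W sf m e k" "arc_ok U W sf m e l"
        using arc_simps(1)[OF b(1)] arc_simps(1)[OF b(2)] True by (auto simp: P_def split: if_splits)
      then show False using kP True that arc_simps(1,2)[OF b(1)] arc_simps(1,2)[OF b(2)] by (auto simp: P_def)
    qed
    have "K e \<subseteq> {0, 2} \<or> K e \<subseteq> {1, 3}"
    proof (rule ccontr)
      assume "\<not> ?thesis"
      then obtain k l where kl: "k \<in> K e" "l \<in> K e" "k \<notin> {0, 2}" "l \<notin> {1, 3}" by blast
      then have "k < 4" "l < 4" by (auto simp: K_def)
      then have "k = 1 \<or> k = 3" "l = 0 \<or> l = 2" using kl(3,4) by auto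
      then have "odd k" "even l" by auto
      then show False using * kl by blast
    qed
    then show ?thesis using card_mono[of "{0, 2}" "K e"] card_mono[of "{1, 3}" "K e"] by auto
  qed
  have BR: "B \<subseteq> {..<R}" using R by (auto simp: B_def K_def J_def)
  have cost: "of_nat (\<Sum>i\<in>B. C i) \<le> 12 * total_weight I S"
  proof -
    let ?Q = "(\<Union>e\<in>J. (\<lambda>k. 2 + 4 * e + k) ` K e)"
    have "(\<Sum>i\<in>B. C i) = (\<Sum>i\<in>?Q. C i)"
      unfolding B_def using fJ fK by (intro sum.mono_neutral_right) (auto simp: arc_cost_def)
    also have "\<dots> = (\<Sum>e\<in>J. \<Sum>i\<in>(\<lambda>k. 2 + 4 * e + k) ` K e. C i)"
    proof (rule sum.UNION_disjoint[OF fJ])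
      show "\<forall>e\<in>J. finite ((\<lambda>k. 2 + 4 * e + k) ` K e)" using fK by simp
      have "2 + 4 * e + k \<noteq> 2 + 4 * e' + k'" if "e \<noteq> e'" "k < 4" "k' < 4" for e e' k k' :: nat
        using that by presburger
      then show "\<forall>e\<in>J. \<forall>e'\<in>J. e \<noteq> e' \<longrightarrow>
          (\<lambda>k. 2 + 4 * e + k) ` K e \<inter> (\<lambda>k. 2 + 4 * e' + k) ` K e' = {}"
        by (auto simp: K_def)
    qed
    also have "\<dots> \<le> (\<Sum>e\<in>J. 2 * cst e)"
    proof (rule sum_mono)
      fix e assume e: "e \<in> J"
      have "(\<Sum>i\<in>(\<lambda>k. 2 + 4 * e + k) ` K e. C i) = (\<Sum>k\<in>K e. C (2 + 4 * e + k))"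
        by (subst sum.reindex) (auto simp: inj_on_def)
      also have "\<dots> = (\<Sum>k\<in>K e. cst e)"
        using e arc_simps(3)[of _ cst m e] by (intro sum.cong) (auto simp: K_def J_def)
      also have "\<dots> \<le> 2 * cst e" using cK[OF e] by simp
      finally show "(\<Sum>i\<in>(\<lambda>k. 2 + 4 * e + k) ` K e. C i) \<le> 2 * cst e" .
    qed
    finally have "of_nat (\<Sum>i\<in>B. C i) \<le> (of_nat (\<Sum>e\<in>J. 2 * cst e) :: rat)" by (rule of_nat_mono)
    also have "\<dots> = (\<Sum>e\<in>J. 2 * of_nat (cst e))" by simp
    also have "\<dots> \<le> (\<Sum>e\<in>J. 12 * weight I (es ! e))"
    proof (rule sum_mono)
      fix e assume "e \<in> J"
      then have "e < m" by (simp add: J_def)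
      then show "2 * of_nat (cst e) \<le> 12 * weight I (es ! e)"
        using cst_bounds(2)[of e] w es_edges[of e] by simp
    qed
    also have "\<dots> = 12 * total_weight I S"
    proof -
      have inj: "inj_on ((!) es) J" using es_eq by (auto simp: inj_on_def J_def)
      have "S \<subseteq> (!) es ` J"
      proof
        fix d assume d: "d \<in> S"
        then have "d \<in> set es" using SE es unfolding enumerates_def by blast
        then obtain e where "e < m" "es ! e = d" unfolding in_set_conv_nth m_def by blast
        then show "d \<in> (!) es ` J" using d by (auto simp: J_def)
      qed
      then have "S = (!) es ` J" by (auto simp: J_def)
      then show ?thesis unfolding total_weight_def by (simp add: sum.reindex[OF inj] sum_distrib_left)
    qed
    finally show ?thesis .
  qed
  have "2 \<le> card (enters B X)" if X: "X \<subseteq> {0<..n}" "X \<noteq> {}" for X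
  proof -
    have fB: "finite (enters B X)" using BR finite_subset by (intro finite_enters) blast
    have "\<exists>i j. i \<noteq> j \<and> i \<in> enters B X \<and> j \<in> enters B X"
    proof (cases "1 \<in> X")
      case True
      have "0 \<notin> X" using X by auto
      then have "0 \<in> enters B X" "1 \<in> enters B X" using True by (auto simp: enters_def B_def arc_tl_def arc_hd_def)
      then show ?thesis by (intro exI[of _ 0] exI[of _ 1]) simp
    next
      case False
      have bridge: "\<exists>i j. i \<noteq> j \<and> i \<in> enters B X \<and> j \<in> enters B X"
        if e: "e < m" "es ! e \<in> S" "br e" "y < n" "z < n" "Suc y \<notin> X" "Suc z \<in> X"
          "ends I (es ! e) = {vs ! y, vs ! z}" "(r, vs ! y) \<in> (adj_rel I (S - {es ! e}))\<^sup>*" for e y z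
      proof -
        have eJ: "e \<in> J" using e by (simp add: J_def)
        have z0: "z \<noteq> 0" using e(7) False by (intro notI) simp
        \<comment> \<open>If both ends were reachable without the edge, it could be bypassed in
          every path, and it would not be a bridge.\<close>
        have zfar: "(r, vs ! z) \<notin> (adj_rel I (S - {es ! e}))\<^sup>*"
        proof
          assume z: "(r, vs ! z) \<in> (adj_rel I (S - {es ! e}))\<^sup>*"
          have "(a, b) \<in> (adj_rel I (S - {es ! e}))\<^sup>*" if ab: "(a, b) \<in> adj_rel I S" for a b
          proof -
            obtain d where d: "d \<in> S" "ends I d = {a, b}" using ab unfolding adj_rel_def by blast
            show ?thesis
            proof (cases "d = es ! e")
              case True
              then have "{a, b} = {vs ! y, vs ! z}" using d e(8) by simp
              then have "(r, a) \<in> (adj_rel I (S - {es ! e}))\<^sup>*" "(r, b) \<in> (adj_rel I (S - {es ! e}))\<^sup>*"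
                using z e(9) by (auto simp: doubleton_eq_iff)
              then show ?thesis using adj_rtrancl_sym rtrancl_trans by metis
            next
              case False
              then have "(a, b) \<in> adj_rel I (S - {es ! e})" using d by (auto simp: adj_rel_def)
              then show ?thesis by (rule r_into_rtrancl)
            qed
          qed
          then have "(adj_rel I S)\<^sup>* \<subseteq> (adj_rel I (S - {es ! e}))\<^sup>*"
            by (intro rtrancl_subset_rtrancl) auto
          then have "connected_by I (S - {es ! e})" using conn unfolding connected_by_def by blast
          then show False using e(3) by (simp add: br_def)
        qed
        have "\<exists>k<4. k div 2 = l \<and> T (2 + 4 * e + k) = Suc y \<and> H (2 + 4 * e + k) = Suc z" if "l = 0 \<or> l = 1" for l
          using arc_between[OF e(1,8,4,5) z0, of l] brsf[OF eJ e(3)] that by blast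
        then obtain k l where kl: "k < 4" "k div 2 = 0" "T (2 + 4 * e + k) = Suc y" "H (2 + 4 * e + k) = Suc z"
          "l < 4" "l div 2 = 1" "T (2 + 4 * e + l) = Suc y" "H (2 + 4 * e + l) = Suc z" by metis
        then have "k \<in> K e" "l \<in> K e" using e(3,9) zfar by (auto simp: K_def P_def near_def)
        then have "2 + 4 * e + k \<in> B" "2 + 4 * e + l \<in> B" using eJ by (auto simp: B_def)
        then have "2 + 4 * e + k \<in> enters B X" "2 + 4 * e + l \<in> enters B X"
          using kl e(6,7) unfolding enters_def by auto
        moreover have "k \<noteq> l" using kl(2,6) by auto
        ultimately show ?thesis by (metis add_left_cancel)
      qed
      have single: "\<exists>k<4. 2 + 4 * e + k \<in> enters B X"
        if e: "e < m" "es ! e \<in> S" "\<not> br e" "y < n" "z < n" "Suc y \<notin> X" "Suc z \<in> X"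
          "ends I (es ! e) = {vs ! y, vs ! z}" for e y z
      proof -
        have z0: "z \<noteq> 0" using e(7) False by (intro notI) simp
        obtain k where k: "k < 4" "k div 2 = 0" "T (2 + 4 * e + k) = Suc y" "H (2 + 4 * e + k) = Suc z"
          using arc_between[OF e(1,8,4,5) z0, of 0] by auto
        then have "k \<in> K e" using e(3) by (auto simp: K_def P_def)
        then have "2 + 4 * e + k \<in> B" using e(1,2) by (auto simp: B_def J_def)
        then show ?thesis using k e(6,7) by (auto simp: enters_def)
      qed
      obtain e y z where e: "e < m" "es ! e \<in> S" "y < n" "z < n" "Suc y \<notin> X" "Suc z \<in> X"
          "ends I (es ! e) = {vs ! y, vs ! z}" "(r, vs ! y) \<in> (adj_rel I (S - {es ! e}))\<^sup>*"
        using crossing_edge[OF SE conn X False] by blast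
      show ?thesis
      proof (cases "br e")
        case True
        then show ?thesis using bridge e by blast
      next
        case nb: False
        then have conn': "connected_by I (S - {es ! e})" by (simp add: br_def)
        have "S - {es ! e} \<subseteq> edges I" using SE by blast
        from crossing_edge[OF this conn' X False]
        obtain e' y' z' where e': "e' < m" "es ! e' \<in> S - {es ! e}" "y' < n" "z' < n" "Suc y' \<notin> X" "Suc z' \<in> X"
          "ends I (es ! e') = {vs ! y', vs ! z'}" "(r, vs ! y') \<in> (adj_rel I (S - {es ! e} - {es ! e'}))\<^sup>*"
          by blast
        have "S - {es ! e} - {es ! e'} \<subseteq> S - {es ! e'}" by blast
        then have r': "(r, vs ! y') \<in> (adj_rel I (S - {es ! e'}))\<^sup>*"
          using e'(8) rtrancl_mono[OF adj_rel_mono] by blast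
        show ?thesis
        proof (cases "br e'")
          case True
          then show ?thesis using bridge e' r' by blast
        next
          case False
          obtain k where k: "k < 4" "2 + 4 * e + k \<in> enters B X" using single e nb by blast
          obtain k' where k': "k' < 4" "2 + 4 * e' + k' \<in> enters B X" using single[of e' y' z'] e' False by blast
          have "e \<noteq> e'" using e'(2) by blast
          then have "2 + 4 * e + k \<noteq> 2 + 4 * e' + k'" using k(1) k'(1) by presburger
          then show ?thesis using k k' by blast
        qed
      qed
    qed
    then obtain i j where "i \<noteq> j" "{i, j} \<subseteq> enters B X" by blast
    then show ?thesis using card_mono[OF fB, of "{i, j}"] by simp
  qed
  then have "covers B" unfolding covers_def by blast
  then show ?thesis using BR cost by blast
qed

end

section \<open>The algorithm\<close>

definition frame :: "nat set \<Rightarrow> nat set \<Rightarrow> store \<Rightarrow> store \<Rightarrow> bool" where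
  "frame X J \<sigma> \<tau> \<longleftrightarrow> (\<forall>x. x \<notin> X \<longrightarrow> \<tau> (Var x) = \<sigma> (Var x)) \<and> (\<forall>j i. j \<notin> J \<longrightarrow> \<tau> (Arr j i) = \<sigma> (Arr j i))"

lemma frameD:
  assumes "frame X J \<sigma> \<tau>"
  shows "x \<notin> X \<Longrightarrow> \<tau> (Var x) = \<sigma> (Var x)" "j \<notin> J \<Longrightarrow> \<tau> (Arr j i) = \<sigma> (Arr j i)"
  using assms by (auto simp: frame_def)

lemma frame_exec: "frame (wv c) (wa c) \<sigma> (exec c \<sigma>)"
  by (simp add: frame_def exec_frame_var exec_frame_arr)

text \<open>Adds to the invariant that all places not written by the loop keep their values, so that
  invariants need only mention what changes.\<close>

lemma exec_For_frame:
  assumes "x \<noteq> 0" "x \<notin> wv c" "0 \<notin> wv c" "\<sigma> (Var 0) = R" "P 0 (\<sigma>(Var x := 0))"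
    and "\<And>i \<tau>. i < R \<Longrightarrow> P i \<tau> \<Longrightarrow> \<tau> (Var x) = i \<Longrightarrow> frame (wv (For x c)) (wa (For x c)) \<sigma> \<tau> \<Longrightarrow>
       P (Suc i) ((exec c \<tau>)(Var x := Suc i))"
  shows "P R (exec (For x c) \<sigma>)"
proof -
  let ?P = "\<lambda>i \<tau>. P i \<tau> \<and> frame (wv (For x c)) (wa (For x c)) \<sigma> \<tau>"
  have "?P R (exec (For x c) \<sigma>)"
  proof (rule exec_For[where P = ?P])
    show "?P 0 (\<sigma>(Var x := 0))" using assms(5) by (auto simp: frame_def)
    fix i \<tau> assume i: "i < R" "?P i \<tau>" "\<tau> (Var x) = i"
    have "frame (wv (For x c)) (wa (For x c)) \<sigma> ((exec c \<tau>)(Var x := Suc i))"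
      using i(2) frame_exec[of c \<tau>] by (auto simp: frame_def)
    then show "?P (Suc i) ((exec c \<tau>)(Var x := Suc i))" using assms(6) i by blast
  qed (use assms in auto)
  then show ?thesis ..
qed

definition notE :: "exp \<Rightarrow> exp" where "notE a = Minus (N 1) a"
definition eqE :: "exp \<Rightarrow> exp \<Rightarrow> exp" where "eqE a b = Minus (N 1) (Plus (Minus a b) (Minus b a))"
definition ltE :: "exp \<Rightarrow> exp \<Rightarrow> exp" where "ltE a b = Minus b a"
definition guard :: "exp \<Rightarrow> com \<Rightarrow> com" where "guard e c = If e c (Assign 47 (N 0))"

lemma ev_notE [simp]: "ev (notE a) \<sigma> = 0 \<longleftrightarrow> ev a \<sigma> \<noteq> 0" by (auto simp: notE_def)
lemma ev_eqE [simp]: "ev (eqE a b) \<sigma> = 0 \<longleftrightarrow> ev a \<sigma> \<noteq> ev b \<sigma>" by (auto simp: eqE_def)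
lemma ev_ltE [simp]: "ev (ltE a b) \<sigma> = 0 \<longleftrightarrow> \<not> ev a \<sigma> < ev b \<sigma>" by (auto simp: ltE_def)
lemma exec_guard [simp]: "exec (guard e c) \<sigma> = (if ev e \<sigma> = 0 then \<sigma>(Var 47 := 0) else exec c \<sigma>)"
  by (simp add: guard_def)
lemma wv_guard [simp]: "wv (guard e c) = insert 47 (wv c)" by (auto simp: guard_def)
lemma wa_guard [simp]: "wa (guard e c) = wa c" by (auto simp: guard_def)
lemma wfc_guard [simp]: "wfc (guard e c) \<longleftrightarrow> wfe 48 e \<and> wfc c" by (auto simp: guard_def)
lemma wfe_ops [simp]: "wfe t (notE a) \<longleftrightarrow> t < 64 \<and> wfe (Suc t) a"
  "wfe t (eqE a b) \<longleftrightarrow> t < 64 \<and> wfe (Suc t) a \<and> wfe (Suc (Suc t)) b \<and> wfe (Suc (Suc (Suc t))) a"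
  "wfe t (ltE a b) \<longleftrightarrow> wfe t b \<and> wfe (Suc t) a"
  by (auto simp: notE_def eqE_def ltE_def)

text \<open>
  Arrays: 0 input, 16, 2, 3 tails, heads and costs of the arcs, 4 the current cover, 5 the set under test,
  6 marks, 7 shortest walks, 8 and 9 their last steps, 10 the candidate cover, 11 the output.
  Entry \<open>k * R + v\<close> of array 7 is \<open>1\<close> plus the least weight of a walk of \<open>k\<close> steps to \<open>v\<close>, or \<open>0\<close> if there
  is none; the weight of every step is raised by \<open>Q\<close> to keep it nonnegative.

  Variables: 10 the additional source and 11, 12 the deleted arcs of \<open>reach\<close>; 15, 22 the results of \<open>feas\<close>
  and \<open>exchc\<close>; 20, 21 the pair of arcs to be exchanged; 25, 26 the offsets of two consecutive levels of
  the table; 30 the start of the walks; 47 a dummy.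
\<close>

definition mark :: com where
  "mark = For 13 (guard (A 5 (V 13)) (guard (notE (eqE (V 13) (V 11))) (guard (notE (eqE (V 13) (V 12)))
     (guard (A 6 (A 16 (V 13))) (Put 6 (A 2 (V 13)) (N 1))))))"

definition reach :: com where
  "reach = For 13 (Put 6 (V 13) (N 0)) ;; Put 6 (N 0) (N 1) ;; Put 6 (V 10) (N 1) ;; For 14 mark"

definition feas :: com where
  "feas = Assign 15 (N 1) ;; For 18 (Assign 10 (N 0) ;; Assign 11 (V 18) ;; Assign 12 (V 18) ;; reach ;;
     For 17 (guard (notE (eqE (A 16 (V 17)) (A 2 (V 17)))) (guard (notE (A 6 (A 2 (V 17)))) (Assign 15 (N 0)))))"

definition copy :: "nat \<Rightarrow> nat \<Rightarrow> com" where
  "copy a b = For 19 (Put b (V 19) (A a (V 19)))"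

definition prune :: com where
  "prune = For 16 (copy 4 5 ;; Put 5 (V 16) (N 0) ;; feas ;; guard (V 15) (Put 4 (V 16) (N 0)))"

text \<open>Its complement within the vertices is the largest set that avoids \<open>s\<close> and
  is entered by no arc of \<open>F\<close>. The second source \<open>s\<close> thus excludes a
  prescribed vertex from the set sought.\<close>

definition rch :: "(nat \<Rightarrow> nat) \<Rightarrow> (nat \<Rightarrow> nat) \<Rightarrow> nat set \<Rightarrow> nat \<Rightarrow> nat set" where
  "rch t h F s = {v. \<exists>u\<in>{0, s}. (u, v) \<in> {(t i, h i) | i. i \<in> F}\<^sup>*}"

lemma rch_base: "0 \<in> rch t h F s" "s \<in> rch t h F s"
  by (auto simp: rch_def)

lemma rch_step: "i \<in> F \<Longrightarrow> t i \<in> rch t h F s \<Longrightarrow> h i \<in> rch t h F s"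
  unfolding rch_def by (blast intro: rtrancl_into_rtrancl)

lemma rch_least:
  assumes "0 \<in> M" "s \<in> M" "\<And>i. i \<in> F \<Longrightarrow> t i \<in> M \<Longrightarrow> h i \<in> M"
  shows "rch t h F s \<subseteq> M"
proof
  fix v assume "v \<in> rch t h F s"
  then obtain u where u: "u \<in> {0, s}" "(u, v) \<in> {(t i, h i) | i. i \<in> F}\<^sup>*" by (auto simp: rch_def)
  from u(2) show "v \<in> M" using u(1) assms by (induction) auto
qed

lemma wv_mark: "wv mark = {13, 47}" "wa mark = {6}"
  by (auto simp: mark_def)

lemma wv_reach: "wv reach = {13, 14, 47}" "wa reach = {6}"
  by (auto simp: reach_def wv_mark)

lemma wv_feas: "wv feas = {10, 11, 12, 13, 14, 15, 17, 18, 47}" "wa feas = {6}"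
  by (auto simp: feas_def wv_reach)

lemma wv_copy: "wv (copy a b) = {19}" "wa (copy a b) = {b}"
  by (auto simp: copy_def)

lemma wv_prune: "wv prune = {10, 11, 12, 13, 14, 15, 16, 17, 18, 19, 47}" "wa prune = {4, 5, 6}"
  by (auto simp: prune_def wv_copy wv_feas)

section \<open>Covers and exchangeable pairs decided by reachability\<close>

context fgc_cover begin

lemma n_less_R: "n < R"
proof -
  have "card {0<..n} = card (H ` {i. i < 2 + 4 * m \<and> T i \<noteq> H i})" using heads_range[of "2 + 4 * m"] by simp
  also have "\<dots> \<le> card {i. i < 2 + 4 * m \<and> T i \<noteq> H i}" by (rule card_image_le) simp
  also have "\<dots> \<le> card {..<2 + 4 * m}" by (intro card_mono) auto
  finally show ?thesis using R by simp
qed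

lemma arcs_less_R: "T i < R" "H i < R"
  using heads_bound[of i] n_less_R by auto

lemma heads_R: "H ` {i. i < R \<and> T i \<noteq> H i} = {0<..n}"
  using heads_range R by simp

text \<open>The vertices unreachable after deletion of \<open>e\<close> form a set entered by no arc
  but \<open>e\<close>. Conversely, a set entered by at most one arc becomes unreachable when this
  arc is deleted; if none enters, any \<open>e\<close> will do.\<close>

lemma covers_iff_reach:
  assumes "B \<subseteq> {..<R}"
  shows "covers B \<longleftrightarrow> (\<forall>e<R. \<forall>i<R. T i \<noteq> H i \<longrightarrow> H i \<in> rch T H (B - {e}) 0)"
proof
  assume cov: "covers B"
  show "\<forall>e<R. \<forall>i<R. T i \<noteq> H i \<longrightarrow> H i \<in> rch T H (B - {e}) 0"
  proof (intro allI impI)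
    fix e i assume i: "i < R" "T i \<noteq> H i"
    let ?M = "rch T H (B - {e}) 0"
    have "{0<..n} - ?M = {}"
    proof (rule ccontr)
      assume ne: "{0<..n} - ?M \<noteq> {}"
      have "2 \<le> card (enters B ({0<..n} - ?M))" using cov ne unfolding covers_def by blast
      moreover have "enters B ({0<..n} - ?M) \<subseteq> {e}"
      proof
        fix j assume "j \<in> enters B ({0<..n} - ?M)"
        then have j: "j \<in> B" "T j \<notin> {0<..n} - ?M" "H j \<in> {0<..n} - ?M" by (auto simp: enters_def)
        have "T j \<in> ?M" using j(2) heads_bound(1)[of j] rch_base(1) by (cases "T j = 0") auto
        then show "j \<in> {e}" using rch_step[of j "B - {e}" T H 0] j by blast
      qed
      ultimately show False using card_mono[of "{e}" "enters B ({0<..n} - ?M)"] by simp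
    qed
    moreover have "H i \<in> {0<..n}" using heads_R i by blast
    ultimately show "H i \<in> ?M" by blast
  qed
next
  assume *: "\<forall>e<R. \<forall>i<R. T i \<noteq> H i \<longrightarrow> H i \<in> rch T H (B - {e}) 0"
  show "covers B" unfolding covers_def
  proof (intro allI impI)
    fix X assume X: "X \<subseteq> {0<..n}" "X \<noteq> {}"
    show "2 \<le> card (enters B X)"
    proof (rule ccontr)
      assume "\<not> 2 \<le> card (enters B X)"
      moreover have "finite (enters B X)" using assms finite_subset by (intro finite_enters) blast
      ultimately have "enters B X = {} \<or> (\<exists>e. enters B X = {e})"
        by (metis One_nat_def card_1_singletonE card_eq_0_iff less_2_cases not_le)
      then have "\<exists>e<R. enters B X \<subseteq> {e}"
      proof
        assume "enters B X = {}"
        then show ?thesis using R by (intro exI[of _ 0]) auto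
      next
        assume "\<exists>e. enters B X = {e}"
        then obtain e where "enters B X = {e}" by blast
        moreover from this have "e < R" using assms by (auto simp: enters_def)
        ultimately show ?thesis by blast
      qed
      then obtain e where e: "e < R" "enters B X \<subseteq> {e}" by blast
      have "rch T H (B - {e}) 0 \<subseteq> - X"
        using e(2) X by (intro rch_least) (auto simp: enters_def)
      moreover obtain v where v: "v \<in> X" using X(2) by blast
      then have "v \<in> H ` {i. i < R \<and> T i \<noteq> H i}" using X(1) heads_R by blast
      then have "v \<in> rch T H (B - {e}) 0" using * e(1) by blast
      ultimately show False using v by blast
    qed
  qed
qed

text \<open>A tight set around \<open>a\<close> that misses an end \<open>s\<close> of
  \<open>b\<close> is entered by exactly two arcs; deleting them leaves both ends of
  \<open>a\<close> unreachable even with \<open>s\<close> as a source. Conversely, a set left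
  unreachable by deleting \<open>e\<close> and \<open>f\<close> is entered by at most two arcs, so
  by exactly two in a cover, and is tight.\<close>

lemma exch_iff_reach:
  assumes B: "B \<subseteq> {..<R}" "regular B" "covers B"
  shows "exch B a b \<longleftrightarrow> (\<forall>e<R. \<forall>f<R. \<forall>s\<in>{T b, H b}. T a \<in> rch T H (B - {e, f}) s \<or> H a \<in> rch T H (B - {e, f}) s)"
proof
  assume ex: "exch B a b"
  show "\<forall>e<R. \<forall>f<R. \<forall>s\<in>{T b, H b}. T a \<in> rch T H (B - {e, f}) s \<or> H a \<in> rch T H (B - {e, f}) s"
  proof (intro allI impI ballI, rule ccontr)
    fix e f s assume s: "s \<in> {T b, H b}"
    let ?M = "rch T H (B - {e, f}) s"
    let ?X = "{0<..n} - ?M"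
    assume "\<not> (T a \<in> ?M \<or> H a \<in> ?M)"
    then have no: "T a \<notin> ?M" "H a \<notin> ?M" by auto
    then have "T a \<noteq> 0" "H a \<noteq> 0" using rch_base(1)[of T H "B - {e, f}" s] by metis+
    then have aX: "T a \<in> ?X" "H a \<in> ?X" using no heads_bound(1,2)[of a] by auto
    have "enters B ?X \<subseteq> {e, f}"
    proof
      fix j assume "j \<in> enters B ?X"
      then have j: "j \<in> B" "T j \<notin> ?X" "H j \<in> ?X" by (auto simp: enters_def)
      have "T j \<in> ?M" using j(2) heads_bound(1)[of j] rch_base(1) by (cases "T j = 0") auto
      then show "j \<in> {e, f}" using rch_step[of j "B - {e, f}" T H s] j by blast
    qed
    then have "card (enters B ?X) \<le> card {e, f}" by (intro card_mono) auto
    also have "\<dots> \<le> 2" by (simp add: card_insert_if)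
    finally have "card (enters B ?X) \<le> 2" .
    moreover have "2 \<le> card (enters B ?X)" using B(3) aX unfolding covers_def by blast
    ultimately have "card (enters B ?X) = 2" by simp
    moreover have "?X \<noteq> {}" using aX by blast
    ultimately have "tight B ?X" using tight_iff_enters[OF B(2), of ?X] by blast
    then have "T b \<in> ?X" "H b \<in> ?X" using ex aX unfolding exch_def by blast+
    then show False using s rch_base(2)[of s T H "B - {e, f}"] by auto
  qed
next
  assume *: "\<forall>e<R. \<forall>f<R. \<forall>s\<in>{T b, H b}. T a \<in> rch T H (B - {e, f}) s \<or> H a \<in> rch T H (B - {e, f}) s"
  show "exch B a b" unfolding exch_def
  proof (intro allI impI, rule ccontr)
    fix X assume X: "tight B X" "T a \<in> X" "H a \<in> X" and "\<not> (T b \<in> X \<and> H b \<in> X)"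
    then obtain s where s: "s \<in> {T b, H b}" "s \<notin> X" by blast
    have Xn: "X \<subseteq> {0<..n}" using X(1) unfolding tight_def by blast
    have "card (enters B X) = 2" using X(1) tight_iff_enters[OF B(2)] by blast
    then obtain e f where ef: "enters B X = {e, f}" by (meson card_2_iff)
    then have "e < R" "f < R" using B(1) by (auto simp: enters_def)
    moreover have "rch T H (B - {e, f}) s \<subseteq> - X"
      using ef s(2) Xn by (intro rch_least) (auto simp: enters_def)
    ultimately show False using * X(2,3) s(1) by blast
  qed
qed

definition arrs :: "store \<Rightarrow> bool" where
  "arrs \<sigma> \<longleftrightarrow> \<sigma> (Var 0) = R \<and> (\<forall>i<R. \<sigma> (Arr 16 i) = T i \<and> \<sigma> (Arr 2 i) = H i \<and> \<sigma> (Arr 3 i) = C i)"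

definition setof :: "nat \<Rightarrow> store \<Rightarrow> nat set" where
  "setof j \<sigma> = {i. i < R \<and> \<sigma> (Arr j i) \<noteq> 0}"

lemma arrs_frame: "arrs \<sigma> \<Longrightarrow> frame X J \<sigma> \<tau> \<Longrightarrow> 0 \<notin> X \<Longrightarrow> 16 \<notin> J \<Longrightarrow> 2 \<notin> J \<Longrightarrow> 3 \<notin> J \<Longrightarrow> arrs \<tau>"
  by (simp add: arrs_def frame_def)

lemma setof_frame: "frame X J \<sigma> \<tau> \<Longrightarrow> j \<notin> J \<Longrightarrow> setof j \<tau> = setof j \<sigma>"
  by (simp add: setof_def frame_def)

lemma arrsD: "arrs \<sigma> \<Longrightarrow> i < R \<Longrightarrow> \<sigma> (Arr 16 i) = T i" "arrs \<sigma> \<Longrightarrow> i < R \<Longrightarrow> \<sigma> (Arr 2 i) = H i"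
  "arrs \<sigma> \<Longrightarrow> i < R \<Longrightarrow> \<sigma> (Arr 3 i) = C i" "arrs \<sigma> \<Longrightarrow> \<sigma> (Var 0) = R"
  by (auto simp: arrs_def)

lemma setof_subset: "setof j \<sigma> \<subseteq> {..<R}"
  by (auto simp: setof_def)

lemma setof_upd: "setof j (\<sigma>(Var x := v)) = setof j \<sigma>"
  by (simp add: setof_def)

lemma arrs_upd: "x \<noteq> 0 \<Longrightarrow> arrs (\<sigma>(Var x := v)) \<longleftrightarrow> arrs \<sigma>"
  by (simp add: arrs_def)

lemma setof_put: "i < R \<Longrightarrow> setof j (\<sigma>(Arr j i := v)) = (if v = 0 then setof j \<sigma> - {i} else insert i (setof j \<sigma>))"
  "j \<noteq> k \<Longrightarrow> setof j (\<sigma>(Arr k l := v)) = setof j \<sigma>"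
  by (auto simp: setof_def)

lemma mark_spec:
  assumes "arrs \<sigma>"
  defines "F \<equiv> setof 5 \<sigma> - {\<sigma> (Var 11), \<sigma> (Var 12)}"
  defines "\<tau> \<equiv> exec mark \<sigma>"
  shows "setof 6 \<sigma> \<subseteq> setof 6 \<tau>" "\<And>i. i \<in> F \<Longrightarrow> T i \<in> setof 6 \<sigma> \<Longrightarrow> H i \<in> setof 6 \<tau>"
    "setof 6 \<sigma> \<subseteq> rch T H F s \<Longrightarrow> setof 6 \<tau> \<subseteq> rch T H F s"
proof -
  let ?c = "guard (A 5 (V 13)) (guard (notE (eqE (V 13) (V 11))) (guard (notE (eqE (V 13) (V 12)))
     (guard (A 6 (A 16 (V 13))) (Put 6 (A 2 (V 13)) (N 1)))))"
  let ?P = "\<lambda>n \<tau>. setof 6 \<sigma> \<subseteq> setof 6 \<tau> \<and> (\<forall>i<n. i \<in> F \<longrightarrow> T i \<in> setof 6 \<sigma> \<longrightarrow> H i \<in> setof 6 \<tau>) \<and>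
     (setof 6 \<sigma> \<subseteq> rch T H F s \<longrightarrow> setof 6 \<tau> \<subseteq> rch T H F s)"
  have "?P R (exec (For 13 ?c) \<sigma>)"
  proof (rule exec_For_frame[where P = ?P])
    fix i \<tau> assume i: "i < R" "?P i \<tau>" "\<tau> (Var 13) = i" and fr: "frame (wv (For 13 ?c)) (wa (For 13 ?c)) \<sigma> \<tau>"
    have ar: "arrs \<tau>" using assms(1) fr by (rule arrs_frame) auto
    have v: "\<tau> (Var 11) = \<sigma> (Var 11)" "\<tau> (Var 12) = \<sigma> (Var 12)" "\<tau> (Arr 5 i) = \<sigma> (Arr 5 i)"
      using frameD[OF fr] by auto
    have iF: "i \<in> F \<longleftrightarrow> \<tau> (Arr 5 i) \<noteq> 0 \<and> i \<noteq> \<tau> (Var 11) \<and> i \<noteq> \<tau> (Var 12)"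
      using i(1) v by (auto simp: F_def setof_def)
    have eq: "setof 6 ((exec ?c \<tau>)(Var 13 := Suc i)) =
       (if i \<in> F \<and> T i \<in> setof 6 \<tau> then insert (H i) (setof 6 \<tau>) else setof 6 \<tau>)"
    proof -
      have "\<tau> (Arr 6 (T i)) = 0 \<longleftrightarrow> T i \<notin> setof 6 \<tau>" using arcs_less_R(1)[of i] by (simp add: setof_def)
      then have "exec ?c \<tau> = (if i \<in> F \<and> T i \<in> setof 6 \<tau> then \<tau>(Arr 6 (H i) := 1) else \<tau>(Var 47 := 0))"
        unfolding iF using i(3) arrsD(1,2)[OF ar i(1)] by simp
      then show ?thesis using arcs_less_R(2)[of i] by (simp add: setof_upd setof_put)
    qed
    show "?P (Suc i) ((exec ?c \<tau>)(Var 13 := Suc i))"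
      unfolding eq using i(2) rch_step[of i F T H s] by (auto simp: less_Suc_eq)
  qed (use assms in \<open>auto simp: arrsD setof_upd\<close>)
  then show "setof 6 \<sigma> \<subseteq> setof 6 \<tau>" "\<And>i. i \<in> F \<Longrightarrow> T i \<in> setof 6 \<sigma> \<Longrightarrow> H i \<in> setof 6 \<tau>"
    "setof 6 \<sigma> \<subseteq> rch T H F s \<Longrightarrow> setof 6 \<tau> \<subseteq> rch T H F s"
    unfolding \<tau>_def mark_def by (auto simp: F_def setof_def)
qed

lemma reach_spec:
  assumes "arrs \<sigma>" "\<sigma> (Var 10) < R"
  shows "setof 6 (exec reach \<sigma>) = rch T H (setof 5 \<sigma> - {\<sigma> (Var 11), \<sigma> (Var 12)}) (\<sigma> (Var 10))"
proof -
  define F where "F = setof 5 \<sigma> - {\<sigma> (Var 11), \<sigma> (Var 12)}"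
  define s where "s = \<sigma> (Var 10)"
  have R0: "0 < R" using R by simp
  let ?c = "Put 6 (V 13) (N 0)"
  define \<sigma>1 where "\<sigma>1 = exec (For 13 ?c) \<sigma>"
  have z: "\<forall>i<R. \<sigma>1 (Arr 6 i) = 0" unfolding \<sigma>1_def
    by (rule exec_For[where P = "\<lambda>n \<tau>. \<forall>i<n. \<tau> (Arr 6 i) = 0"]) (use assms in \<open>auto simp: arrsD less_Suc_eq\<close>)
  have f1: "frame (wv (For 13 ?c)) (wa (For 13 ?c)) \<sigma> \<sigma>1" unfolding \<sigma>1_def by (rule frame_exec)
  define \<sigma>2 where "\<sigma>2 = \<sigma>1(Arr 6 0 := 1, Arr 6 s := 1)"
  have "\<sigma>1 (Var 10) = s" using frameD(1)[OF f1, of 10] by (simp add: s_def)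
  then have ex: "exec reach \<sigma> = exec (For 14 mark) \<sigma>2" by (simp add: reach_def \<sigma>1_def \<sigma>2_def)
  have f2: "frame {13} {6} \<sigma> \<sigma>2" using f1 by (auto simp: frame_def \<sigma>2_def)
  have ar2: "arrs \<sigma>2" using assms(1) f2 by (rule arrs_frame) auto
  have s2: "setof 6 \<sigma>2 = {0, s}" using z R0 assms(2) by (auto simp: setof_def \<sigma>2_def s_def)
  define M where "M = rch T H F s"
  let ?closed = "\<lambda>S. \<forall>i\<in>F. T i \<in> S \<longrightarrow> H i \<in> S"
  \<comment> \<open>Each pass over the arcs marks a new vertex unless the marks are closed already.
    More than \<open>R\<close> marks are impossible, so \<open>R\<close> passes suffice.\<close>
  let ?P = "\<lambda>n \<tau>. {0, s} \<subseteq> setof 6 \<tau> \<and> setof 6 \<tau> \<subseteq> M \<and> (?closed (setof 6 \<tau>) \<or> n < card (setof 6 \<tau>))"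
  have "?P R (exec (For 14 mark) \<sigma>2)"
  proof (rule exec_For_frame[where P = ?P])
    have "0 < card {0, s}" by (simp add: card_gt_0_iff)
    moreover have "{0, s} \<subseteq> M" using rch_base by (auto simp: M_def)
    ultimately show "?P 0 (\<sigma>2(Var 14 := 0))" unfolding setof_upd s2 by simp
    fix i \<tau> assume i: "i < R" "?P i \<tau>" and fr: "frame (wv (For 14 mark)) (wa (For 14 mark)) \<sigma>2 \<tau>"
    have ar: "arrs \<tau>" using ar2 fr by (rule arrs_frame) (auto simp: wv_mark)
    have F: "setof 5 \<tau> - {\<tau> (Var 11), \<tau> (Var 12)} = F"
      using frameD(1)[OF fr, of 11] frameD(1)[OF fr, of 12] setof_frame[OF fr, of 5]
        frameD(1)[OF f2, of 11] frameD(1)[OF f2, of 12] setof_frame[OF f2, of 5]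
      by (simp add: wv_mark F_def)
    let ?\<tau> = "exec mark \<tau>"
    note ms = mark_spec[OF ar, unfolded F]
    have sub: "setof 6 \<tau> \<subseteq> setof 6 ?\<tau>" "setof 6 ?\<tau> \<subseteq> M" using ms(1) ms(3)[of s] i(2) by (auto simp: M_def)
    have "?closed (setof 6 ?\<tau>) \<or> Suc i < card (setof 6 ?\<tau>)"
    proof (cases "?closed (setof 6 \<tau>)")
      case True
      then have "M \<subseteq> setof 6 \<tau>" unfolding M_def using i(2) by (intro rch_least) auto
      then have "setof 6 ?\<tau> = setof 6 \<tau>" using sub by blast
      then show ?thesis using True by simp
    next
      case False
      then obtain j where j: "j \<in> F" "T j \<in> setof 6 \<tau>" "H j \<notin> setof 6 \<tau>" by blast
      then have "setof 6 \<tau> \<subset> setof 6 ?\<tau>" using ms(2)[OF j(1,2)] sub by blast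
      then have "card (setof 6 \<tau>) < card (setof 6 ?\<tau>)"
        by (intro psubset_card_mono) (auto simp: setof_def)
      then show ?thesis using False i(2) by auto
    qed
    then show "?P (Suc i) (?\<tau>(Var 14 := Suc i))" unfolding setof_upd using sub i(2) by blast
  qed (use ar2 in \<open>auto simp: arrsD wv_mark\<close>)
  moreover have "card (setof 6 \<tau>) \<le> R" for \<tau> using card_mono[OF _ setof_subset, of 6 \<tau>] by simp
  ultimately have "?closed (setof 6 (exec reach \<sigma>))" "{0, s} \<subseteq> setof 6 (exec reach \<sigma>)" "setof 6 (exec reach \<sigma>) \<subseteq> M"
    unfolding ex using leD by blast+
  moreover from this have "M \<subseteq> setof 6 (exec reach \<sigma>)" unfolding M_def by (intro rch_least) auto
  ultimately show ?thesis unfolding M_def F_def s_def by blast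
qed

lemma feas_spec:
  assumes "arrs \<sigma>"
  shows "exec feas \<sigma> (Var 15) \<noteq> 0 \<longleftrightarrow> covers (setof 5 \<sigma>)"
proof -
  let ?d = "guard (notE (eqE (A 16 (V 17)) (A 2 (V 17)))) (guard (notE (A 6 (A 2 (V 17)))) (Assign 15 (N 0)))"
  let ?c = "Assign 10 (N 0) ;; Assign 11 (V 18) ;; Assign 12 (V 18) ;; reach ;; For 17 ?d"
  define good where "good e i \<longleftrightarrow> (T i \<noteq> H i \<longrightarrow> H i \<in> rch T H (setof 5 \<sigma> - {e}) 0)" for e i
  have inner: "exec (For 17 ?d) \<tau> (Var 15) \<noteq> 0 \<longleftrightarrow> \<tau> (Var 15) \<noteq> 0 \<and> (\<forall>i<R. T i \<noteq> H i \<longrightarrow> H i \<in> setof 6 \<tau>)"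
    if ar: "arrs \<tau>" for \<tau>
  proof -
    let ?P = "\<lambda>n \<rho>. \<rho> (Var 15) \<noteq> 0 \<longleftrightarrow> \<tau> (Var 15) \<noteq> 0 \<and> (\<forall>i<n. T i \<noteq> H i \<longrightarrow> H i \<in> setof 6 \<tau>)"
    show ?thesis
    proof (rule exec_For_frame[where P = ?P])
      fix i \<rho> assume i: "i < R" "?P i \<rho>" "\<rho> (Var 17) = i" and fr: "frame (wv (For 17 ?d)) (wa (For 17 ?d)) \<tau> \<rho>"
      have ar': "arrs \<rho>" using ar fr by (rule arrs_frame) auto
      have "\<rho> (Arr 6 (H i)) = 0 \<longleftrightarrow> H i \<notin> setof 6 \<tau>"
        using frameD(2)[OF fr, of 6 "H i"] arcs_less_R[of i] by (auto simp: setof_def)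
      then show "?P (Suc i) ((exec ?d \<rho>)(Var 17 := Suc i))"
        using i arrsD(1-3)[OF ar' i(1)] by (auto simp: less_Suc_eq)
    qed (use ar in \<open>auto simp: arrsD\<close>)
  qed
  let ?\<sigma> = "\<sigma>(Var 15 := 1)"
  let ?P = "\<lambda>n \<rho>. \<rho> (Var 15) \<noteq> 0 \<longleftrightarrow> (\<forall>e<n. \<forall>i<R. good e i)"
  have "?P R (exec (For 18 ?c) ?\<sigma>)"
  proof (rule exec_For_frame[where P = ?P])
    fix e \<rho> assume e: "e < R" "?P e \<rho>" "\<rho> (Var 18) = e" and fr: "frame (wv (For 18 ?c)) (wa (For 18 ?c)) ?\<sigma> \<rho>"
    have fr': "frame {10, 11, 12, 13, 14, 15, 17, 18, 47} {6} \<sigma> \<rho>"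
      using fr by (auto simp: frame_def wv_reach)
    have ar: "arrs \<rho>" using assms fr' by (rule arrs_frame) auto
    define \<rho>1 where "\<rho>1 = \<rho>(Var 10 := 0, Var 11 := e, Var 12 := e)"
    have ar1: "arrs \<rho>1" using ar by (simp add: \<rho>1_def arrs_upd)
    have s5: "setof 5 \<rho>1 = setof 5 \<sigma>" using setof_frame[OF fr', of 5] by (simp add: \<rho>1_def setof_upd)
    have v: "\<rho>1 (Var 10) = 0" "\<rho>1 (Var 11) = e" "\<rho>1 (Var 12) = e" by (simp_all add: \<rho>1_def)
    then have "\<rho>1 (Var 10) < R" using R by simp
    from reach_spec[OF ar1 this] have rs: "setof 6 (exec reach \<rho>1) = rch T H (setof 5 \<sigma> - {e}) 0"
      using s5 v by simp
    have ar2: "arrs (exec reach \<rho>1)" using ar1 frame_exec by (rule arrs_frame) (auto simp: wv_reach)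
    have "exec ?c \<rho> = exec (For 17 ?d) (exec reach \<rho>1)"
      using e(3) by (simp add: \<rho>1_def)
    moreover have "exec reach \<rho>1 (Var 15) = \<rho> (Var 15)"
      using frameD(1)[OF frame_exec[of reach \<rho>1], of 15] by (simp add: wv_reach \<rho>1_def)
    ultimately have "exec ?c \<rho> (Var 15) \<noteq> 0 \<longleftrightarrow> \<rho> (Var 15) \<noteq> 0 \<and> (\<forall>i<R. good e i)"
      using inner[OF ar2] rs by (simp add: good_def)
    then show "?P (Suc e) ((exec ?c \<rho>)(Var 18 := Suc e))" using e(2) by (auto simp: less_Suc_eq)
  qed (use assms in \<open>auto simp: arrsD wv_reach\<close>)
  then show ?thesis
    unfolding covers_iff_reach[OF setof_subset] good_def feas_def by simp
qed

lemma copy_spec: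
  assumes "arrs \<sigma>" "a \<noteq> b"
  shows "i < R \<Longrightarrow> exec (copy a b) \<sigma> (Arr b i) = \<sigma> (Arr a i)" "setof b (exec (copy a b) \<sigma>) = setof a \<sigma>"
proof -
  have "\<forall>i<R. exec (copy a b) \<sigma> (Arr b i) = \<sigma> (Arr a i)" unfolding copy_def
  proof (rule exec_For_frame[where P = "\<lambda>n \<tau>. \<forall>i<n. \<tau> (Arr b i) = \<sigma> (Arr a i)"])
    fix i \<tau> assume i: "i < R" "\<forall>k<i. \<tau> (Arr b k) = \<sigma> (Arr a k)" "\<tau> (Var 19) = i"
      and fr: "frame (wv (For 19 (Put b (V 19) (A a (V 19))))) (wa (For 19 (Put b (V 19) (A a (V 19))))) \<sigma> \<tau>"
    have "\<tau> (Arr a i) = \<sigma> (Arr a i)" using frameD(2)[OF fr, of a i] assms(2) by simp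
    then show "\<forall>k<Suc i. ((exec (Put b (V 19) (A a (V 19))) \<tau>)(Var 19 := Suc i)) (Arr b k) = \<sigma> (Arr a k)"
      using i by (auto simp: less_Suc_eq)
  qed (use assms in \<open>auto simp: arrsD\<close>)
  then show "i < R \<Longrightarrow> exec (copy a b) \<sigma> (Arr b i) = \<sigma> (Arr a i)" "setof b (exec (copy a b) \<sigma>) = setof a \<sigma>"
    by (auto simp: setof_def)
qed

text \<open>An arc that could not be dropped in its turn cannot be dropped later, by monotonicity of
  \<open>covers\<close>. So a single pass reaches a minimal cover, which restores the regularity on
  which the search relies.\<close>

lemma prune_spec:
  assumes "arrs \<sigma>" "covers (setof 4 \<sigma>)"
  defines "\<tau> \<equiv> exec prune \<sigma>"
  shows "setof 4 \<tau> \<subseteq> setof 4 \<sigma>" "covers (setof 4 \<tau>)" "regular (setof 4 \<tau>)"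
proof -
  let ?c = "copy 4 5 ;; Put 5 (V 16) (N 0) ;; feas ;; guard (V 15) (Put 4 (V 16) (N 0))"
  let ?P = "\<lambda>n \<tau>. setof 4 \<tau> \<subseteq> setof 4 \<sigma> \<and> covers (setof 4 \<tau>) \<and> (\<forall>i<n. i \<in> setof 4 \<tau> \<longrightarrow> \<not> covers (setof 4 \<tau> - {i}))"
  have fin: "finite (setof 4 \<rho>)" for \<rho> by (simp add: setof_def)
  have P: "?P R (exec (For 16 ?c) \<sigma>)"
  proof (rule exec_For_frame[where P = ?P])
    fix i \<rho> assume i: "i < R" "?P i \<rho>" "\<rho> (Var 16) = i" and fr: "frame (wv (For 16 ?c)) (wa (For 16 ?c)) \<sigma> \<rho>"
    have ar: "arrs \<rho>" using assms(1) fr by (rule arrs_frame) (auto simp: wv_copy wv_feas)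
    define \<rho>1 where "\<rho>1 = exec (copy 4 5) \<rho>"
    have f1: "frame {19} {5} \<rho> \<rho>1" using frame_exec[of "copy 4 5" \<rho>] by (simp add: \<rho>1_def wv_copy)
    define \<rho>2 where "\<rho>2 = \<rho>1(Arr 5 i := 0)"
    have f2: "frame {19} {5} \<rho> \<rho>2" using f1 by (auto simp: frame_def \<rho>2_def)
    have ar2: "arrs \<rho>2" using ar f2 by (rule arrs_frame) auto
    have s5: "setof 5 \<rho>2 = setof 4 \<rho> - {i}"
      using copy_spec(2)[OF ar, of 4 5] i(1) by (simp add: \<rho>2_def \<rho>1_def setof_put)
    define \<rho>3 where "\<rho>3 = exec feas \<rho>2"
    have f3: "frame (wv feas) (wa feas) \<rho>2 \<rho>3" unfolding \<rho>3_def by (rule frame_exec)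
    have s4: "setof 4 \<rho>3 = setof 4 \<rho>" using setof_frame[OF f3, of 4] setof_frame[OF f2, of 4] by (simp add: wv_feas)
    have v16: "\<rho>1 (Var 16) = i" "\<rho>3 (Var 16) = i"
      using frameD(1)[OF f1, of 16] frameD(1)[OF f2, of 16] frameD(1)[OF f3, of 16] i(3) by (simp_all add: wv_feas)
    have v15: "\<rho>3 (Var 15) \<noteq> 0 \<longleftrightarrow> covers (setof 4 \<rho> - {i})"
      using feas_spec[OF ar2] s5 by (simp add: \<rho>3_def)
    have "exec ?c \<rho> = (if \<rho>3 (Var 15) = 0 then \<rho>3(Var 47 := 0) else \<rho>3(Arr 4 i := 0))"
      using v16 by (simp add: \<rho>3_def \<rho>2_def \<rho>1_def)
    then have eq: "setof 4 ((exec ?c \<rho>)(Var 16 := Suc i)) =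
        (if covers (setof 4 \<rho> - {i}) then setof 4 \<rho> - {i} else setof 4 \<rho>)"
      using v15 i(1) s4 by (auto simp: setof_upd setof_put)
    have mono: "covers (setof 4 \<rho> - {j})" if "covers (setof 4 \<rho> - {i} - {j})" for j
      by (rule covers_mono[OF that]) (use fin in auto)
    show "?P (Suc i) ((exec ?c \<rho>)(Var 16 := Suc i))"
      unfolding eq using i(2) mono by (auto simp: less_Suc_eq)
  qed (use assms in \<open>auto simp: arrsD wv_copy wv_feas setof_upd\<close>)
  then show "setof 4 \<tau> \<subseteq> setof 4 \<sigma>" "covers (setof 4 \<tau>)" by (auto simp: \<tau>_def prune_def)
  show "regular (setof 4 \<tau>)"
    using P by (intro minimal_cover_regular[OF fin]) (auto simp: \<tau>_def prune_def setof_def)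
qed

end

section \<open>The exchange test, the table of walks and the improvement loop\<close>

definition probe :: "exp \<Rightarrow> com" where
  "probe se = Assign 10 se ;; Assign 11 (V 23) ;; Assign 12 (V 24) ;; reach ;;
     guard (notE (Plus (A 6 (A 16 (V 20))) (A 6 (A 2 (V 20))))) (Assign 22 (N 0))"

definition exchc :: com where
  "exchc = Assign 22 (N 1) ;; For 23 (For 24 (probe (A 16 (V 21)) ;; probe (A 2 (V 21))))"

definition store_step :: com where
  "store_step = guard (Plus (notE (A 7 (V 29))) (ltE (V 28) (A 7 (V 29))))
     (Put 7 (V 29) (V 28) ;; Put 8 (V 29) (V 20) ;; Put 9 (V 29) (V 21))"

text \<open>\<open>Q\<close> is meant to bound all arc costs. Added before the cost of the leaving
  arc is subtracted, it keeps the truncated subtraction exact.\<close>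

definition relax :: "nat \<Rightarrow> com" where
  "relax Q = guard (notE (A 4 (V 20))) (guard (notE (eqE (A 16 (V 20)) (A 2 (V 20)))) (guard (A 4 (V 21))
     (guard (A 7 (Plus (V 25) (A 2 (V 20)))) (exchc ;; guard (V 22)
       (Assign 28 (Minus (Plus (Plus (A 7 (Plus (V 25) (A 2 (V 20)))) (A 3 (V 20))) (N Q)) (A 3 (V 21))) ;;
        Assign 29 (Plus (V 26) (A 2 (V 21))) ;; store_step)))))"

definition level :: "nat \<Rightarrow> com" where
  "level Q = For 31 (Put 7 (Plus (V 26) (V 31)) (N 0)) ;; For 20 (For 21 (relax Q))"

text \<open>The offsets of the levels are advanced by adding \<open>R\<close>, as there is no
  multiplication.\<close>

definition dp :: "nat \<Rightarrow> com" where
  "dp Q = Assign 25 (N 0) ;; Assign 26 (V 0) ;; For 31 (Put 7 (V 31) (N 0)) ;; Put 7 (V 30) (N 1) ;;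
     For 27 (level Q ;; Assign 25 (V 26) ;; Assign 26 (Plus (V 26) (V 0)))"

text \<open>Follows the stored last steps back from the end of the walk. The guard cuts the
  \<open>R\<close> rounds down to the number of steps, which is one more than variable 32.\<close>

definition cand :: com where
  "cand = copy 4 10 ;; Assign 34 (V 30) ;; Assign 35 (V 36) ;;
     For 33 (guard (ltE (V 33) (Plus (V 32) (N 1)))
       (Assign 28 (A 8 (Plus (V 35) (V 34))) ;; Assign 29 (A 9 (Plus (V 35) (V 34))) ;;
        Put 10 (V 29) (N 0) ;; Put 10 (V 28) (N 1) ;; Assign 34 (A 2 (V 28)) ;; Assign 35 (Minus (V 35) (V 0))))"

definition costs :: com where
  "costs = Assign 37 (N 0) ;; Assign 38 (N 0) ;;
     For 31 (guard (A 4 (V 31)) (Assign 37 (Plus (V 37) (A 3 (V 31)))) ;;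
       guard (A 10 (V 31)) (Assign 38 (Plus (V 38) (A 3 (V 31)))))"

definition check :: com where
  "check = copy 10 5 ;; feas ;; costs ;; guard (V 15) (guard (ltE (V 38) (V 37)) (copy 10 4))"

text \<open>A candidate replaces the cover only after it has been verified to be a cheaper cover.
  Unsuitable roots and lengths, and tables outdated by an earlier replacement, are therefore
  harmless.\<close>

definition search :: "nat \<Rightarrow> com" where
  "search Q = For 30 (copy 4 5 ;; dp Q ;; Assign 36 (V 0) ;;
     For 32 (cand ;; check ;; Assign 36 (Plus (V 36) (V 0))))"

text \<open>Two nested loops give the \<open>R * R\<close> rounds needed. Pruning comes first in
  each round because an accepted candidate need not be regular.\<close>

definition optimize :: "nat \<Rightarrow> com" where
  "optimize Q = For 39 (For 40 (prune ;; search Q))"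

lemma wv_probe: "wv (probe se) = {10, 11, 12, 13, 14, 22, 47}" "wa (probe se) = {6}"
  by (auto simp: probe_def wv_reach)

lemma wv_exchc: "wv exchc = {10, 11, 12, 13, 14, 22, 23, 24, 47}" "wa exchc = {6}"
  by (auto simp: exchc_def wv_probe)

lemma wv_store_step: "wv store_step = {47}" "wa store_step = {7, 8, 9}"
  by (auto simp: store_step_def)

lemma wv_relax: "wv (relax Q) = {10, 11, 12, 13, 14, 22, 23, 24, 28, 29, 47}" "wa (relax Q) = {6, 7, 8, 9}"
  by (auto simp: relax_def wv_exchc wv_store_step)

lemma wv_level: "wv (level Q) = {10, 11, 12, 13, 14, 20, 21, 22, 23, 24, 28, 29, 31, 47}" "wa (level Q) = {6, 7, 8, 9}"
  by (auto simp: level_def wv_relax)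

lemma wv_dp: "wv (dp Q) = {10, 11, 12, 13, 14, 20, 21, 22, 23, 24, 25, 26, 27, 28, 29, 31, 47}" "wa (dp Q) = {6, 7, 8, 9}"
  by (auto simp: dp_def wv_level)

lemma wv_cand: "wv cand = {19, 28, 29, 33, 34, 35, 47}" "wa cand = {10}"
  by (auto simp: cand_def wv_copy)

lemma wv_costs: "wv costs = {31, 37, 38, 47}" "wa costs = {}"
  by (auto simp: costs_def)

lemma wv_check: "wv check = {10, 11, 12, 13, 14, 15, 17, 18, 19, 31, 37, 38, 47}" "wa check = {4, 5, 6}"
  by (auto simp: check_def wv_copy wv_feas wv_costs)

lemma wv_search: "wv (search Q) = {10, 11, 12, 13, 14, 15, 17, 18, 19, 20, 21, 22, 23, 24, 25, 26, 27, 28, 29,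
    30, 31, 32, 33, 34, 35, 36, 37, 38, 47}" "wa (search Q) = {4, 5, 6, 7, 8, 9, 10}"
  by (auto simp: search_def wv_copy wv_dp wv_cand wv_check)

context fgc_cover begin

lemma probe_spec:
  assumes "arrs \<rho>" "\<rho> (Var 20) = a" "a < R" "ev se \<rho> = s" "s < R"
  shows "exec (probe se) \<rho> (Var 22) \<noteq> 0 \<longleftrightarrow> \<rho> (Var 22) \<noteq> 0 \<and>
    (T a \<in> rch T H (setof 5 \<rho> - {\<rho> (Var 23), \<rho> (Var 24)}) s \<or> H a \<in> rch T H (setof 5 \<rho> - {\<rho> (Var 23), \<rho> (Var 24)}) s)"
proof -
  define \<rho>1 where "\<rho>1 = \<rho>(Var 10 := s, Var 11 := \<rho> (Var 23), Var 12 := \<rho> (Var 24))"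
  have v: "\<rho>1 (Var 10) = s" "\<rho>1 (Var 11) = \<rho> (Var 23)" "\<rho>1 (Var 12) = \<rho> (Var 24)" "\<rho>1 (Var 20) = a"
    "\<rho>1 (Var 22) = \<rho> (Var 22)" using assms(2) by (simp_all add: \<rho>1_def)
  have ar1: "arrs \<rho>1" using assms(1) by (simp add: \<rho>1_def arrs_upd)
  have s5: "setof 5 \<rho>1 = setof 5 \<rho>" by (simp add: \<rho>1_def setof_upd)
  define \<rho>2 where "\<rho>2 = exec reach \<rho>1"
  have f2: "frame {13, 14, 47} {6} \<rho>1 \<rho>2" using frame_exec[of reach \<rho>1] by (simp add: \<rho>2_def wv_reach)
  have s6: "setof 6 \<rho>2 = rch T H (setof 5 \<rho> - {\<rho> (Var 23), \<rho> (Var 24)}) s"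
    using reach_spec[OF ar1] v s5 assms(5) by (simp add: \<rho>2_def)
  have ar2: "arrs \<rho>2" using ar1 f2 by (rule arrs_frame) auto
  have w: "\<rho>2 (Var 20) = a" "\<rho>2 (Var 22) = \<rho> (Var 22)"
    using frameD(1)[OF f2, of 20] frameD(1)[OF f2, of 22] v by simp_all
  have z: "\<rho>2 (Arr 6 (T a)) = 0 \<longleftrightarrow> T a \<notin> setof 6 \<rho>2" "\<rho>2 (Arr 6 (H a)) = 0 \<longleftrightarrow> H a \<notin> setof 6 \<rho>2"
    using arcs_less_R[of a] by (simp_all add: setof_def)
  have "exec (probe se) \<rho> = (if T a \<in> setof 6 \<rho>2 \<or> H a \<in> setof 6 \<rho>2 then \<rho>2(Var 47 := 0) else \<rho>2(Var 22 := 0))"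
    using arrsD(1,2)[OF ar2 assms(3)] w(1) z assms(4)
    by (cases "T a \<in> setof 6 \<rho>2"; cases "H a \<in> setof 6 \<rho>2")
      (simp_all add: probe_def \<rho>1_def[symmetric] \<rho>2_def[symmetric])
  then show ?thesis using w(2) s6 by simp
qed

lemma exchc_spec:
  assumes "arrs \<sigma>" "\<sigma> (Var 20) = a" "\<sigma> (Var 21) = b" "a < R" "b < R"
    and B: "setof 5 \<sigma> = B" "regular B" "covers B"
  shows "exec exchc \<sigma> (Var 22) \<noteq> 0 \<longleftrightarrow> exch B a b"
proof -
  let ?c = "probe (A 16 (V 21)) ;; probe (A 2 (V 21))"
  define ok where "ok e f s \<longleftrightarrow> T a \<in> rch T H (B - {e, f}) s \<or> H a \<in> rch T H (B - {e, f}) s" for e f s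
  define \<sigma>1 where "\<sigma>1 = \<sigma>(Var 22 := 1)"
  have f1: "frame {22} {} \<sigma> \<sigma>1" by (simp add: frame_def \<sigma>1_def)
  let ?W = "{10, 11, 12, 13, 14, 22, 23, 24, 47} :: nat set"
  have ar1: "arrs \<sigma>1" using assms(1) by (simp add: \<sigma>1_def arrs_upd)
  let ?P = "\<lambda>n \<rho>. \<rho> (Var 22) \<noteq> 0 \<longleftrightarrow> (\<forall>e<n. \<forall>f<R. ok e f (T b) \<and> ok e f (H b))"
  have "?P R (exec (For 23 (For 24 ?c)) \<sigma>1)"
  proof (rule exec_For_frame[where P = ?P])
    fix e \<rho> assume e: "e < R" "?P e \<rho>" "\<rho> (Var 23) = e" and fr: "frame (wv (For 23 (For 24 ?c))) (wa (For 23 (For 24 ?c))) \<sigma>1 \<rho>"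
    have fr': "frame ?W {6} \<sigma> \<rho>" using fr f1 by (simp add: frame_def wv_probe)
    have ar: "arrs \<rho>" using assms(1) fr' by (rule arrs_frame) auto
    let ?P' = "\<lambda>n \<rho>'. \<rho>' (Var 22) \<noteq> 0 \<longleftrightarrow> \<rho> (Var 22) \<noteq> 0 \<and> (\<forall>f<n. ok e f (T b) \<and> ok e f (H b))"
    have "?P' R (exec (For 24 ?c) \<rho>)"
    proof (rule exec_For_frame[where P = ?P'])
      fix f \<rho>' assume f: "f < R" "?P' f \<rho>'" "\<rho>' (Var 24) = f" and fr2: "frame (wv (For 24 ?c)) (wa (For 24 ?c)) \<rho> \<rho>'"
      have fr3: "frame ?W {6} \<sigma> \<rho>'" using fr2 fr' by (simp add: frame_def wv_probe)
      have ar2: "arrs \<rho>'" using assms(1) fr3 by (rule arrs_frame) auto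
      have w: "\<rho>' (Var 20) = a" "\<rho>' (Var 21) = b" "\<rho>' (Var 23) = e" "setof 5 \<rho>' = B"
        using frameD(1)[OF fr3, of 20] frameD(1)[OF fr3, of 21] frameD(1)[OF fr2, of 23] assms(2,3) e(3)
          setof_frame[OF fr3, of 5] B(1) by (simp_all add: wv_probe)
      define \<rho>1 where "\<rho>1 = exec (probe (A 16 (V 21))) \<rho>'"
      have f4: "frame {10, 11, 12, 13, 14, 22, 47} {6} \<rho>' \<rho>1"
        using frame_exec[of "probe (A 16 (V 21))" \<rho>'] by (simp add: \<rho>1_def wv_probe)
      have ar3: "arrs \<rho>1" using ar2 f4 by (rule arrs_frame) auto
      have w1: "\<rho>1 (Var 20) = a" "\<rho>1 (Var 21) = b" "\<rho>1 (Var 23) = e" "\<rho>1 (Var 24) = f" "setof 5 \<rho>1 = B"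
        using frameD(1)[OF f4, of 20] frameD(1)[OF f4, of 21] frameD(1)[OF f4, of 23] frameD(1)[OF f4, of 24]
          setof_frame[OF f4, of 5] w f(3) by simp_all
      have p1: "\<rho>1 (Var 22) \<noteq> 0 \<longleftrightarrow> \<rho>' (Var 22) \<noteq> 0 \<and> ok e f (T b)"
        unfolding \<rho>1_def using probe_spec[OF ar2 w(1) assms(4), of "A 16 (V 21)" "T b"] w f(3)
          arrsD(1)[OF ar2 assms(5)] arcs_less_R(1)[of b] by (simp add: ok_def)
      have p2: "exec (probe (A 2 (V 21))) \<rho>1 (Var 22) \<noteq> 0 \<longleftrightarrow> \<rho>1 (Var 22) \<noteq> 0 \<and> ok e f (H b)"
        using probe_spec[OF ar3 w1(1) assms(4), of "A 2 (V 21)" "H b"] w1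
          arrsD(2)[OF ar3 assms(5)] arcs_less_R(2)[of b] by (simp add: ok_def)
      have "exec ?c \<rho>' (Var 22) \<noteq> 0 \<longleftrightarrow> \<rho>' (Var 22) \<noteq> 0 \<and> ok e f (T b) \<and> ok e f (H b)"
        using p1 p2 by (simp add: \<rho>1_def)
      then show "?P' (Suc f) ((exec ?c \<rho>')(Var 24 := Suc f))" using f(2) by (auto simp: less_Suc_eq)
    qed (use ar in \<open>auto simp: arrsD wv_probe\<close>)
    then show "?P (Suc e) ((exec (For 24 ?c) \<rho>)(Var 23 := Suc e))" using e(2) by (auto simp: less_Suc_eq)
  next
    show "\<sigma>1 (Var 0) = R" using ar1 by (rule arrsD)
  qed (auto simp: wv_probe \<sigma>1_def)
  moreover have "exec exchc \<sigma> = exec (For 23 (For 24 ?c)) \<sigma>1"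
    by (simp only: exchc_def exec.simps ev.simps \<sigma>1_def)
  moreover have "B \<subseteq> {..<R}" using B(1) setof_subset by blast
  ultimately show ?thesis using exch_iff_reach[OF _ B(2,3)] by (auto simp: ok_def)
qed

text \<open>The invariant of relaxation: each entry of level \<open>Suc k\<close> is attained by the
  step stored with it, and no step in \<open>S\<close>, the pairs treated so far, would improve on
  it. A finished level has \<open>S = UNIV\<close>.\<close>

definition level_ok :: "nat set \<Rightarrow> nat \<Rightarrow> (nat \<times> nat) set \<Rightarrow> nat \<Rightarrow> store \<Rightarrow> bool" where
  "level_ok B Q S k \<sigma> \<longleftrightarrow>
    (\<forall>v<R. \<sigma> (Arr 7 (Suc k * R + v)) \<noteq> 0 \<longrightarrow>
      (\<exists>a b. \<sigma> (Arr 8 (Suc k * R + v)) = a \<and> \<sigma> (Arr 9 (Suc k * R + v)) = b \<and> step B a b \<and> H b = v \<and>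
        \<sigma> (Arr 7 (k * R + H a)) \<noteq> 0 \<and> \<sigma> (Arr 7 (Suc k * R + v)) = \<sigma> (Arr 7 (k * R + H a)) + C a + Q - C b)) \<and>
    (\<forall>a b. (a, b) \<in> S \<longrightarrow> step B a b \<longrightarrow> \<sigma> (Arr 7 (k * R + H a)) \<noteq> 0 \<longrightarrow> \<sigma> (Arr 7 (Suc k * R + H b)) \<noteq> 0 \<and>
      \<sigma> (Arr 7 (Suc k * R + H b)) \<le> \<sigma> (Arr 7 (k * R + H a)) + C a + Q - C b)"

lemma level_ok_cong:
  assumes "level_ok B Q S k \<sigma>" "\<And>j l. j \<in> {7, 8, 9} \<Longrightarrow> l < Suc (Suc k) * R \<Longrightarrow> \<tau> (Arr j l) = \<sigma> (Arr j l)"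
  shows "level_ok B Q S k \<tau>"
proof -
  have "k * R + H a < Suc (Suc k) * R" "Suc k * R + H a < Suc (Suc k) * R" for a using arcs_less_R[of a] by auto
  moreover have "Suc k * R + v < Suc (Suc k) * R" if "v < R" for v using that by simp
  ultimately show ?thesis using assms unfolding level_ok_def by simp
qed

lemma relax_spec:
  assumes "arrs \<sigma>" "\<sigma> (Var 20) = a" "\<sigma> (Var 21) = b" "a < R" "b < R"
    and B: "setof 4 \<sigma> = B" "setof 5 \<sigma> = B" "regular B" "covers B"
    and k: "\<sigma> (Var 25) = k * R" "\<sigma> (Var 26) = Suc k * R" and Q: "\<And>i. C i \<le> Q"
    and ok: "level_ok B Q S k \<sigma>"
  shows "level_ok B Q (insert (a, b) S) k (exec (relax Q) \<sigma>)"
    "j \<in> {7, 8, 9} \<Longrightarrow> l < Suc k * R \<Longrightarrow> exec (relax Q) \<sigma> (Arr j l) = \<sigma> (Arr j l)"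
proof -
  let ?\<tau> = "exec (relax Q) \<sigma>"
  define x where "x = \<sigma> (Arr 7 (k * R + H a)) + C a + Q - C b"
  define y where "y = Suc k * R + H b"
  define cond where "cond \<longleftrightarrow> step B a b \<and> \<sigma> (Arr 7 (k * R + H a)) \<noteq> 0"
  define better where "better \<longleftrightarrow> \<sigma> (Arr 7 y) = 0 \<or> x < \<sigma> (Arr 7 y)"
  have yk: "Suc k * R \<le> y" by (simp add: y_def)
  have m: "\<sigma> (Arr 4 a) = 0 \<longleftrightarrow> a \<notin> B" "\<sigma> (Arr 4 b) = 0 \<longleftrightarrow> b \<notin> B"
    using B(1) assms(4,5) by (auto simp: setof_def)
  note ar = arrsD(1-3)[OF assms(1)]
  have main: "?\<tau> (Arr j l) = (if cond \<and> better \<and> l = y then (if j = 7 then x else if j = 8 then a else b) else \<sigma> (Arr j l))"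
    if j: "j \<in> {7, 8, 9}" for j l
  proof (cases "a \<notin> B \<and> T a \<noteq> H a \<and> b \<in> B \<and> \<sigma> (Arr 7 (k * R + H a)) \<noteq> 0")
    case False
    then have "?\<tau> = \<sigma>(Var 47 := 0)" "\<not> cond"
      using m k assms(2-5) ar by (auto simp: relax_def cond_def step_def)
    then show ?thesis by simp
  next
    case True
    define \<sigma>1 where "\<sigma>1 = exec exchc \<sigma>"
    have f1: "frame {10, 11, 12, 13, 14, 22, 23, 24, 47} {6} \<sigma> \<sigma>1"
      using frame_exec[of exchc \<sigma>] by (simp add: \<sigma>1_def wv_exchc)
    have ar1: "arrs \<sigma>1" using assms(1) f1 by (rule arrs_frame) auto
    have v: "\<sigma>1 (Var 20) = a" "\<sigma>1 (Var 21) = b" "\<sigma>1 (Var 25) = k * R" "\<sigma>1 (Var 26) = Suc k * R"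
      using frameD(1)[OF f1, of 20] frameD(1)[OF f1, of 21] frameD(1)[OF f1, of 25] frameD(1)[OF f1, of 26] assms(2,3) k
      by simp_all
    have w: "\<sigma>1 (Arr 7 l) = \<sigma> (Arr 7 l)" "\<sigma>1 (Arr 8 l) = \<sigma> (Arr 8 l)" "\<sigma>1 (Arr 9 l) = \<sigma> (Arr 9 l)" for l
      using frameD(2)[OF f1] by simp_all
    have x22: "\<sigma>1 (Var 22) = 0 \<longleftrightarrow> \<not> exch B a b"
      using exchc_spec[OF assms(1-5) B(2-4)] unfolding \<sigma>1_def by blast
    have c: "cond \<longleftrightarrow> exch B a b" using True assms(4) by (auto simp: cond_def step_def)
    have "?\<tau> = exec (guard (V 22)
       (Assign 28 (Minus (Plus (Plus (A 7 (Plus (V 25) (A 2 (V 20)))) (A 3 (V 20))) (N Q)) (A 3 (V 21))) ;;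
        Assign 29 (Plus (V 26) (A 2 (V 21))) ;; store_step)) \<sigma>1"
      using True m k assms(2-5) ar by (simp add: relax_def \<sigma>1_def)
    also have "\<dots> = (if cond then exec store_step (\<sigma>1(Var 28 := x, Var 29 := y)) else \<sigma>1(Var 47 := 0))"
      using v x22 c arrsD(1-3)[OF ar1 assms(4)] arrsD(1-3)[OF ar1 assms(5)] w by (simp add: x_def y_def)
    finally have e: "?\<tau> = (if cond then exec store_step (\<sigma>1(Var 28 := x, Var 29 := y)) else \<sigma>1(Var 47 := 0))" .
    have "exec store_step (\<sigma>1(Var 28 := x, Var 29 := y)) (Arr j l) =
      (if better \<and> l = y then (if j = 7 then x else if j = 8 then a else b) else \<sigma>1 (Arr j l))"
      using j v w by (auto simp: store_step_def better_def)
    then show ?thesis using e j w by auto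
  qed
  \<comment> \<open>Only level \<open>Suc k\<close> is written, so the level that is read stays
    fixed.\<close>
  have low: "?\<tau> (Arr j l) = \<sigma> (Arr j l)" if "j \<in> {7, 8, 9}" "l < Suc k * R" for j l
    using main[OF that(1), of l] that(2) yk by auto
  show "j \<in> {7, 8, 9} \<Longrightarrow> l < Suc k * R \<Longrightarrow> ?\<tau> (Arr j l) = \<sigma> (Arr j l)" by (rule low)
  have lowH: "?\<tau> (Arr 7 (k * R + H c)) = \<sigma> (Arr 7 (k * R + H c))" for c
    using arcs_less_R(2)[of c] by (intro low) auto
  have yv: "Suc k * R + v = y \<longleftrightarrow> v = H b" for v by (auto simp: y_def)
  \<comment> \<open>A new entry is nonzero because of \<open>C b <= Q\<close>, so 0 remains the sign
    for a missing walk.\<close>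
  have xpos: "cond \<Longrightarrow> x \<noteq> 0" using Q[of b] by (auto simp: x_def cond_def)
  have dec: "\<sigma> (Arr 7 l) \<noteq> 0 \<Longrightarrow> ?\<tau> (Arr 7 l) \<noteq> 0 \<and> ?\<tau> (Arr 7 l) \<le> \<sigma> (Arr 7 l)" for l
    using main[of 7 l] xpos by (auto simp: better_def)
  show "level_ok B Q (insert (a, b) S) k ?\<tau>"
    unfolding level_ok_def
  proof (intro conjI allI impI)
    fix v assume v: "v < R" "?\<tau> (Arr 7 (Suc k * R + v)) \<noteq> 0"
    show "\<exists>a b. ?\<tau> (Arr 8 (Suc k * R + v)) = a \<and> ?\<tau> (Arr 9 (Suc k * R + v)) = b \<and> step B a b \<and> H b = v \<and>
        ?\<tau> (Arr 7 (k * R + H a)) \<noteq> 0 \<and> ?\<tau> (Arr 7 (Suc k * R + v)) = ?\<tau> (Arr 7 (k * R + H a)) + C a + Q - C b"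
    proof (cases "cond \<and> better \<and> v = H b")
      case True
      then have y: "Suc k * R + v = y" by (simp add: y_def)
      have "?\<tau> (Arr 7 y) = x" "?\<tau> (Arr 8 y) = a" "?\<tau> (Arr 9 y) = b"
        using True main[of 7 y] main[of 8 y] main[of 9 y] by simp_all
      then show ?thesis unfolding lowH y using True by (simp add: x_def cond_def)
    next
      case False
      then have "\<not> (cond \<and> better \<and> Suc k * R + v = y)" using yv by blast
      then have same: "?\<tau> (Arr j (Suc k * R + v)) = \<sigma> (Arr j (Suc k * R + v))" if "j \<in> {7, 8, 9}" for j
        using main[OF that, of "Suc k * R + v"] by (simp only: if_False)
      have same': "?\<tau> (Arr 7 (Suc k * R + v)) = \<sigma> (Arr 7 (Suc k * R + v))"
        "?\<tau> (Arr 8 (Suc k * R + v)) = \<sigma> (Arr 8 (Suc k * R + v))"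
        "?\<tau> (Arr 9 (Suc k * R + v)) = \<sigma> (Arr 9 (Suc k * R + v))"
        using same by blast+
      show ?thesis using ok v unfolding lowH same' level_ok_def by blast
    qed
  next
    fix c d assume cd: "(c, d) \<in> insert (a, b) S" "step B c d" "?\<tau> (Arr 7 (k * R + H c)) \<noteq> 0"
    have "?\<tau> (Arr 7 (Suc k * R + H d)) \<noteq> 0 \<and> ?\<tau> (Arr 7 (Suc k * R + H d)) \<le> \<sigma> (Arr 7 (k * R + H c)) + C c + Q - C d"
    proof (cases "(c, d) = (a, b)")
      case True
      then have cond using cd(2,3) lowH by (simp add: cond_def)
      have "?\<tau> (Arr 7 y) \<noteq> 0 \<and> ?\<tau> (Arr 7 y) \<le> x"
        using main[of 7 y] xpos[OF \<open>cond\<close>] \<open>cond\<close> by (auto simp: better_def)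
      then show ?thesis using True by (simp add: y_def x_def)
    next
      case False
      then have "\<sigma> (Arr 7 (Suc k * R + H d)) \<noteq> 0 \<and> \<sigma> (Arr 7 (Suc k * R + H d)) \<le> \<sigma> (Arr 7 (k * R + H c)) + C c + Q - C d"
        using ok cd lowH unfolding level_ok_def by auto
      then show ?thesis using dec[of "Suc k * R + H d"] by linarith
    qed
    then show "?\<tau> (Arr 7 (Suc k * R + H d)) \<noteq> 0"
      "?\<tau> (Arr 7 (Suc k * R + H d)) \<le> ?\<tau> (Arr 7 (k * R + H c)) + C c + Q - C d"
      unfolding lowH by blast+
  qed
qed

lemma level_spec:
  assumes "arrs \<sigma>" and B: "setof 4 \<sigma> = B" "setof 5 \<sigma> = B" "regular B" "covers B"
    and k: "\<sigma> (Var 25) = k * R" "\<sigma> (Var 26) = Suc k * R" and Q: "\<And>i. C i \<le> Q"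
  defines "\<tau> \<equiv> exec (level Q) \<sigma>"
  shows "level_ok B Q UNIV k \<tau>" "\<And>j l. j \<in> {7, 8, 9} \<Longrightarrow> l < Suc k * R \<Longrightarrow> \<tau> (Arr j l) = \<sigma> (Arr j l)"
proof -
  let ?c = "Put 7 (Plus (V 26) (V 31)) (N 0)"
  define \<sigma>1 where "\<sigma>1 = exec (For 31 ?c) \<sigma>"
  have f1: "frame {31} {7} \<sigma> \<sigma>1" using frame_exec[of "For 31 ?c" \<sigma>] by (simp add: \<sigma>1_def)
  let ?P1 = "\<lambda>n \<rho>. (\<forall>v<n. \<rho> (Arr 7 (Suc k * R + v)) = 0) \<and> (\<forall>l<Suc k * R. \<rho> (Arr 7 l) = \<sigma> (Arr 7 l))"
  have z: "?P1 R \<sigma>1" unfolding \<sigma>1_def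
  proof (rule exec_For_frame[where P = ?P1])
    fix i \<rho> assume i: "i < R" "?P1 i \<rho>" "\<rho> (Var 31) = i" and fr: "frame (wv (For 31 ?c)) (wa (For 31 ?c)) \<sigma> \<rho>"
    have "\<rho> (Var 26) = Suc k * R" using frameD(1)[OF fr, of 26] k by simp
    then show "?P1 (Suc i) ((exec ?c \<rho>)(Var 31 := Suc i))" using i by (auto simp: less_Suc_eq)
  qed (use assms(1) in \<open>auto simp: arrsD\<close>)
  have ar1: "arrs \<sigma>1" using assms(1) f1 by (rule arrs_frame) auto
  let ?W = "{10, 11, 12, 13, 14, 20, 21, 22, 23, 24, 28, 29, 31, 47} :: nat set"
  let ?low = "\<lambda>\<rho>. \<forall>j\<in>{7, 8, 9}. \<forall>l<Suc k * R. \<rho> (Arr j l) = \<sigma> (Arr j l)"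
  have s1: "level_ok B Q {} k \<sigma>1" "?low \<sigma>1"
    using z frameD(2)[OF f1, of 8] frameD(2)[OF f1, of 9] by (auto simp: level_ok_def)
  let ?P = "\<lambda>n \<rho>. level_ok B Q ({..<n} \<times> {..<R}) k \<rho> \<and> ?low \<rho>"
  have main: "?P R (exec (For 20 (For 21 (relax Q))) \<sigma>1)"
  proof (rule exec_For_frame[where P = ?P])
    fix a \<rho> assume a: "a < R" "?P a \<rho>" "\<rho> (Var 20) = a"
      and fr: "frame (wv (For 20 (For 21 (relax Q)))) (wa (For 20 (For 21 (relax Q)))) \<sigma>1 \<rho>"
    have fr': "frame ?W {6, 7, 8, 9} \<sigma> \<rho>" using fr f1 by (simp add: frame_def wv_relax)
    have ar: "arrs \<rho>" using assms(1) fr' by (rule arrs_frame) auto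
    let ?P' = "\<lambda>n \<rho>. level_ok B Q ({..<a} \<times> {..<R} \<union> {a} \<times> {..<n}) k \<rho> \<and> ?low \<rho>"
    have "?P' R (exec (For 21 (relax Q)) \<rho>)"
    proof (rule exec_For_frame[where P = ?P'])
      fix b \<rho>' assume b: "b < R" "?P' b \<rho>'" "\<rho>' (Var 21) = b"
        and fr2: "frame (wv (For 21 (relax Q))) (wa (For 21 (relax Q))) \<rho> \<rho>'"
      have fr3: "frame ?W {6, 7, 8, 9} \<sigma> \<rho>'" using fr2 fr' by (simp add: frame_def wv_relax)
      have ar2: "arrs \<rho>'" using assms(1) fr3 by (rule arrs_frame) auto
      have w: "\<rho>' (Var 20) = a" "setof 4 \<rho>' = B" "setof 5 \<rho>' = B" "\<rho>' (Var 25) = k * R" "\<rho>' (Var 26) = Suc k * R"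
        using frameD(1)[OF fr2, of 20] setof_frame[OF fr3, of 4] setof_frame[OF fr3, of 5] frameD(1)[OF fr3, of 25]
          frameD(1)[OF fr3, of 26] a(3) B k by (simp_all add: wv_relax)
      have "{..<a} \<times> {..<R} \<union> {a} \<times> {..<Suc b} = insert (a, b) ({..<a} \<times> {..<R} \<union> {a} \<times> {..<b})" by auto
      moreover note relax_spec[OF ar2 w(1) b(3) a(1) b(1) w(2,3) B(3,4) w(4,5) Q conjunct1[OF b(2)]]
      ultimately have "?P' (Suc b) (exec (relax Q) \<rho>')" using b(2) by (simp del: mult_Suc)
      moreover have "level_ok B Q S k (\<rho>(Var 21 := Suc b)) = level_ok B Q S k \<rho>" for \<rho> S
        by (simp add: level_ok_def)
      ultimately show "?P' (Suc b) ((exec (relax Q) \<rho>')(Var 21 := Suc b))" by simp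
    next
      have "level_ok B Q S k (\<rho>(Var 21 := 0)) = level_ok B Q S k \<rho>" for \<rho> S by (simp add: level_ok_def)
      then show "?P' 0 (\<rho>(Var 21 := 0))" using a(2) by simp
    qed (use ar in \<open>auto simp: arrsD wv_relax\<close>)
    moreover have "{..<a} \<times> {..<R} \<union> {a} \<times> {..<R} = {..<Suc a} \<times> {..<R}" by auto
    moreover have "level_ok B Q S k (\<rho>(Var 20 := Suc a)) = level_ok B Q S k \<rho>" for \<rho> S by (simp add: level_ok_def)
    ultimately show "?P (Suc a) ((exec (For 21 (relax Q)) \<rho>)(Var 20 := Suc a))" by simp
  next
    have "level_ok B Q S k (\<rho>(Var 20 := 0)) = level_ok B Q S k \<rho>" for \<rho> S by (simp add: level_ok_def)
    then show "?P 0 (\<sigma>1(Var 20 := 0))" using s1 by simp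
  qed (use ar1 in \<open>auto simp: arrsD wv_relax\<close>)
  have \<tau>: "\<tau> = exec (For 20 (For 21 (relax Q))) \<sigma>1"
    unfolding \<tau>_def level_def \<sigma>1_def by (simp only: exec.simps)
  have fin: "?P R \<tau>" unfolding \<tau> by (rule main)
  have "(a, b) \<in> {..<R} \<times> {..<R}" if "step B a b" for a b
    using that setof_subset[of 4 \<sigma>] B(1) by (auto simp: step_def)
  then show "level_ok B Q UNIV k \<tau>" using fin unfolding level_ok_def by blast
  show "\<And>j l. j \<in> {7, 8, 9} \<Longrightarrow> l < Suc k * R \<Longrightarrow> \<tau> (Arr j l) = \<sigma> (Arr j l)" using fin by blast
qed

definition table :: "nat set \<Rightarrow> nat \<Rightarrow> nat \<Rightarrow> nat \<Rightarrow> store \<Rightarrow> bool" where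
  "table B Q s d \<sigma> \<longleftrightarrow> (\<forall>v<R. \<sigma> (Arr 7 v) = (if v = s then 1 else 0)) \<and> (\<forall>k<d. level_ok B Q UNIV k \<sigma>)"

lemma table_frame: "table B Q s d \<sigma> \<Longrightarrow> frame X J \<sigma> \<tau> \<Longrightarrow> J \<inter> {7, 8, 9} = {} \<Longrightarrow> table B Q s d \<tau>"
  unfolding table_def level_ok_def frame_def by auto

lemma dp_spec:
  assumes "arrs \<sigma>" "\<sigma> (Var 30) = s" "s < R" and B: "setof 4 \<sigma> = B" "setof 5 \<sigma> = B" "regular B" "covers B"
    and Q: "\<And>i. C i \<le> Q"
  shows "table B Q s R (exec (dp Q) \<sigma>)"
proof -
  let ?c = "Put 7 (V 31) (N 0)"
  define \<sigma>0 where "\<sigma>0 = \<sigma>(Var 25 := 0, Var 26 := \<sigma> (Var 0))"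
  define \<sigma>1 where "\<sigma>1 = exec (For 31 ?c) \<sigma>0"
  have f0: "frame {25, 26} {} \<sigma> \<sigma>0" by (simp add: frame_def \<sigma>0_def)
  have ar0: "arrs \<sigma>0" using assms(1) f0 by (rule arrs_frame) auto
  have f1: "frame {31} {7} \<sigma>0 \<sigma>1" using frame_exec[of "For 31 ?c" \<sigma>0] by (simp add: \<sigma>1_def)
  have z: "\<forall>v<R. \<sigma>1 (Arr 7 v) = 0" unfolding \<sigma>1_def
    by (rule exec_For[where P = "\<lambda>n \<rho>. \<forall>v<n. \<rho> (Arr 7 v) = 0"]) (use ar0 in \<open>auto simp: arrsD less_Suc_eq\<close>)
  define \<sigma>2 where "\<sigma>2 = \<sigma>1(Arr 7 s := 1)"
  have "\<sigma>1 (Var 30) = s" using frameD(1)[OF f1, of 30] frameD(1)[OF f0, of 30] assms(2) by simp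
  then have ex: "exec (dp Q) \<sigma> = exec (For 27 (level Q ;; Assign 25 (V 26) ;; Assign 26 (Plus (V 26) (V 0)))) \<sigma>2"
    unfolding dp_def \<sigma>2_def \<sigma>1_def \<sigma>0_def by (simp del: exec.simps(5))
  have f2: "frame {25, 26, 31} {7} \<sigma> \<sigma>2" using f0 f1 by (simp add: frame_def \<sigma>2_def)
  have v2: "\<sigma>2 (Var 25) = 0" "\<sigma>2 (Var 26) = R"
    using frameD(1)[OF f1, of 25] frameD(1)[OF f1, of 26] arrsD(4)[OF assms(1)] by (simp_all add: \<sigma>2_def \<sigma>0_def)
  have ar2: "arrs \<sigma>2" using assms(1) f2 by (rule arrs_frame) auto
  have b2: "\<forall>v<R. \<sigma>2 (Arr 7 v) = (if v = s then 1 else 0)" using z by (simp add: \<sigma>2_def)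
  let ?d = "level Q ;; Assign 25 (V 26) ;; Assign 26 (Plus (V 26) (V 0))"
  let ?P = "\<lambda>n \<rho>. table B Q s n \<rho> \<and> \<rho> (Var 25) = n * R \<and> \<rho> (Var 26) = Suc n * R"
  have tu: "table B Q s d (\<rho>(Var x := y)) = table B Q s d \<rho>" for d \<rho> x y by (simp add: table_def level_ok_def)
  have "?P R (exec (For 27 ?d) \<sigma>2)"
  proof (rule exec_For_frame[where P = ?P])
    show "?P 0 (\<sigma>2(Var 27 := 0))" unfolding tu using b2 v2 by (simp add: table_def)
    fix k \<rho> assume k: "k < R" "?P k \<rho>" "\<rho> (Var 27) = k" and fr: "frame (wv (For 27 ?d)) (wa (For 27 ?d)) \<sigma>2 \<rho>"
    have fr': "frame {10, 11, 12, 13, 14, 20, 21, 22, 23, 24, 25, 26, 27, 28, 29, 31, 47} {6, 7, 8, 9} \<sigma> \<rho>"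
      using fr f2 by (simp add: frame_def wv_level)
    have ar: "arrs \<rho>" using assms(1) fr' by (rule arrs_frame) auto
    have s: "setof 4 \<rho> = B" "setof 5 \<rho> = B" using setof_frame[OF fr', of 4] setof_frame[OF fr', of 5] B by simp_all
    define \<rho>1 where "\<rho>1 = exec (level Q) \<rho>"
    have p: "\<rho> (Var 25) = k * R" "\<rho> (Var 26) = Suc k * R" using k(2) by blast+
    note ls = level_spec[OF ar s B(3,4) p Q, folded \<rho>1_def]
    have fl: "frame (wv (level Q)) (wa (level Q)) \<rho> \<rho>1" unfolding \<rho>1_def by (rule frame_exec)
    have v: "\<rho>1 (Var 26) = Suc k * R" "\<rho>1 (Var 0) = R"
      using frameD(1)[OF fl, of 26] frameD(1)[OF fl, of 0] p arrsD(4)[OF ar] by (simp_all add: wv_level)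
    have "table B Q s (Suc k) \<rho>1" unfolding table_def
    proof (intro conjI allI impI)
      fix v assume "v < R"
      then show "\<rho>1 (Arr 7 v) = (if v = s then 1 else 0)" using ls(2)[of 7 v] k(2) by (simp add: table_def)
    next
      fix i assume i: "i < Suc k"
      show "level_ok B Q UNIV i \<rho>1"
      proof (cases "i = k")
        case False
        then have "Suc (Suc i) * R \<le> Suc k * R" using i by (intro mult_le_mono1) simp
        then have "\<rho>1 (Arr j l) = \<rho> (Arr j l)" if "j \<in> {7, 8, 9}" "l < Suc (Suc i) * R" for j l
          using ls(2)[OF that(1), of l] that(2) by linarith
        moreover have "level_ok B Q UNIV i \<rho>" using k(2) i False by (simp add: table_def)
        ultimately show ?thesis by (intro level_ok_cong[of B Q UNIV i \<rho> \<rho>1])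
      qed (use ls(1) in simp)
    qed
    moreover have "(exec ?d \<rho>)(Var 27 := Suc k) = \<rho>1(Var 25 := Suc k * R, Var 26 := Suc (Suc k) * R, Var 27 := Suc k)"
      using v by (simp add: \<rho>1_def add_ac)
    ultimately show "?P (Suc k) ((exec ?d \<rho>)(Var 27 := Suc k))" by (simp add: tu)
  qed (use ar2 in \<open>auto simp: arrsD wv_level\<close>)
  then show ?thesis unfolding ex by blast
qed

text \<open>Together with the exact weight of the traced walk in \<open>cand_spec\<close>, this one
  inequality suffices: a negative closed walk of given length forces the traced walk to be negative.
  The summands 1 and \<open>length ps * Q\<close> are the shifts in the table.\<close>

lemma table_walk_le:
  assumes tab: "table B Q s R \<sigma>" and Q: "\<And>i. C i \<le> Q" and B: "B \<subseteq> {..<R}" and s: "s < R"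
  shows "walk B s ps v \<Longrightarrow> length ps \<le> R \<Longrightarrow>
    \<sigma> (Arr 7 (length ps * R + v)) \<noteq> 0 \<and> int (\<sigma> (Arr 7 (length ps * R + v))) \<le> 1 + wt ps + int (length ps * Q)"
proof (induction ps arbitrary: v rule: rev_induct)
  case Nil
  then show ?case using tab s by (simp add: table_def)
next
  case (snoc p ps)
  obtain a b where p: "p = (a, b)" by force
  from snoc.prems(1) have w: "walk B s ps (H a)" "step B a b" "v = H b" by (auto simp: walk_append p)
  let ?k = "length ps"
  have IH: "\<sigma> (Arr 7 (?k * R + H a)) \<noteq> 0" "int (\<sigma> (Arr 7 (?k * R + H a))) \<le> 1 + wt ps + int (?k * Q)"
    using snoc.IH[OF w(1)] snoc.prems(2) by auto
  have "level_ok B Q UNIV ?k \<sigma>" using tab snoc.prems(2) by (simp add: table_def)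
  then have l: "\<sigma> (Arr 7 (Suc ?k * R + H b)) \<noteq> 0"
    "\<sigma> (Arr 7 (Suc ?k * R + H b)) \<le> \<sigma> (Arr 7 (?k * R + H a)) + C a + Q - C b"
    using w(2) IH(1) unfolding level_ok_def by blast+
  have "int (\<sigma> (Arr 7 (Suc ?k * R + H b))) \<le> int (\<sigma> (Arr 7 (?k * R + H a))) + int (C a) + int Q - int (C b)"
    using l(2) Q[of b] by linarith
  then have "int (\<sigma> (Arr 7 (Suc ?k * R + H b))) \<le> 1 + wt (ps @ [p]) + int (Suc ?k * Q)"
    using IH(2) by (simp add: p algebra_simps)
  then show ?case using l(1) w(3) by simp
qed


lemma cand_spec:
  assumes ar: "arrs \<sigma>" and tab: "table B Q s R \<sigma>" and Q: "\<And>i. C i \<le> Q" and B: "setof 4 \<sigma> = B" and s: "s < R"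
    and v: "\<sigma> (Var 30) = s" "\<sigma> (Var 32) = k" "\<sigma> (Var 36) = Suc k * R" and k: "k < R"
    and nz: "\<sigma> (Arr 7 (Suc k * R + s)) \<noteq> 0"
  shows "\<exists>qs. walk B s qs s \<and> length qs = Suc k \<and> int (\<sigma> (Arr 7 (Suc k * R + s))) = 1 + wt qs + int (Suc k * Q) \<and>
    setof 10 (exec cand \<sigma>) = B - snd ` set qs \<union> fst ` set qs"
proof -
  let ?c = "guard (ltE (V 33) (Plus (V 32) (N 1)))
       (Assign 28 (A 8 (Plus (V 35) (V 34))) ;; Assign 29 (A 9 (Plus (V 35) (V 34))) ;;
        Put 10 (V 29) (N 0) ;; Put 10 (V 28) (N 1) ;; Assign 34 (A 2 (V 28)) ;; Assign 35 (Minus (V 35) (V 0)))"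
  define \<sigma>1 where "\<sigma>1 = exec (copy 4 10) \<sigma>"
  define \<sigma>2 where "\<sigma>2 = \<sigma>1(Var 34 := s, Var 35 := Suc k * R)"
  have f1: "frame {19} {10} \<sigma> \<sigma>1" using frame_exec[of "copy 4 10" \<sigma>] by (simp add: \<sigma>1_def wv_copy)
  have s10: "setof 10 \<sigma>1 = B" using copy_spec(2)[OF ar, of 4 10] B by (simp add: \<sigma>1_def)
  have f2: "frame {19, 34, 35} {10} \<sigma> \<sigma>2" using f1 by (simp add: frame_def \<sigma>2_def)
  have ar2: "arrs \<sigma>2" using ar f2 by (rule arrs_frame) auto
  have ex: "exec cand \<sigma> = exec (For 33 ?c) \<sigma>2"
    using frameD(1)[OF f1, of 30] frameD(1)[OF f1, of 36] v unfolding cand_def \<sigma>2_def \<sigma>1_def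
    by (simp del: exec.simps(5))
  have BR: "B \<subseteq> {..<R}" using B setof_subset by blast
  define D where "D l = \<sigma> (Arr 7 l)" for l
  \<comment> \<open>\<open>qs\<close> is the final part of the walk, with \<open>l\<close> steps,
    traced so far; variable 34 is the vertex where it begins. The table entry splits into the
    remaining entry and the shifted weight of \<open>qs\<close>.\<close>
  let ?Q = "\<lambda>l \<rho> qs. length qs = l \<and> walk B (\<rho> (Var 34)) qs s \<and> \<rho> (Var 34) < R \<and> \<rho> (Var 35) = (Suc k - l) * R \<and>
      D ((Suc k - l) * R + \<rho> (Var 34)) \<noteq> 0 \<and>
      int (D (Suc k * R + s)) = int (D ((Suc k - l) * R + \<rho> (Var 34))) + wt qs + int (l * Q) \<and>
      setof 10 \<rho> = B - snd ` set qs \<union> fst ` set qs"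
  let ?P = "\<lambda>i \<rho>. \<exists>qs. ?Q (min i (Suc k)) \<rho> qs"
  have main: "?P R (exec (For 33 ?c) \<sigma>2)"
  proof (rule exec_For_frame[where P = ?P])
    show "?P 0 (\<sigma>2(Var 33 := 0))"
      unfolding setof_upd using s nz s10 by (intro exI[of _ "[]"]) (simp add: \<sigma>2_def D_def setof_upd)
    fix i \<rho> assume i: "i < R" "?P i \<rho>" "\<rho> (Var 33) = i" and fr: "frame (wv (For 33 ?c)) (wa (For 33 ?c)) \<sigma>2 \<rho>"
    have fr': "frame {19, 28, 29, 33, 34, 35, 47} {10} \<sigma> \<rho>" using fr f2 by (simp add: frame_def)
    have ar3: "arrs \<rho>" using ar fr' by (rule arrs_frame) auto
    have v32: "\<rho> (Var 32) = k" using frameD(1)[OF fr', of 32] v by simp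
    show "?P (Suc i) ((exec ?c \<rho>)(Var 33 := Suc i))"
    proof (cases "i < Suc k")
      case False
      then have "exec ?c \<rho> = \<rho>(Var 47 := 0)" using i(3) v32 by simp
      then have ec: "(exec ?c \<rho>)(Var 33 := Suc i) = \<rho>(Var 47 := 0, Var 33 := Suc i)" by (simp only:)
      have mm: "min i (Suc k) = Suc k" "min (Suc i) (Suc k) = Suc k" using False by simp_all
      show ?thesis using i(2) unfolding ec mm by (simp add: setof_upd)
    next
      case True
      define w where "w = \<rho> (Var 34)"
      define l where "l = k - i"
      have l: "Suc k - i = Suc l" "Suc k - Suc i = l" using True by (auto simp: l_def)
      obtain qs where qs: "length qs = i" "walk B w qs s" "w < R" "\<rho> (Var 35) = Suc l * R" "D (Suc l * R + w) \<noteq> 0"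
        "int (D (Suc k * R + s)) = int (D (Suc l * R + w)) + wt qs + int (i * Q)"
        "setof 10 \<rho> = B - snd ` set qs \<union> fst ` set qs"
        using i(2) True l by (auto simp: min_def w_def)
      have "level_ok B Q UNIV l \<sigma>" using tab k by (simp add: table_def l_def)
      then obtain a b where ab: "\<sigma> (Arr 8 (Suc l * R + w)) = a" "\<sigma> (Arr 9 (Suc l * R + w)) = b" "step B a b" "H b = w"
        "D (l * R + H a) \<noteq> 0" "D (Suc l * R + w) = D (l * R + H a) + C a + Q - C b"
        using qs(3,5) unfolding level_ok_def D_def by blast
      have aR: "a < R" "b < R" "a \<notin> B" "b \<in> B" using ab(3) BR by (auto simp: step_def)
      have r89: "\<rho> (Arr 8 (Suc l * R + w)) = a" "\<rho> (Arr 9 (Suc l * R + w)) = b"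
        using frameD(2)[OF fr', of 8] frameD(2)[OF fr', of 9] ab(1,2) by simp_all
      have "exec ?c \<rho> = \<rho>(Var 28 := a, Var 29 := b, Arr 10 b := 0, Arr 10 a := 1, Var 34 := H a, Var 35 := l * R)"
        using i(3) v32 True r89 qs(4) arrsD(4)[OF ar3] arrsD(2)[OF ar3 aR(1)] by (simp add: w_def[symmetric])
      then have ec: "(exec ?c \<rho>)(Var 33 := Suc i) =
        \<rho>(Var 28 := a, Var 29 := b, Arr 10 b := 0, Arr 10 a := 1, Var 34 := H a, Var 35 := l * R, Var 33 := Suc i)" by (simp only:)
      have cb: "C b \<le> Q" by (rule Q)
      have "?Q (Suc i) ((exec ?c \<rho>)(Var 33 := Suc i)) ((a, b) # qs)"
      proof (intro conjI)
        show "length ((a, b) # qs) = Suc i" using qs(1) by simp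
        show "walk B (((exec ?c \<rho>)(Var 33 := Suc i)) (Var 34)) ((a, b) # qs) s"
          unfolding ec using ab(3,4) qs(2) by simp
        show "((exec ?c \<rho>)(Var 33 := Suc i)) (Var 34) < R" unfolding ec using arcs_less_R(2)[of a] by simp
        show "((exec ?c \<rho>)(Var 33 := Suc i)) (Var 35) = (Suc k - Suc i) * R" unfolding ec l by simp
        show "D ((Suc k - Suc i) * R + ((exec ?c \<rho>)(Var 33 := Suc i)) (Var 34)) \<noteq> 0" unfolding ec l using ab(5) by simp
        have "int (D (Suc l * R + w)) = int (D (l * R + H a)) + int (C a) + int Q - int (C b)" using ab(6) cb by linarith
        then show "int (D (Suc k * R + s)) = int (D ((Suc k - Suc i) * R + ((exec ?c \<rho>)(Var 33 := Suc i)) (Var 34))) +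
          wt ((a, b) # qs) + int (Suc i * Q)"
          unfolding ec l using qs(6) by (simp add: algebra_simps)
        \<comment> \<open>Arcs inserted before are outside \<open>B\<close> and \<open>b\<close> is
          in \<open>B\<close>, so removing \<open>b\<close> does not undo an insertion.\<close>
        have fs: "fst ` set qs \<inter> B = {}" using walk_steps[OF qs(2)] by (force simp: step_def)
        show "setof 10 ((exec ?c \<rho>)(Var 33 := Suc i)) = B - snd ` set ((a, b) # qs) \<union> fst ` set ((a, b) # qs)"
          unfolding ec setof_upd using aR qs(7) fs by (auto simp: setof_put setof_upd)
      qed
      moreover have "min (Suc i) (Suc k) = Suc i" using True by simp
      ultimately show ?thesis by metis
    qed
  qed (use ar2 in \<open>auto simp: arrsD\<close>)
  have "?P R (exec cand \<sigma>)" unfolding ex by (rule main)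
  moreover have "min R (Suc k) = Suc k" using k by simp
  ultimately obtain qs where qs: "length qs = Suc k" "walk B (exec cand \<sigma> (Var 34)) qs s" "exec cand \<sigma> (Var 34) < R"
     "D (exec cand \<sigma> (Var 34)) \<noteq> 0"
      "int (D (Suc k * R + s)) = int (D (exec cand \<sigma> (Var 34))) + wt qs + int (Suc k * Q)"
      "setof 10 (exec cand \<sigma>) = B - snd ` set qs \<union> fst ` set qs"
    by auto
  \<comment> \<open>The only nonzero entry of level 0 is the 1 at \<open>s\<close>. So the traced
    walk starts at \<open>s\<close>, and no unknown weight remains.\<close>
  have "exec cand \<sigma> (Var 34) = s" "D (exec cand \<sigma> (Var 34)) = 1"
    using tab qs(3,4) by (auto simp: table_def D_def split: if_splits)
  then show ?thesis using qs unfolding D_def by (intro exI[of _ qs]) auto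
qed

definition cost :: "nat set \<Rightarrow> nat" where
  "cost S = (\<Sum>i\<in>S. C i)"

lemma cost_int: "sum (\<lambda>i. int (C i)) S = int (cost S)"
  by (simp add: cost_def)

lemma costs_spec:
  assumes "arrs \<sigma>"
  shows "exec costs \<sigma> (Var 37) = cost (setof 4 \<sigma>)" "exec costs \<sigma> (Var 38) = cost (setof 10 \<sigma>)"
proof -
  let ?c = "guard (A 4 (V 31)) (Assign 37 (Plus (V 37) (A 3 (V 31)))) ;;
       guard (A 10 (V 31)) (Assign 38 (Plus (V 38) (A 3 (V 31))))"
  let ?P = "\<lambda>d \<rho>. \<rho> (Var 37) = cost (setof 4 \<sigma> \<inter> {..<d}) \<and> \<rho> (Var 38) = cost (setof 10 \<sigma> \<inter> {..<d})"
  let ?\<sigma> = "\<sigma>(Var 37 := 0, Var 38 := 0)"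
  have ar0: "arrs ?\<sigma>" using assms by (simp add: arrs_upd)
  have S: "cost (S \<inter> {..<Suc i}) = cost (S \<inter> {..<i}) + (if i \<in> S then C i else 0)" for S i
  proof -
    have "S \<inter> {..<Suc i} = (if i \<in> S then insert i (S \<inter> {..<i}) else S \<inter> {..<i})" by (auto simp: less_Suc_eq)
    then show ?thesis by (simp add: cost_def)
  qed
  have "?P R (exec (For 31 ?c) ?\<sigma>)"
  proof (rule exec_For_frame[where P = ?P])
    fix i \<rho> assume i: "i < R" "?P i \<rho>" "\<rho> (Var 31) = i" and fr: "frame (wv (For 31 ?c)) (wa (For 31 ?c)) ?\<sigma> \<rho>"
    have ar: "arrs \<rho>" using ar0 fr by (rule arrs_frame) auto
    have z: "\<rho> (Arr 4 i) = 0 \<longleftrightarrow> i \<notin> setof 4 \<sigma>" "\<rho> (Arr 10 i) = 0 \<longleftrightarrow> i \<notin> setof 10 \<sigma>"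
      using frameD(2)[OF fr, of 4 i] frameD(2)[OF fr, of 10 i] i(1) by (auto simp: setof_def)
    show "?P (Suc i) ((exec ?c \<rho>)(Var 31 := Suc i))"
      unfolding S using i(2,3) z arrsD(3)[OF ar i(1)]
      by (cases "i \<in> setof 4 \<sigma>"; cases "i \<in> setof 10 \<sigma>") simp_all
  qed (use assms in \<open>auto simp: arrsD cost_def\<close>)
  moreover have "setof j \<sigma> \<inter> {..<R} = setof j \<sigma>" for j using setof_subset by blast
  moreover have "exec costs \<sigma> = exec (For 31 ?c) ?\<sigma>"
    unfolding costs_def by (simp only: exec.simps ev.simps)
  ultimately show "exec costs \<sigma> (Var 37) = cost (setof 4 \<sigma>)" "exec costs \<sigma> (Var 38) = cost (setof 10 \<sigma>)" by simp_all
qed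

lemma check_spec:
  assumes ar: "arrs \<sigma>"
  shows "setof 4 (exec check \<sigma>) =
    (if covers (setof 10 \<sigma>) \<and> cost (setof 10 \<sigma>) < cost (setof 4 \<sigma>) then setof 10 \<sigma> else setof 4 \<sigma>)"
proof -
  define \<sigma>1 where "\<sigma>1 = exec (copy 10 5) \<sigma>"
  have f1: "frame {19} {5} \<sigma> \<sigma>1" using frame_exec[of "copy 10 5" \<sigma>] by (simp add: \<sigma>1_def wv_copy)
  have s5: "setof 5 \<sigma>1 = setof 10 \<sigma>" using copy_spec(2)[OF ar, of 10 5] by (simp add: \<sigma>1_def)
  have ar1: "arrs \<sigma>1" using ar f1 by (rule arrs_frame) auto
  define \<sigma>2 where "\<sigma>2 = exec feas \<sigma>1"
  have f2: "frame (wv feas) (wa feas) \<sigma>1 \<sigma>2" unfolding \<sigma>2_def by (rule frame_exec)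
  have ar2: "arrs \<sigma>2" using ar1 f2 by (rule arrs_frame) (auto simp: wv_feas)
  define \<sigma>3 where "\<sigma>3 = exec costs \<sigma>2"
  have f3: "frame (wv costs) (wa costs) \<sigma>2 \<sigma>3" unfolding \<sigma>3_def by (rule frame_exec)
  have ar3: "arrs \<sigma>3" using ar2 f3 by (rule arrs_frame) (auto simp: wv_costs)
  have s2: "setof 4 \<sigma>2 = setof 4 \<sigma>" "setof 10 \<sigma>2 = setof 10 \<sigma>"
    using setof_frame[OF f1, of 4] setof_frame[OF f1, of 10] setof_frame[OF f2, of 4] setof_frame[OF f2, of 10]
    by (simp_all add: wv_feas)
  have s3: "setof 4 \<sigma>3 = setof 4 \<sigma>" "setof 10 \<sigma>3 = setof 10 \<sigma>"
    using setof_frame[OF f3, of 4] setof_frame[OF f3, of 10] s2 by (simp_all add: wv_costs)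
  have v: "\<sigma>3 (Var 15) = 0 \<longleftrightarrow> \<not> covers (setof 10 \<sigma>)"
  proof -
    have "\<sigma>3 (Var 15) = exec feas \<sigma>1 (Var 15)" using frameD(1)[OF f3, of 15] by (simp add: wv_costs \<sigma>2_def)
    then show ?thesis using feas_spec[OF ar1] s5 by metis
  qed
  have c: "\<sigma>3 (Var 37) = cost (setof 4 \<sigma>)" "\<sigma>3 (Var 38) = cost (setof 10 \<sigma>)"
    using costs_spec[OF ar2] s2 by (simp_all add: \<sigma>3_def)
  have "exec check \<sigma> = exec (guard (V 15) (guard (ltE (V 38) (V 37)) (copy 10 4))) \<sigma>3"
    unfolding check_def \<sigma>3_def \<sigma>2_def \<sigma>1_def by (simp only: exec.simps)
  then show ?thesis using v c s3 copy_spec(2)[OF ar3, of 10 4] by (simp add: setof_upd)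
qed

text \<open>
  If the current cover is not optimal, the table for a suitable root and length yields a shortest
  negative closed walk, and the candidate read off it is accepted.
\<close>

lemma search_spec:
  assumes ar: "arrs \<sigma>" and B: "setof 4 \<sigma> = B" "regular B" "covers B" and Q: "\<And>i. C i \<le> Q"
  defines "\<tau> \<equiv> exec (search Q) \<sigma>"
  shows "covers (setof 4 \<tau>)" "cost (setof 4 \<tau>) \<le> cost B"
    "\<And>D. D \<subseteq> {..<R} \<Longrightarrow> covers D \<Longrightarrow> cost D < cost B \<Longrightarrow> cost (setof 4 \<tau>) < cost B"
proof -
  have BR: "B \<subseteq> {..<R}" using B(1) setof_subset by blast
  define opt where "opt \<longleftrightarrow> \<not> (\<exists>D\<subseteq>{..<R}. covers D \<and> cost D < cost B)"
  \<comment> \<open>The promising root and length are fixed before the loops are analyzed. The loop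
    counter \<open>k\<close> stands for walks of \<open>Suc k\<close> steps.\<close>
  have "\<exists>k s. \<not> opt \<longrightarrow> k < R - 1 \<and> s < R \<and> (\<exists>ps. walk B s ps s \<and> length ps = Suc k \<and> wt ps < 0) \<and>
    (\<forall>ps. walk B s ps s \<longrightarrow> length ps = Suc k \<longrightarrow> wt ps < 0 \<longrightarrow>
       covers (B - snd ` set ps \<union> fst ` set ps) \<and> cost (B - snd ` set ps \<union> fst ` set ps) < cost B)"
  proof (cases opt)
    case False
    then obtain D where D: "D \<subseteq> {..<R}" "covers D" "cost D < cost B" by (auto simp: opt_def)
    have "sum (\<lambda>i. int (C i)) D < sum (\<lambda>i. int (C i)) B" unfolding cost_int using D(3) by simp
    then obtain k s where k: "0 < k" "k \<le> card {0<..n}" "s \<in> {0<..n}" "\<exists>ps. walk B s ps s \<and> length ps = k \<and> wt ps < 0"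
      "\<forall>ps. walk B s ps s \<longrightarrow> length ps = k \<longrightarrow> wt ps < 0 \<longrightarrow>
       covers (B - snd ` set ps \<union> fst ` set ps) \<and>
       sum (\<lambda>i. int (C i)) (B - snd ` set ps \<union> fst ` set ps) < sum (\<lambda>i. int (C i)) B"
      using improving_walk_exists[OF B(2,3) BR D(2,1)] by auto
    have "k - 1 < R - 1" "s < R" "k = Suc (k - 1)" using k(1-3) n_less_R by auto
    then show ?thesis using k(4,5) unfolding cost_int of_nat_less_iff by metis
  qed auto
  then obtain k\<^sub>0 s\<^sub>0 where best: "\<not> opt \<Longrightarrow> k\<^sub>0 < R - 1" "\<not> opt \<Longrightarrow> s\<^sub>0 < R"
    "\<not> opt \<Longrightarrow> \<exists>ps. walk B s\<^sub>0 ps s\<^sub>0 \<and> length ps = Suc k\<^sub>0 \<and> wt ps < 0"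
    "\<And>ps. \<not> opt \<Longrightarrow> walk B s\<^sub>0 ps s\<^sub>0 \<Longrightarrow> length ps = Suc k\<^sub>0 \<Longrightarrow> wt ps < 0 \<Longrightarrow>
       covers (B - snd ` set ps \<union> fst ` set ps) \<and> cost (B - snd ` set ps \<union> fst ` set ps) < cost B"
    by blast
  define inv where "inv \<rho> \<longleftrightarrow> covers (setof 4 \<rho>) \<and> (setof 4 \<rho> = B \<or> cost (setof 4 \<rho>) < cost B)" for \<rho>
  have inv_upd: "inv (\<rho>(Var x := y)) = inv \<rho>" for \<rho> x y by (simp add: inv_def setof_upd)
  let ?d = "cand ;; check ;; Assign 36 (Plus (V 36) (V 0))"
  let ?c = "copy 4 5 ;; dp Q ;; Assign 36 (V 0) ;; For 32 ?d"
  let ?P = "\<lambda>i \<rho>. inv \<rho> \<and> (\<not> opt \<longrightarrow> s\<^sub>0 < i \<longrightarrow> cost (setof 4 \<rho>) < cost B)"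
  have "?P R (exec (For 30 ?c) \<sigma>)"
  proof (rule exec_For_frame[where P = ?P])
    show "?P 0 (\<sigma>(Var 30 := 0))" using B by (simp add: inv_def setof_upd)
    fix s \<rho> assume s: "s < R" "?P s \<rho>" "\<rho> (Var 30) = s" and fr: "frame (wv (For 30 ?c)) (wa (For 30 ?c)) \<sigma> \<rho>"
    have ar1: "arrs \<rho>" using ar fr by (rule arrs_frame) (auto simp: wv_copy wv_dp wv_cand wv_check)
    define \<rho>1 where "\<rho>1 = exec (copy 4 5) \<rho>"
    have f1: "frame {19} {5} \<rho> \<rho>1" using frame_exec[of "copy 4 5" \<rho>] by (simp add: \<rho>1_def wv_copy)
    have ar2: "arrs \<rho>1" using ar1 f1 by (rule arrs_frame) auto
    have s5: "setof 5 \<rho>1 = setof 4 \<rho>" "setof 4 \<rho>1 = setof 4 \<rho>"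
      using copy_spec(2)[OF ar1, of 4 5] setof_frame[OF f1, of 4] by (simp_all add: \<rho>1_def)
    have v30: "\<rho>1 (Var 30) = s" using frameD(1)[OF f1, of 30] s(3) by simp
    define \<rho>2 where "\<rho>2 = exec (dp Q) \<rho>1"
    have f2: "frame (wv (dp Q)) (wa (dp Q)) \<rho>1 \<rho>2" unfolding \<rho>2_def by (rule frame_exec)
    have ar3: "arrs \<rho>2" using ar2 f2 by (rule arrs_frame) (auto simp: wv_dp)
    have s42: "setof 4 \<rho>2 = setof 4 \<rho>" using setof_frame[OF f2, of 4] s5 by (simp add: wv_dp)
    have tab: "table B Q s R \<rho>2" if "setof 4 \<rho> = B"
      unfolding \<rho>2_def using that s5 by (intro dp_spec[OF ar2 v30 s(1) _ _ B(2,3) Q]) auto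
    define \<rho>3 where "\<rho>3 = \<rho>2(Var 36 := R)"
    have f3: "frame {36} {} \<rho>2 \<rho>3" by (simp add: frame_def \<rho>3_def)
    have ar4: "arrs \<rho>3" using ar3 f3 by (rule arrs_frame) auto
    have i3: "inv \<rho>3" using s(2) s42 by (simp add: inv_def \<rho>3_def setof_upd)
    have v3: "\<rho>3 (Var 30) = s" "\<rho>3 (Var 36) = R"
      using frameD(1)[OF f2, of 30] v30 by (simp_all add: wv_dp \<rho>3_def)
    have "exec ?c \<rho> = exec (For 32 ?d) \<rho>3"
      using arrsD(4)[OF ar3] by (simp add: \<rho>3_def \<rho>2_def \<rho>1_def del: exec.simps(5))
    moreover
    \<comment> \<open>The last conjunct traces equality with \<open>B\<close> back to the start of
      the round for \<open>s\<close>, when the table was computed; so the table is the one of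
      \<open>B\<close>.\<close>
    let ?P' = "\<lambda>k \<rho>'. inv \<rho>' \<and> \<rho>' (Var 36) = Suc k * R \<and> (\<not> opt \<longrightarrow> s\<^sub>0 < s \<or> (s\<^sub>0 = s \<and> k\<^sub>0 < k) \<longrightarrow> cost (setof 4 \<rho>') < cost B) \<and>
        (setof 4 \<rho>' = B \<longrightarrow> setof 4 \<rho> = B)"
    have "?P' R (exec (For 32 ?d) \<rho>3)"
    proof (rule exec_For_frame[where P = ?P'])
      have "setof 4 (\<rho>3(Var 32 := 0)) = setof 4 \<rho>" using s42 by (simp add: \<rho>3_def setof_upd)
      then show "?P' 0 (\<rho>3(Var 32 := 0))" using i3 v3 s(2) by (simp add: inv_upd)
      fix k \<rho>' assume k: "k < R" "?P' k \<rho>'" "\<rho>' (Var 32) = k" and fr2: "frame (wv (For 32 ?d)) (wa (For 32 ?d)) \<rho>3 \<rho>'"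
      have ar5: "arrs \<rho>'" using ar4 fr2 by (rule arrs_frame) (auto simp: wv_cand wv_check)
      define \<rho>4 where "\<rho>4 = exec cand \<rho>'"
      have f4: "frame (wv cand) (wa cand) \<rho>' \<rho>4" unfolding \<rho>4_def by (rule frame_exec)
      have ar6: "arrs \<rho>4" using ar5 f4 by (rule arrs_frame) (auto simp: wv_cand)
      have s44: "setof 4 \<rho>4 = setof 4 \<rho>'" using setof_frame[OF f4, of 4] by (simp add: wv_cand)
      define \<rho>5 where "\<rho>5 = exec check \<rho>4"
      have f5: "frame (wv check) (wa check) \<rho>4 \<rho>5" unfolding \<rho>5_def by (rule frame_exec)
      have ar7: "arrs \<rho>5" using ar6 f5 by (rule arrs_frame) (auto simp: wv_check)
      have s45: "setof 4 \<rho>5 = (if covers (setof 10 \<rho>4) \<and> cost (setof 10 \<rho>4) < cost (setof 4 \<rho>') then setof 10 \<rho>4 else setof 4 \<rho>')"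
        using check_spec[OF ar6] s44 by (simp add: \<rho>5_def)
      have v36: "\<rho>5 (Var 36) = Suc k * R"
        using frameD(1)[OF f5, of 36] frameD(1)[OF f4, of 36] k(2) by (simp add: wv_cand wv_check)
      have ec: "(exec ?d \<rho>')(Var 32 := Suc k) = \<rho>5(Var 36 := Suc (Suc k) * R, Var 32 := Suc k)"
        using v36 arrsD(4)[OF ar7] by (simp add: \<rho>5_def \<rho>4_def add_ac)
      have i5: "inv \<rho>5" "cost (setof 4 \<rho>5) \<le> cost (setof 4 \<rho>')" "setof 4 \<rho>5 = B \<longrightarrow> setof 4 \<rho>' = B"
        using k(2) s45 by (auto simp: inv_def)
      have "cost (setof 4 \<rho>5) < cost B" if no: "\<not> opt" "s\<^sub>0 < s \<or> (s\<^sub>0 = s \<and> k\<^sub>0 < Suc k)"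
      proof (cases "s\<^sub>0 < s \<or> (s\<^sub>0 = s \<and> k\<^sub>0 < k)")
        case True
        then show ?thesis using k(2) no(1) i5(2) by linarith
      next
        case False
        then have eq: "s\<^sub>0 = s" "k\<^sub>0 = k" using no(2) by auto
        show ?thesis
        proof (cases "setof 4 \<rho>' = B")
          case False
          then have "cost (setof 4 \<rho>') < cost B" using k(2) by (simp add: inv_def)
          then show ?thesis using i5(2) by linarith
        next
          case True
          then have "table B Q s R \<rho>2" using tab k(2) by blast
          then have "table B Q s R \<rho>3" using f3 by (rule table_frame) auto
          then have tab': "table B Q s R \<rho>'" using fr2 by (rule table_frame) (auto simp: wv_cand wv_check)
          have v30': "\<rho>' (Var 30) = s" using frameD(1)[OF fr2, of 30] v3 by (simp add: wv_cand wv_check)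
          obtain ps where ps: "walk B s ps s" "length ps = Suc k" "wt ps < 0" using best(3)[OF no(1)] eq by blast
          have "Suc k \<le> R" using k(1) by simp
          then have le: "\<rho>' (Arr 7 (Suc k * R + s)) \<noteq> 0" "int (\<rho>' (Arr 7 (Suc k * R + s))) \<le> 1 + wt ps + int (Suc k * Q)"
            using table_walk_le[OF tab' Q BR s(1) ps(1)] ps(2) by auto
          obtain qs where qs: "walk B s qs s" "length qs = Suc k"
            "int (\<rho>' (Arr 7 (Suc k * R + s))) = 1 + wt qs + int (Suc k * Q)"
            "setof 10 \<rho>4 = B - snd ` set qs \<union> fst ` set qs"
            using cand_spec[OF ar5 tab' Q True s(1) v30' k(3) _ k(1) le(1)] k(2) unfolding \<rho>4_def by blast
          have "wt qs < 0" using qs(3) le(2) ps(3) by linarith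
          then have "covers (setof 10 \<rho>4)" "cost (setof 10 \<rho>4) < cost B"
            using best(4)[OF no(1)] qs eq by auto
          then show ?thesis using s45 True by simp
        qed
      qed
      then show "?P' (Suc k) ((exec ?d \<rho>')(Var 32 := Suc k))"
        unfolding ec using i5 k(2) by (simp add: inv_upd setof_upd)
    qed (use ar4 in \<open>auto simp: arrsD wv_cand wv_check\<close>)
    moreover have "k\<^sub>0 < R" if "\<not> opt" using best(1)[OF that] by simp
    ultimately show "?P (Suc s) ((exec ?c \<rho>)(Var 30 := Suc s))"
      unfolding inv_upd setof_upd less_Suc_eq by metis
  qed (use ar in \<open>auto simp: arrsD wv_copy wv_dp wv_cand wv_check\<close>)
  then have fin: "inv \<tau>" "\<not> opt \<longrightarrow> s\<^sub>0 < R \<longrightarrow> cost (setof 4 \<tau>) < cost B" unfolding \<tau>_def search_def by blast+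
  show "covers (setof 4 \<tau>)" "cost (setof 4 \<tau>) \<le> cost B" using fin(1) by (auto simp: inv_def)
  show "cost (setof 4 \<tau>) < cost B" if "D \<subseteq> {..<R}" "covers D" "cost D < cost B" for D
    using fin(2) best(2) that unfolding opt_def by blast
qed

text \<open>Each round either has an optimal cover or lowers the integral cost by at least one.
  After \<open>R * R\<close> rounds without optimality the cost would be 0, which is optimal as
  well.\<close>

lemma optimize_spec:
  assumes ar: "arrs \<sigma>" and cov: "covers (setof 4 \<sigma>)" and Q: "\<And>i. C i \<le> Q" and c: "cost (setof 4 \<sigma>) \<le> R * R"
  defines "\<tau> \<equiv> exec (optimize Q) \<sigma>"
  shows "covers (setof 4 \<tau>)" "\<And>D. D \<subseteq> {..<R} \<Longrightarrow> covers D \<Longrightarrow> cost (setof 4 \<tau>) \<le> cost D"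
proof -
  define opt where "opt S \<longleftrightarrow> (\<forall>D\<subseteq>{..<R}. covers D \<longrightarrow> cost S \<le> cost D)" for S
  let ?c = "prune ;; search Q"
  define inv where "inv t \<rho> \<longleftrightarrow> covers (setof 4 \<rho>) \<and> (opt (setof 4 \<rho>) \<or> cost (setof 4 \<rho>) + t \<le> R * R)" for t \<rho>
  have inv_upd: "inv t (\<rho>(Var x := y)) = inv t \<rho>" for t \<rho> x y by (simp add: inv_def setof_upd)
  have once: "inv (Suc t) (exec ?c \<rho>)" if ar: "arrs \<rho>" and i: "inv t \<rho>" for t \<rho>
  proof -
    define \<rho>1 where "\<rho>1 = exec prune \<rho>"
    have f1: "frame (wv prune) (wa prune) \<rho> \<rho>1" unfolding \<rho>1_def by (rule frame_exec)
    have ar1: "arrs \<rho>1" using ar f1 by (rule arrs_frame) (auto simp: wv_prune)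
    have "covers (setof 4 \<rho>)" using i by (simp add: inv_def)
    note p = prune_spec[OF ar this, folded \<rho>1_def]
    note s = search_spec[OF ar1 refl p(3,2) Q]
    have "cost (setof 4 \<rho>1) \<le> cost (setof 4 \<rho>)"
      unfolding cost_def using p(1) by (intro sum_mono2) (auto simp: setof_def)
    then have le: "cost (setof 4 (exec (search Q) \<rho>1)) \<le> cost (setof 4 \<rho>)" using s(2) by linarith
    have "opt (setof 4 (exec (search Q) \<rho>1)) \<or> cost (setof 4 (exec (search Q) \<rho>1)) + Suc t \<le> R * R"
    proof (cases "opt (setof 4 \<rho>) \<or> opt (setof 4 \<rho>1)")
      case True
      then show ?thesis using le s(2) unfolding opt_def by (meson order_trans)
    next
      case False
      then obtain D where "D \<subseteq> {..<R}" "covers D" "cost D < cost (setof 4 \<rho>1)" by (auto simp: opt_def not_le)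
      then have "cost (setof 4 (exec (search Q) \<rho>1)) < cost (setof 4 \<rho>1)" by (rule s(3))
      then show ?thesis using i False \<open>cost (setof 4 \<rho>1) \<le> cost (setof 4 \<rho>)\<close> by (auto simp: inv_def)
    qed
    then show ?thesis using s(1) by (simp add: inv_def \<rho>1_def)
  qed
  let ?P = "\<lambda>i \<rho>. inv (i * R) \<rho>"
  have "?P R (exec (For 39 (For 40 ?c)) \<sigma>)"
  proof (rule exec_For_frame[where P = ?P])
    show "?P 0 (\<sigma>(Var 39 := 0))" unfolding inv_upd using cov c by (simp add: inv_def)
    fix i \<rho> assume i: "i < R" "?P i \<rho>" and fr: "frame (wv (For 39 (For 40 ?c))) (wa (For 39 (For 40 ?c))) \<sigma> \<rho>"
    have ar1: "arrs \<rho>" using ar fr by (rule arrs_frame) (auto simp: wv_prune wv_search)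
    let ?P' = "\<lambda>j \<rho>'. inv (i * R + j) \<rho>'"
    have "?P' R (exec (For 40 ?c) \<rho>)"
    proof (rule exec_For_frame[where P = ?P'])
      show "?P' 0 (\<rho>(Var 40 := 0))" unfolding inv_upd using i(2) by simp
      fix j \<rho>' assume j: "?P' j \<rho>'" and fr2: "frame (wv (For 40 ?c)) (wa (For 40 ?c)) \<rho> \<rho>'"
      have "arrs \<rho>'" using ar1 fr2 by (rule arrs_frame) (auto simp: wv_prune wv_search)
      then show "?P' (Suc j) ((exec ?c \<rho>')(Var 40 := Suc j))" unfolding inv_upd using once j by simp
    qed (use ar1 in \<open>auto simp: arrsD wv_prune wv_search\<close>)
    then show "?P (Suc i) ((exec (For 40 ?c) \<rho>)(Var 39 := Suc i))"
      unfolding inv_upd by (simp add: add.commute del: exec.simps)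
  qed (use ar in \<open>auto simp: arrsD wv_prune wv_search\<close>)
  then have fin: "covers (setof 4 \<tau>)" "opt (setof 4 \<tau>) \<or> cost (setof 4 \<tau>) + R * R \<le> R * R"
    unfolding \<tau>_def optimize_def inv_def by blast+
  then show "covers (setof 4 \<tau>)" by blast
  show "cost (setof 4 \<tau>) \<le> cost D" if "D \<subseteq> {..<R}" "covers D" for D
    using fin(2) that by (auto simp: opt_def)
qed

end

section \<open>Reading the instance and writing the solution\<close>

definition ceil5 :: com where
  "ceil5 = Assign 46 (N 0) ;; Assign 9 (N 0) ;;
     Assign 7 (Plus (Plus (A 0 (Plus (V 42) (N 2))) (Plus (A 0 (Plus (V 42) (N 2))) (A 0 (Plus (V 42) (N 2)))))
       (Plus (A 0 (Plus (V 42) (N 2))) (A 0 (Plus (V 42) (N 2))))) ;;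
     For 31 (guard (ltE (V 9) (V 7)) (Assign 46 (Plus (V 46) (N 1)) ;; Assign 9 (Plus (V 9) (A 0 (Plus (V 42) (N 3))))))"

definition put_arcs :: "nat \<Rightarrow> nat \<Rightarrow> nat \<Rightarrow> com" where
  "put_arcs k x y = guard (V y)
     (Put 16 (Plus (V 43) (N k)) (Plus (V x) (N 1)) ;; Put 2 (Plus (V 43) (N k)) (Plus (V y) (N 1)) ;;
      guard (V 6) (Put 16 (Plus (V 43) (N (k + 2))) (Plus (V x) (N 1)) ;; Put 2 (Plus (V 43) (N (k + 2))) (Plus (V y) (N 1))))"

definition place :: com where
  "place = Put 3 (V 43) (V 46) ;; Put 3 (Plus (V 43) (N 1)) (V 46) ;; Put 3 (Plus (V 43) (N 2)) (V 46) ;;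
      Put 3 (Plus (V 43) (N 3)) (V 46) ;; put_arcs 0 44 45 ;; put_arcs 1 45 44 ;; guard (notE (V 6)) (Assign 8 (N 1)) ;;
      Assign 42 (Plus (V 42) (N 5)) ;; Assign 43 (Plus (V 43) (N 4))"

definition edge :: com where
  "edge = guard (ltE (V 41) (A 0 (N 1)))
     (Assign 44 (A 0 (V 42)) ;; Assign 45 (A 0 (Plus (V 42) (N 1))) ;; Assign 6 (A 0 (Plus (V 42) (N 4))) ;; ceil5 ;; place)"

definition setup_arcs :: com where
  "setup_arcs = For 31 (Put 16 (V 31) (N 0) ;; Put 2 (V 31) (N 0) ;; Put 3 (V 31) (N 0) ;; Put 4 (V 31) (N 1)) ;;
     Put 2 (N 0) (N 1) ;; Put 2 (N 1) (N 1) ;; Assign 42 (N 2) ;; Assign 43 (N 2) ;; Assign 8 (N 0) ;; For 41 edge"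

text \<open>Without unsafe edges every set is feasible, so the empty set is optimal. The guard on
  variable 8 then leaves the output empty.\<close>

definition collect :: com where
  "collect = Assign 1 (N 0) ;; Assign 43 (N 2) ;;
     For 41 (guard (ltE (V 41) (A 0 (N 1)))
       (guard (V 8) (guard (Plus (Plus (A 4 (V 43)) (A 4 (Plus (V 43) (N 1)))) (Plus (A 4 (Plus (V 43) (N 2))) (A 4 (Plus (V 43) (N 3)))))
          (Put 11 (V 1) (V 41) ;; Assign 1 (Plus (V 1) (N 1)))) ;;
        Assign 43 (Plus (V 43) (N 4))))"

definition main :: "nat \<Rightarrow> com" where
  "main Q = setup_arcs ;; optimize Q ;; collect"

lemma wv_ceil5: "wv ceil5 = {7, 9, 31, 46, 47}" "wa ceil5 = {}"
  by (auto simp: ceil5_def)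

lemma wv_edge: "wv edge = {6, 7, 8, 9, 31, 42, 43, 44, 45, 46, 47}" "wa edge = {2, 3, 16}"
  by (auto simp: edge_def place_def wv_ceil5 put_arcs_def)

lemma wv_optimize: "wv (optimize Q) = {10, 11, 12, 13, 14, 15, 16, 17, 18, 19, 20, 21, 22, 23, 24, 25, 26, 27, 28, 29,
    30, 31, 32, 33, 34, 35, 36, 37, 38, 39, 40, 47}" "wa (optimize Q) = {4, 5, 6, 7, 8, 9, 10}"
  by (auto simp: optimize_def wv_prune wv_search)

lemma wf_main: "wfc (main Q)" "0 \<notin> wv (main Q)"
proof -
  have "wfc mark" by (simp add: mark_def)
  moreover from this have "wfc reach" by (simp add: reach_def wv_mark)
  moreover from this have "wfc feas" by (simp add: feas_def wv_reach)
  moreover have "wfc (copy a b)" if "a < 64" "b < 64" for a b using that by (simp add: copy_def)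
  moreover from calculation have "wfc prune" by (simp add: prune_def wv_copy wv_feas)
  moreover from calculation have "wfc exchc" by (simp add: exchc_def probe_def wv_reach)
  moreover have "wfc store_step" by (simp add: store_step_def)
  moreover from calculation have "wfc (relax Q)" by (simp add: relax_def)
  moreover from calculation have "wfc (level Q)" by (simp add: level_def wv_relax)
  moreover from calculation have "wfc (dp Q)" by (simp add: dp_def wv_level)
  moreover from calculation have "wfc cand" by (simp add: cand_def)
  moreover have "wfc costs" by (simp add: costs_def)
  moreover from calculation have "wfc check" by (simp add: check_def)
  moreover from calculation have "wfc (search Q)" by (simp add: search_def wv_copy wv_dp wv_cand wv_check)
  moreover from calculation have "wfc (optimize Q)" by (simp add: optimize_def wv_prune wv_search)
  moreover have "wfc edge" by (simp add: edge_def place_def ceil5_def put_arcs_def)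
  moreover from this have "wfc setup_arcs" by (simp add: setup_arcs_def wv_edge)
  moreover have "wfc collect" by (simp add: collect_def)
  ultimately show "wfc (main Q)" by (simp add: main_def)
  show "0 \<notin> wv (main Q)" by (simp add: main_def setup_arcs_def collect_def wv_edge wv_optimize)
qed

text \<open>Division by repeated addition: the number of times \<open>d\<close> has to be added to
  reach \<open>a\<close>. The hypothesis \<open>a <= R * d\<close> says that \<open>R\<close> rounds
  are enough; it comes from the bound on the weights.\<close>

lemma ceil5_spec:
  assumes "\<sigma> (Var 0) = R" "\<sigma> (Arr 0 (\<sigma> (Var 42) + 3)) = d" "5 * \<sigma> (Arr 0 (\<sigma> (Var 42) + 2)) = a" "a \<le> R * d"
  defines "x \<equiv> exec ceil5 \<sigma> (Var 46)"
  shows "a \<le> x * d" "x = 0 \<or> (x - 1) * d < a"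
proof -
  let ?c = "guard (ltE (V 9) (V 7)) (Assign 46 (Plus (V 46) (N 1)) ;; Assign 9 (Plus (V 9) (A 0 (Plus (V 42) (N 3)))))"
  define \<sigma>1 where "\<sigma>1 = \<sigma>(Var 46 := 0, Var 9 := 0, Var 7 := a)"
  have ex: "exec ceil5 \<sigma> = exec (For 31 ?c) \<sigma>1"
  proof -
    let ?b = "\<sigma> (Arr 0 (\<sigma> (Var 42) + 2))"
    have "?b + (?b + ?b) + (?b + ?b) = a" using assms(3) by simp
    then show ?thesis unfolding ceil5_def \<sigma>1_def by (simp del: exec.simps(5))
  qed
  let ?P = "\<lambda>i \<rho>. \<rho> (Var 9) = \<rho> (Var 46) * d \<and> (\<rho> (Var 46) = 0 \<or> (\<rho> (Var 46) - 1) * d < a) \<and>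
     (a \<le> \<rho> (Var 9) \<or> \<rho> (Var 46) = i)"
  have "?P R (exec (For 31 ?c) \<sigma>1)"
  proof (rule exec_For_frame[where P = ?P])
    fix i \<rho> assume i: "?P i \<rho>" and fr: "frame (wv (For 31 ?c)) (wa (For 31 ?c)) \<sigma>1 \<rho>"
    have v: "\<rho> (Var 7) = a" "\<rho> (Arr 0 (\<rho> (Var 42) + 3)) = d"
      using frameD(1)[OF fr, of 7] frameD(1)[OF fr, of 42] frameD(2)[OF fr, of 0] assms(2) by (simp_all add: \<sigma>1_def)
    show "?P (Suc i) ((exec ?c \<rho>)(Var 31 := Suc i))"
      using i v by (cases "\<rho> (Var 9) < a") auto
  qed (use assms(1) in \<open>auto simp: \<sigma>1_def\<close>)
  then show "a \<le> x * d" "x = 0 \<or> (x - 1) * d < a"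
    unfolding x_def ex using assms(4) by auto
qed

lemma put_arcs_spec:
  "exec (put_arcs k x y) \<sigma> (Arr 16 i) = (if \<sigma> (Var y) \<noteq> 0 \<and> (i = \<sigma> (Var 43) + k \<or> \<sigma> (Var 6) \<noteq> 0 \<and> i = \<sigma> (Var 43) + (k + 2))
     then \<sigma> (Var x) + 1 else \<sigma> (Arr 16 i))"
  "exec (put_arcs k x y) \<sigma> (Arr 2 i) = (if \<sigma> (Var y) \<noteq> 0 \<and> (i = \<sigma> (Var 43) + k \<or> \<sigma> (Var 6) \<noteq> 0 \<and> i = \<sigma> (Var 43) + (k + 2))
     then \<sigma> (Var y) + 1 else \<sigma> (Arr 2 i))"
  "z \<noteq> 47 \<Longrightarrow> exec (put_arcs k x y) \<sigma> (Var z) = \<sigma> (Var z)"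
  "exec (put_arcs k x y) \<sigma> (Arr 3 i) = \<sigma> (Arr 3 i)"
  by (simp_all add: put_arcs_def)

lemma collect_spec:
  assumes "\<sigma> (Var 0) = R" "\<sigma> (Arr 0 1) = m" "m \<le> R"
  defines "\<tau> \<equiv> exec collect \<sigma>"
  shows "map (\<lambda>i. \<tau> (Arr 11 i)) [0..<\<tau> (Var 1)] =
    filter (\<lambda>e. \<sigma> (Var 8) \<noteq> 0 \<and> (\<exists>k<4. \<sigma> (Arr 4 (2 + 4 * e + k)) \<noteq> 0)) [0..<m]"
    "\<tau> (Var 1) \<le> m"
proof -
  let ?d = "guard (V 8) (guard (Plus (Plus (A 4 (V 43)) (A 4 (Plus (V 43) (N 1)))) (Plus (A 4 (Plus (V 43) (N 2))) (A 4 (Plus (V 43) (N 3)))))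
          (Put 11 (V 1) (V 41) ;; Assign 1 (Plus (V 1) (N 1))))"
  let ?c = "guard (ltE (V 41) (A 0 (N 1))) (?d ;; Assign 43 (Plus (V 43) (N 4)))"
  define P where "P e \<longleftrightarrow> \<sigma> (Var 8) \<noteq> 0 \<and> (\<exists>k<4. \<sigma> (Arr 4 (2 + 4 * e + k)) \<noteq> 0)" for e
  let ?\<sigma> = "\<sigma>(Var 1 := 0, Var 43 := 2)"
  let ?I = "\<lambda>i \<rho>. map (\<lambda>i. \<rho> (Arr 11 i)) [0..<\<rho> (Var 1)] = filter P [0..<min i m] \<and> \<rho> (Var 43) = 2 + 4 * min i m"
  have fin: "?I R (exec (For 41 ?c) ?\<sigma>)"
  proof (rule exec_For_frame[where P = ?I])
    fix i \<rho> assume i: "?I i \<rho>" "\<rho> (Var 41) = i" and fr: "frame (wv (For 41 ?c)) (wa (For 41 ?c)) ?\<sigma> \<rho>"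
    have v: "\<rho> (Var 8) = \<sigma> (Var 8)" "\<rho> (Arr 0 1) = m" "\<And>l. \<rho> (Arr 4 l) = \<sigma> (Arr 4 l)"
      using frameD(1)[OF fr, of 8] frameD(2)[OF fr, of 0] frameD(2)[OF fr, of 4] assms(2) by simp_all
    show "?I (Suc i) ((exec ?c \<rho>)(Var 41 := Suc i))"
    proof (cases "i < m")
      case False
      then show ?thesis using i v by (simp add: min_def)
    next
      case True
      then have p: "\<rho> (Var 43) = 2 + 4 * i" "min i m = i" "min (Suc i) m = Suc i" using i(1) by simp_all
      have k4: "(\<exists>k<4. Q k) \<longleftrightarrow> Q 0 \<or> Q 1 \<or> Q 2 \<or> Q (3::nat)" for Q
        by (auto simp: eval_nat_numeral less_Suc_eq)
      have Pi: "P i \<longleftrightarrow> \<sigma> (Var 8) \<noteq> 0 \<and> (\<sigma> (Arr 4 (2 + 4 * i)) \<noteq> 0 \<or> \<sigma> (Arr 4 (2 + 4 * i + 1)) \<noteq> 0 \<or>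
          \<sigma> (Arr 4 (2 + 4 * i + 2)) \<noteq> 0 \<or> \<sigma> (Arr 4 (2 + 4 * i + 3)) \<noteq> 0)"
        unfolding P_def k4 by simp
      define sum4 where "sum4 = \<sigma> (Arr 4 (2 + 4 * i)) + \<sigma> (Arr 4 (2 + 4 * i + 1)) +
          (\<sigma> (Arr 4 (2 + 4 * i + 2)) + \<sigma> (Arr 4 (2 + 4 * i + 3)))"
      have sum4: "P i \<longleftrightarrow> \<sigma> (Var 8) \<noteq> 0 \<and> sum4 \<noteq> 0" unfolding Pi sum4_def by auto
      have d: "exec ?d \<rho> = (if P i then \<rho>(Arr 11 (\<rho> (Var 1)) := i, Var 1 := \<rho> (Var 1) + 1) else \<rho>(Var 47 := 0))"
      proof -
        have e: "ev (Plus (Plus (A 4 (V 43)) (A 4 (Plus (V 43) (N 1)))) (Plus (A 4 (Plus (V 43) (N 2))) (A 4 (Plus (V 43) (N 3))))) \<rho> = sum4"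
          by (simp only: ev.simps v p sum4_def)
        show ?thesis unfolding exec_guard e using sum4 i(2) v(1) by simp
      qed
      have "exec ?c \<rho> = (exec ?d \<rho>)(Var 43 := exec ?d \<rho> (Var 43) + 4)"
        using True i(2) v(2) by simp
      then have ec: "(exec ?c \<rho>)(Var 41 := Suc i) =
         (if P i then \<rho>(Arr 11 (\<rho> (Var 1)) := i, Var 1 := \<rho> (Var 1) + 1, Var 43 := 2 + 4 * i + 4, Var 41 := Suc i)
          else \<rho>(Var 47 := 0, Var 43 := 2 + 4 * i + 4, Var 41 := Suc i))"
        unfolding d by (simp add: p)
      have mc: "map (\<lambda>l. if l = b then x else g l) [0..<b] = map g [0..<b]" for b x and g :: "nat \<Rightarrow> nat"
        by (rule map_cong) auto
      show ?thesis unfolding ec p(3) using i(1) unfolding p(2) by (simp add: mc)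
    qed
  qed (use assms(1) in auto)
  have ex: "\<tau> = exec (For 41 ?c) ?\<sigma>" unfolding \<tau>_def collect_def by (simp only: exec.simps ev.simps)
  have f: "map (\<lambda>i. \<tau> (Arr 11 i)) [0..<\<tau> (Var 1)] = filter P [0..<m]"
    using fin assms(3) unfolding ex[symmetric] by (simp add: min_def split: if_splits)
  then show "map (\<lambda>i. \<tau> (Arr 11 i)) [0..<\<tau> (Var 1)] =
    filter (\<lambda>e. \<sigma> (Var 8) \<noteq> 0 \<and> (\<exists>k<4. \<sigma> (Arr 4 (2 + 4 * e + k)) \<noteq> 0)) [0..<m]" by (simp add: P_def[abs_def])
  have "\<tau> (Var 1) = length (filter P [0..<m])" using arg_cong[OF f, of length] by simp
  also have "\<dots> \<le> m" using length_filter_le[of P "[0..<m]"] by simp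
  finally show "\<tau> (Var 1) \<le> m" .
qed

context fgc_cover begin

lemma cst_eq:
  fixes w :: rat
  assumes w: "0 \<le> w" and q: "quotient_of w = (p, q)" and x: "5 * nat p \<le> x * nat q" "x = 0 \<or> (x - 1) * nat q < 5 * nat p"
  shows "x = nat \<lceil>5 * w\<rceil>"
proof -
  have q0: "0 < q" using q by (rule quotient_of_denom_pos)
  have wq: "w = of_int p / of_int q" using q by (rule quotient_of_div)
  have p0: "0 \<le> p" using w q0 by (simp add: wq zero_le_divide_iff)
  have "int (5 * nat p) \<le> int (x * nat q)" using x(1) by (simp only: of_nat_le_iff)
  then have "5 * p \<le> int x * q" using p0 q0 by simp
  then have "(of_int (5 * p) :: rat) \<le> of_int (int x * q)" by (simp only: of_int_le_iff)
  then have 1: "5 * w \<le> of_nat x" using q0 by (simp add: wq divide_le_eq)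
  have 2: "of_nat x - 1 < 5 * w"
  proof (cases "x = 0")
    case False
    then obtain y where y: "x = Suc y" by (cases x) auto
    then have "int (y * nat q) < int (5 * nat p)" using x(2) by (simp only: of_nat_less_iff) simp
    then have "int y * q < 5 * p" using p0 q0 by simp
    then have "(of_int (int y * q) :: rat) < of_int (5 * p)" by (simp only: of_int_less_iff)
    then show ?thesis using q0 by (simp add: wq less_divide_eq y)
  qed (use w in simp)
  have "\<lceil>5 * w\<rceil> = int x" using 1 2 by (intro ceiling_unique) auto
  then show ?thesis by simp
qed

lemma arc_beyond: "2 + 4 * m \<le> i \<Longrightarrow> T i = 0 \<and> H i = 0 \<and> C i = 0"
proof -
  assume i: "2 + 4 * m \<le> i"
  then have "m \<le> (i - 2) div 4" by linarith
  then show ?thesis using i by (simp add: arc_tl_def arc_hd_def arc_cost_def arc_ok_def Let_def)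
qed

lemma edge_spec:
  assumes e: "e < m" and v: "\<rho> (Var 41) = e" "\<rho> (Var 42) = 2 + 5 * e" "\<rho> (Var 43) = 2 + 4 * e" "\<rho> (Var 0) = R"
    and input: "\<And>i. 1 \<le> i \<Longrightarrow> i < 2 + 5 * m \<Longrightarrow> \<rho> (Arr 0 i) = encode_fgc I vs es ! i"
    and w: "0 \<le> weight I (es ! e)" and cR: "cst e \<le> R"
  defines "\<tau> \<equiv> exec edge \<rho>"
  shows "\<tau> (Var 42) = 2 + 5 * Suc e" "\<tau> (Var 43) = 2 + 4 * Suc e" "\<tau> (Var 8) \<noteq> 0 \<longleftrightarrow> \<rho> (Var 8) \<noteq> 0 \<or> \<not> sf e"
    "\<And>i. i \<notin> {2 + 4 * e..<2 + 4 * Suc e} \<Longrightarrow> j \<in> {2, 3, 16} \<Longrightarrow> \<tau> (Arr j i) = \<rho> (Arr j i)"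
    "\<And>i. i \<in> {2 + 4 * e..<2 + 4 * Suc e} \<Longrightarrow> \<rho> (Arr 16 i) = 0 \<Longrightarrow> \<tau> (Arr 16 i) = T i"
    "\<And>i. i \<in> {2 + 4 * e..<2 + 4 * Suc e} \<Longrightarrow> \<rho> (Arr 2 i) = 0 \<Longrightarrow> \<tau> (Arr 2 i) = H i"
    "\<And>i. i \<in> {2 + 4 * e..<2 + 4 * Suc e} \<Longrightarrow> \<tau> (Arr 3 i) = C i"
proof -
  obtain p q where pq: "quotient_of (weight I (es ! e)) = (p, q)" by force
  define \<rho>1 where "\<rho>1 = \<rho>(Var 44 := U e, Var 45 := W e, Var 6 := if sf e then 1 else 0)"
  define \<rho>2 where "\<rho>2 = exec ceil5 \<rho>1"
  have xs: "\<rho> (Arr 0 1) = m" "\<rho> (Arr 0 (2 + 5 * e)) = U e" "\<rho> (Arr 0 (2 + 5 * e + 1)) = W e"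
    "\<rho> (Arr 0 (2 + 5 * e + 2)) = nat p" "\<rho> (Arr 0 (2 + 5 * e + 3)) = nat q"
    "\<rho> (Arr 0 (2 + 5 * e + 4)) = (if sf e then 1 else 0)"
    using e input[of 1] input[of "2 + 5 * e"] input[of "2 + 5 * e + 1"] input[of "2 + 5 * e + 2"]
      input[of "2 + 5 * e + 3"] input[of "2 + 5 * e + 4"] encode_nth[OF e] encode_length(2) pq
    by (simp_all add: eval_nat_numeral)
  have f1: "frame {44, 45, 6} {} \<rho> \<rho>1" by (simp add: frame_def \<rho>1_def)
  have f2: "frame {7, 9, 31, 46, 47} {} \<rho>1 \<rho>2" using frame_exec[of ceil5 \<rho>1] by (simp add: \<rho>2_def wv_ceil5)
  have r1: "\<rho>1 (Var 0) = R" "\<rho>1 (Var 42) = 2 + 5 * e" "\<rho>1 (Arr 0 (\<rho>1 (Var 42) + 3)) = nat q" "5 * \<rho>1 (Arr 0 (\<rho>1 (Var 42) + 2)) = 5 * nat p"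
    using v xs by (simp_all add: \<rho>1_def)
  have q0: "0 < q" using pq by (rule quotient_of_denom_pos)
  have p0: "0 \<le> p" using w quotient_of_div[OF pq] q0 by (simp add: zero_le_divide_iff)
  \<comment> \<open>The rounded cost is at most \<open>R\<close>, so the loop of
    \<open>ceil5\<close> is long enough.\<close>
  have "5 * nat p \<le> R * nat q"
  proof -
    have "5 * weight I (es ! e) \<le> of_int \<lceil>5 * weight I (es ! e)\<rceil>" by (rule le_of_int_ceiling)
    also have "\<dots> = of_nat (cst e)" using w by (simp add: cst_def zero_le_ceiling)
    also have "\<dots> \<le> of_nat R" using cR by (simp only: of_nat_le_iff)
    finally have "of_int (5 * p) \<le> (of_int (int R * q) :: rat)" using q0 by (simp add: quotient_of_div[OF pq] divide_le_eq)
    then have "5 * p \<le> int R * q" by (simp only: of_int_le_iff)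
    then have "int (5 * nat p) \<le> int (R * nat q)" using p0 q0 by simp
    then show ?thesis by (simp only: of_nat_le_iff)
  qed
  from ceil5_spec[OF r1(1,3,4) this] have x: "\<rho>2 (Var 46) = cst e"
    unfolding cst_def \<rho>2_def by (rule cst_eq[OF w pq])
  have r2: "\<rho>2 (Var 42) = 2 + 5 * e" "\<rho>2 (Var 43) = 2 + 4 * e" "\<rho>2 (Var 44) = U e" "\<rho>2 (Var 45) = W e"
    "\<rho>2 (Var 6) = (if sf e then 1 else 0)" "\<rho>2 (Var 8) = \<rho> (Var 8)" "\<And>j i. \<rho>2 (Arr j i) = \<rho> (Arr j i)"
    using frameD(1)[OF f2, of 42] frameD(1)[OF f2, of 43] frameD(1)[OF f2, of 44] frameD(1)[OF f2, of 45]
      frameD(1)[OF f2, of 6] frameD(1)[OF f2, of 8] frameD(2)[OF f2] v by (simp_all add: \<rho>1_def)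
  have ex: "\<tau> = exec place \<rho>2"
    using v xs e unfolding \<tau>_def edge_def \<rho>2_def \<rho>1_def by simp
  define \<rho>3 where "\<rho>3 = \<rho>2(Arr 3 (2 + 4 * e) := cst e, Arr 3 (2 + 4 * e + 1) := cst e, Arr 3 (2 + 4 * e + 2) := cst e,
      Arr 3 (2 + 4 * e + 3) := cst e)"
  define \<rho>4 where "\<rho>4 = exec (put_arcs 0 44 45) \<rho>3"
  define \<rho>5 where "\<rho>5 = exec (put_arcs 1 45 44) \<rho>4"
  have v3: "\<rho>3 (Var y) = \<rho>2 (Var y)" for y by (simp add: \<rho>3_def)
  have v4: "\<rho>4 (Var y) = \<rho>2 (Var y)" if "y \<noteq> 47" for y using that by (simp add: \<rho>4_def put_arcs_spec v3)
  have v5: "\<rho>5 (Var y) = \<rho>2 (Var y)" if "y \<noteq> 47" for y using that by (simp add: \<rho>5_def put_arcs_spec v4)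
  have "exec place \<rho>2 = exec (guard (notE (V 6)) (Assign 8 (N 1)) ;;
      Assign 42 (Plus (V 42) (N 5)) ;; Assign 43 (Plus (V 43) (N 4))) \<rho>5"
    using r2(2) x by (simp add: place_def \<rho>5_def \<rho>4_def \<rho>3_def)
  also have "\<dots> = (if sf e then \<rho>5(Var 47 := 0, Var 42 := 2 + 5 * Suc e, Var 43 := 2 + 4 * Suc e)
     else \<rho>5(Var 8 := 1, Var 42 := 2 + 5 * Suc e, Var 43 := 2 + 4 * Suc e))"
    using r2(1,2,5) by (simp add: v5)
  finally have last: "exec place \<rho>2 = (if sf e then \<rho>5(Var 47 := 0, Var 42 := 2 + 5 * Suc e, Var 43 := 2 + 4 * Suc e)
     else \<rho>5(Var 8 := 1, Var 42 := 2 + 5 * Suc e, Var 43 := 2 + 4 * Suc e))" .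
  have same: "exec place \<rho>2 (Arr j i) = \<rho>5 (Arr j i)" for j i unfolding last by simp
  have c: "(\<rho>2 (Var 6) \<noteq> 0) = sf e" using r2(5) by simp
  have r4: "\<rho>4 (Var 44) = U e" "\<rho>4 (Var 45) = W e" "\<rho>4 (Var 43) = 2 + 4 * e" "(\<rho>4 (Var 6) \<noteq> 0) = sf e"
    using v4[of 44] v4[of 45] v4[of 43] v4[of 6] r2(2-4) c by simp_all
  have r3: "\<rho>3 (Var 44) = U e" "\<rho>3 (Var 45) = W e" "\<rho>3 (Var 43) = 2 + 4 * e" "(\<rho>3 (Var 6) \<noteq> 0) = sf e"
    unfolding v3 using r2(2-4) c by simp_all
  have three: "1 + 2 = (3 :: nat)" "0 + 2 = (2 :: nat)" by simp_all
  have arr: "exec place \<rho>2 (Arr 16 i) = (if U e \<noteq> 0 \<and> (i = 2 + 4 * e + 1 \<or> sf e \<and> i = 2 + 4 * e + 3) then W e + 1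
      else if W e \<noteq> 0 \<and> (i = 2 + 4 * e + 0 \<or> sf e \<and> i = 2 + 4 * e + 2) then U e + 1 else \<rho> (Arr 16 i))"
    "exec place \<rho>2 (Arr 2 i) = (if U e \<noteq> 0 \<and> (i = 2 + 4 * e + 1 \<or> sf e \<and> i = 2 + 4 * e + 3) then U e + 1
      else if W e \<noteq> 0 \<and> (i = 2 + 4 * e + 0 \<or> sf e \<and> i = 2 + 4 * e + 2) then W e + 1 else \<rho> (Arr 2 i))"
    "exec place \<rho>2 (Arr 3 i) = (if i \<in> {2 + 4 * e..<2 + 4 * Suc e} then cst e else \<rho> (Arr 3 i))" for i
  proof -
    have "\<rho>3 (Arr 16 i) = \<rho> (Arr 16 i)" "\<rho>3 (Arr 2 i) = \<rho> (Arr 2 i)" using r2(7) by (simp_all add: \<rho>3_def)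
    then show "exec place \<rho>2 (Arr 16 i) = (if U e \<noteq> 0 \<and> (i = 2 + 4 * e + 1 \<or> sf e \<and> i = 2 + 4 * e + 3) then W e + 1
      else if W e \<noteq> 0 \<and> (i = 2 + 4 * e + 0 \<or> sf e \<and> i = 2 + 4 * e + 2) then U e + 1 else \<rho> (Arr 16 i))"
      "exec place \<rho>2 (Arr 2 i) = (if U e \<noteq> 0 \<and> (i = 2 + 4 * e + 1 \<or> sf e \<and> i = 2 + 4 * e + 3) then U e + 1
      else if W e \<noteq> 0 \<and> (i = 2 + 4 * e + 0 \<or> sf e \<and> i = 2 + 4 * e + 2) then W e + 1 else \<rho> (Arr 2 i))"
      unfolding same \<rho>5_def put_arcs_spec r4 unfolding \<rho>4_def put_arcs_spec r3 three by simp_all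
    have "i \<in> {2 + 4 * e..<2 + 4 * Suc e} \<longleftrightarrow> i = 2 + 4 * e \<or> i = 2 + 4 * e + 1 \<or> i = 2 + 4 * e + 2 \<or> i = 2 + 4 * e + 3"
      unfolding atLeastLessThan_iff by presburger
    then show "exec place \<rho>2 (Arr 3 i) = (if i \<in> {2 + 4 * e..<2 + 4 * Suc e} then cst e else \<rho> (Arr 3 i))"
      unfolding same \<rho>5_def put_arcs_spec \<rho>4_def \<rho>3_def using r2(7)[of 3 i] by (simp only: fun_upd_apply loc.inject) simp
  qed
  have arr': "exec place \<rho>2 (Var 42) = 2 + 5 * Suc e" "exec place \<rho>2 (Var 43) = 2 + 4 * Suc e"
    "exec place \<rho>2 (Var 8) \<noteq> 0 \<longleftrightarrow> \<rho> (Var 8) \<noteq> 0 \<or> \<not> sf e"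
    unfolding last using v5[of 8] r2(6) by simp_all
  show "\<tau> (Var 42) = 2 + 5 * Suc e" "\<tau> (Var 43) = 2 + 4 * Suc e" "\<tau> (Var 8) \<noteq> 0 \<longleftrightarrow> \<rho> (Var 8) \<noteq> 0 \<or> \<not> sf e"
    unfolding ex using arr' by blast+
  show "\<tau> (Arr j i) = \<rho> (Arr j i)" if "i \<notin> {2 + 4 * e..<2 + 4 * Suc e}" "j \<in> {2, 3, 16}" for i j
    using that unfolding ex by (auto simp only: arr insert_iff empty_iff split: if_splits) auto
  have split: "\<exists>k<4. i = 2 + 4 * e + k" if "i \<in> {2 + 4 * e..<2 + 4 * Suc e}" for i
    using that by (intro exI[of _ "i - (2 + 4 * e)"]) auto
  have k4: "k = 0 \<or> k = 1 \<or> k = 2 \<or> k = (3::nat)" if "k < 4" for k using that by linarith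
  show "\<tau> (Arr 16 i) = T i" if i: "i \<in> {2 + 4 * e..<2 + 4 * Suc e}" "\<rho> (Arr 16 i) = 0" for i
  proof -
    obtain k where k: "k < 4" "i = 2 + 4 * e + k" using split[OF i(1)] by blast
    show ?thesis unfolding ex arr(1) using i(2) k4[OF k(1)] e unfolding k(2) arc_simps(1)[OF k(1)]
      by (auto simp: arc_ok_def)
  qed
  show "\<tau> (Arr 2 i) = H i" if i: "i \<in> {2 + 4 * e..<2 + 4 * Suc e}" "\<rho> (Arr 2 i) = 0" for i
  proof -
    obtain k where k: "k < 4" "i = 2 + 4 * e + k" using split[OF i(1)] by blast
    show ?thesis unfolding ex arr(2) using i(2) k4[OF k(1)] e unfolding k(2) arc_simps(2)[OF k(1)]
      by (auto simp: arc_ok_def)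
  qed
  show "\<tau> (Arr 3 i) = C i" if i: "i \<in> {2 + 4 * e..<2 + 4 * Suc e}" for i
  proof -
    obtain k where k: "k < 4" "i = 2 + 4 * e + k" using split[OF i] by blast
    show ?thesis unfolding ex arr(3) using i e unfolding k(2) arc_simps(3)[OF k(1)] by simp
  qed
qed

lemma setup_arcs_spec:
  assumes v: "\<sigma> (Var 0) = R" and input: "\<And>i. 1 \<le> i \<Longrightarrow> i < 2 + 5 * m \<Longrightarrow> \<sigma> (Arr 0 i) = encode_fgc I vs es ! i"
    and w: "\<And>e. e < m \<Longrightarrow> 0 \<le> weight I (es ! e)" and cR: "\<And>e. e < m \<Longrightarrow> cst e \<le> R"
  defines "\<tau> \<equiv> exec setup_arcs \<sigma>"
  shows "arrs \<tau>" "setof 4 \<tau> = {..<R}" "\<tau> (Var 8) \<noteq> 0 \<longleftrightarrow> (\<exists>e<m. \<not> sf e)" "\<tau> (Arr 0 1) = m"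
proof -
  let ?c = "Put 16 (V 31) (N 0) ;; Put 2 (V 31) (N 0) ;; Put 3 (V 31) (N 0) ;; Put 4 (V 31) (N 1)"
  define \<sigma>1 where "\<sigma>1 = exec (For 31 ?c) \<sigma>"
  have f1: "frame {31} {2, 3, 4, 16} \<sigma> \<sigma>1"
    using frame_exec[of "For 31 ?c" \<sigma>] by (simp add: \<sigma>1_def insert_commute)
  have z: "\<forall>i<R. \<sigma>1 (Arr 16 i) = 0 \<and> \<sigma>1 (Arr 2 i) = 0 \<and> \<sigma>1 (Arr 3 i) = 0 \<and> \<sigma>1 (Arr 4 i) = 1"
    unfolding \<sigma>1_def
    by (rule exec_For[where P = "\<lambda>n \<rho>. \<forall>i<n. \<rho> (Arr 16 i) = 0 \<and> \<rho> (Arr 2 i) = 0 \<and> \<rho> (Arr 3 i) = 0 \<and> \<rho> (Arr 4 i) = 1"])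
      (use v in \<open>auto simp: less_Suc_eq\<close>)
  define \<sigma>2 where "\<sigma>2 = \<sigma>1(Arr 2 0 := 1, Arr 2 1 := 1, Var 42 := 2, Var 43 := 2, Var 8 := 0)"
  have f2: "frame {8, 31, 42, 43} {2, 3, 4, 16} \<sigma> \<sigma>2" using f1 by (simp add: frame_def \<sigma>2_def)
  have ex: "\<tau> = exec (For 41 edge) \<sigma>2"
    unfolding \<tau>_def setup_arcs_def \<sigma>2_def \<sigma>1_def by (simp only: exec.simps ev.simps)
  let ?A = "\<lambda>l \<rho>. \<forall>i<R. \<rho> (Arr 16 i) = (if i < 2 + 4 * l then T i else 0) \<and> \<rho> (Arr 2 i) = (if i < 2 + 4 * l then H i else 0) \<and>
      \<rho> (Arr 3 i) = (if i < 2 + 4 * l then C i else 0)"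
  let ?P = "\<lambda>l \<rho>. \<rho> (Var 42) = 2 + 5 * l \<and> \<rho> (Var 43) = 2 + 4 * l \<and> (\<rho> (Var 8) \<noteq> 0 \<longleftrightarrow> (\<exists>e<l. \<not> sf e)) \<and> ?A l \<rho>"
  have main: "?P (min R m) (exec (For 41 edge) \<sigma>2)"
  proof (rule exec_For_frame[where P = "\<lambda>i \<rho>. ?P (min i m) \<rho>"])
    \<comment> \<open>Before any edge is read, the source arcs 0 and 1 are in place, and all other
      numbers are still loops at 0.\<close>
    have "i = 0 \<or> i = 1 \<or> 2 \<le> i" for i :: nat by linarith
    then show "?P (min 0 m) (\<sigma>2(Var 41 := 0))"
      using z R by (auto simp: \<sigma>2_def arc_tl_def arc_hd_def arc_cost_def)
    fix e \<rho> assume e: "e < R" "?P (min e m) \<rho>" "\<rho> (Var 41) = e" and fr: "frame (wv (For 41 edge)) (wa (For 41 edge)) \<sigma>2 \<rho>"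
    have in\<rho>: "\<rho> (Arr 0 i) = \<sigma> (Arr 0 i)" for i
      using frameD(2)[OF fr, of 0] frameD(2)[OF f2, of 0] by (simp add: wv_edge)
    have m1: "\<rho> (Arr 0 1) = m" using in\<rho> input[of 1] encode_length(2) by simp
    show "?P (min (Suc e) m) ((exec edge \<rho>)(Var 41 := Suc e))"
    proof (cases "e < m")
      case False
      then have "exec edge \<rho> = \<rho>(Var 47 := 0)" using e(3) m1 by (simp add: edge_def)
      then have ec: "(exec edge \<rho>)(Var 41 := Suc e) = \<rho>(Var 47 := 0, Var 41 := Suc e)" by (simp only:)
      have mm: "min e m = m" "min (Suc e) m = m" using False by simp_all
      show ?thesis using e(2) unfolding ec mm by simp
    next
      case True
      have mm: "min e m = e" "min (Suc e) m = Suc e" using True by simp_all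
      have P: "\<rho> (Var 42) = 2 + 5 * e" "\<rho> (Var 43) = 2 + 4 * e" "\<rho> (Var 8) \<noteq> 0 \<longleftrightarrow> (\<exists>d<e. \<not> sf d)" "?A e \<rho>"
        using e(2) unfolding mm by blast+
      have "\<rho> (Var 0) = R" using frameD(1)[OF fr, of 0] frameD(1)[OF f2, of 0] v by (simp add: wv_edge)
      note es = edge_spec[OF True e(3) P(1,2) this _ w[OF True] cR[OF True]]
      have inp: "\<And>i. 1 \<le> i \<Longrightarrow> i < 2 + 5 * m \<Longrightarrow> \<rho> (Arr 0 i) = encode_fgc I vs es ! i"
        using in\<rho> input by simp
      have "?A (Suc e) (exec edge \<rho>)"
      proof (intro allI impI)
        fix i assume i: "i < R"
        note Pi = P(4)[rule_format, OF i]
        show "exec edge \<rho> (Arr 16 i) = (if i < 2 + 4 * Suc e then T i else 0) \<and>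
          exec edge \<rho> (Arr 2 i) = (if i < 2 + 4 * Suc e then H i else 0) \<and>
          exec edge \<rho> (Arr 3 i) = (if i < 2 + 4 * Suc e then C i else 0)"
        proof (cases "i \<in> {2 + 4 * e..<2 + 4 * Suc e}")
          case True
          then show ?thesis using es(5-7)[OF inp True] Pi by simp
        next
          case False
          then have "i < 2 + 4 * Suc e \<longleftrightarrow> i < 2 + 4 * e" by auto
          then show ?thesis using es(4)[OF inp False, of 16] es(4)[OF inp False, of 2] es(4)[OF inp False, of 3] Pi by simp
        qed
      qed
      moreover have "(exec edge \<rho> (Var 8) \<noteq> 0) \<longleftrightarrow> (\<exists>d<Suc e. \<not> sf d)"
        using es(3)[OF inp] P(3) by (auto simp: less_Suc_eq)
      ultimately show ?thesis unfolding mm using es(1,2)[OF inp] by simp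
    qed
  next
    show "\<sigma>2 (Var 0) = R" using frameD(1)[OF f2, of 0] v by simp
  qed (auto simp: wv_edge)
  have mR: "min R m = m" using R by simp
  have P: "\<tau> (Var 8) \<noteq> 0 \<longleftrightarrow> (\<exists>e<m. \<not> sf e)" "?A m \<tau>" using main unfolding mR ex by blast+
  have f3: "frame (wv (For 41 edge)) (wa (For 41 edge)) \<sigma>2 \<tau>" unfolding ex by (rule frame_exec)
  show "\<tau> (Var 8) \<noteq> 0 \<longleftrightarrow> (\<exists>e<m. \<not> sf e)" by (rule P(1))
  have "\<tau> (Var 0) = R" using frameD(1)[OF f3, of 0] frameD(1)[OF f2, of 0] v by (simp add: wv_edge)
  then show "arrs \<tau>" unfolding arrs_def using P(2) arc_beyond by (auto simp: not_less)
  have "\<tau> (Arr 4 i) = 1" if "i < R" for i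
    using frameD(2)[OF f3, of 4] z that by (simp add: wv_edge \<sigma>2_def)
  then show "setof 4 \<tau> = {..<R}" by (auto simp: setof_def)
  show "\<tau> (Arr 0 1) = m"
    using frameD(2)[OF f3, of 0 1] frameD(2)[OF f2, of 0 1] input[of 1] encode_length(2) by (simp add: wv_edge)
qed

end

section \<open>The approximation guarantee\<close>

lemma total_weight_nonneg: "fgc_instance I \<Longrightarrow> S \<subseteq> edges I \<Longrightarrow> 0 \<le> total_weight I S"
  unfolding total_weight_def fgc_instance_def by (intro sum_nonneg) auto

lemma OPT_attained:
  assumes "fgc_instance I" "\<exists>S. feasible I S"
  shows "\<exists>S. feasible I S \<and> total_weight I S = OPT I"
proof -
  have "finite (edges I)" using assms(1) unfolding fgc_instance_def by blast
  moreover have "{S. feasible I S} \<subseteq> Pow (edges I)" unfolding feasible_def by blast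
  ultimately have "finite {S. feasible I S}" by (meson finite_Pow_iff finite_subset)
  then have "OPT I \<in> total_weight I ` {S. feasible I S}"
    unfolding OPT_def using assms(2) by (intro Min_in) auto
  then show ?thesis by auto
qed

context fgc_cover begin

text \<open>With unsafe edges present, five times the weight of the output is at most the cost of
  the cover found, hence at most that of the cover made from an optimal solution, hence at most
  \<open>12 * OPT I\<close>. Without a feasible set only the bound on the output length is
  claimed.\<close>

lemma main_spec:
  assumes w: "\<forall>e\<in>edges I. 1 \<le> weight I e \<and> weight I e \<le> of_nat M" and RM: "5 * M \<le> R"
    and v: "\<sigma> (Var 0) = R" and input: "\<And>i. 1 \<le> i \<Longrightarrow> i < 2 + 5 * m \<Longrightarrow> \<sigma> (Arr 0 i) = encode_fgc I vs es ! i"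
  defines "\<tau> \<equiv> exec (main (5 * M)) \<sigma>"
  defines "ys \<equiv> map (\<lambda>i. \<tau> (Arr 11 i)) [0..<\<tau> (Var 1)]"
  shows "\<tau> (Var 1) < R"
    "\<exists>S. feasible I S \<Longrightarrow> \<exists>S. decodes_to es ys S \<and> feasible I S \<and> total_weight I S \<le> 12 / 5 * OPT I"
proof -
  have cst: "cst e \<le> 5 * M" if "e < m" for e
  proof -
    have "5 * weight I (es ! e) \<le> of_int (int (5 * M))" using w es_edges[OF that] by simp
    then have "\<lceil>5 * weight I (es ! e)\<rceil> \<le> int (5 * M)" by (rule ceiling_le)
    then show ?thesis unfolding cst_def by linarith
  qed
  have cQ: "C i \<le> 5 * M" for i
    using cst[of "(i - 2) div 4"] by (simp add: arc_cost_def)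
  define \<sigma>1 where "\<sigma>1 = exec setup_arcs \<sigma>"
  have w0: "0 \<le> weight I (es ! e)" if "e < m" for e
    using w es_edges[OF that] order_trans[of 0 1 "weight I (es ! e)"] by simp
  have cR: "cst e \<le> R" if "e < m" for e using cst[OF that] RM by linarith
  have sp: "arrs \<sigma>1" "setof 4 \<sigma>1 = {..<R}" "\<sigma>1 (Var 8) \<noteq> 0 \<longleftrightarrow> (\<exists>e<m. \<not> sf e)" "\<sigma>1 (Arr 0 1) = m"
    unfolding \<sigma>1_def by (rule setup_arcs_spec; simp add: v input w0 cR)+
  define \<sigma>2 where "\<sigma>2 = exec (optimize (5 * M)) \<sigma>1"
  have f2: "frame (wv (optimize (5 * M))) (wa (optimize (5 * M))) \<sigma>1 \<sigma>2" unfolding \<sigma>2_def by (rule frame_exec)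
  have v2: "\<sigma>2 (Var 0) = R" "\<sigma>2 (Arr 0 1) = m" "\<sigma>2 (Var 8) = \<sigma>1 (Var 8)"
    using frameD(1)[OF f2, of 0] frameD(2)[OF f2, of 0 1] frameD(1)[OF f2, of 8] sp(4) arrsD(4)[OF sp(1)]
    by (simp_all add: wv_optimize)
  have \<tau>: "\<tau> = exec collect \<sigma>2" by (simp add: \<tau>_def main_def \<sigma>2_def \<sigma>1_def)
  have mR: "m \<le> R" using R by simp
  note co = collect_spec[OF v2(1,2) mR, folded \<tau>]
  show "\<tau> (Var 1) < R" using co(2) R by linarith
  assume ex: "\<exists>S. feasible I S"
  then obtain S where S: "feasible I S" "total_weight I S = OPT I" using OPT_attained[OF inst] by blast
  have pos: "0 \<le> OPT I" using total_weight_nonneg[OF inst, of S] S by (simp add: feasible_def)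
  have ys: "ys = filter (\<lambda>e. \<sigma>2 (Var 8) \<noteq> 0 \<and> (\<exists>k<4. \<sigma>2 (Arr 4 (2 + 4 * e + k)) \<noteq> 0)) [0..<m]"
    unfolding ys_def by (rule co(1))
  have dec: "decodes_to es ys ((!) es ` set ys)" unfolding decodes_to_def ys by (auto simp: m_def)
  have any: "\<sigma>2 (Var 8) \<noteq> 0 \<longleftrightarrow> unsafe I \<noteq> {}"
  proof -
    have "unsafe I = (!) es ` {e. e < m \<and> \<not> sf e}"
    proof (intro equalityI subsetI)
      fix f assume f: "f \<in> unsafe I"
      then have "f \<in> set es" using es unfolding unsafe_def enumerates_def by blast
      then obtain e where "e < m" "es ! e = f" unfolding in_set_conv_nth m_def by blast
      then show "f \<in> (!) es ` {e. e < m \<and> \<not> sf e}" using f by (auto simp: sf_def unsafe_def)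
    qed (auto simp: unsafe_def sf_def es_edges)
    then have "unsafe I \<noteq> {} \<longleftrightarrow> (\<exists>e<m. \<not> sf e)" by auto
    then show ?thesis using sp(3) v2(3) by simp
  qed
  have "feasible I ((!) es ` set ys) \<and> total_weight I ((!) es ` set ys) \<le> 12 / 5 * OPT I"
  proof (cases "unsafe I = {}")
    case True
    then have "ys = []" using any ys by simp
    then show ?thesis using True pos by (simp add: feasible_def total_weight_def)
  next
    case False
    obtain D where D: "D \<subseteq> {..<R}" "covers D" "of_nat (\<Sum>i\<in>D. C i) \<le> 12 * total_weight I S"
      using covers_from_feasible[OF S(1) False] w by blast
    \<comment> \<open>The feasible set provides a cover \<open>D\<close>, so the set of all arcs is
      a legitimate start.\<close>
    have "covers (setof 4 \<sigma>1)" unfolding sp(2) by (rule covers_mono[OF D(2,1)]) simp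
    moreover have "cost (setof 4 \<sigma>1) \<le> R * R"
    proof -
      have "cost (setof 4 \<sigma>1) \<le> (\<Sum>i<R. R)" unfolding cost_def sp(2) using cQ RM by (intro sum_mono) (meson order_trans)
      then show ?thesis by simp
    qed
    ultimately have opt: "covers (setof 4 \<sigma>2)" "cost (setof 4 \<sigma>2) \<le> cost D"
      using optimize_spec[OF sp(1) _ cQ] D(1,2) unfolding \<sigma>2_def by blast+
    have "2 + 4 * e + k \<in> setof 4 \<sigma>2 \<longleftrightarrow> \<sigma>2 (Arr 4 (2 + 4 * e + k)) \<noteq> 0" if "e < m" "k < 4" for e k
      using that R by (auto simp: setof_def)
    then have ch: "(!) es ` set ys = chosen (setof 4 \<sigma>2)"
      unfolding ys chosen_def using any False by auto
    have "feasible I (chosen (setof 4 \<sigma>2))" by (rule chosen_feasible[OF setof_subset opt(1)])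
    moreover have "5 * total_weight I (chosen (setof 4 \<sigma>2)) \<le> of_nat (cost (setof 4 \<sigma>2))"
      unfolding cost_def using w by (intro chosen_weight[OF setof_subset]) blast
    moreover have "of_nat (cost (setof 4 \<sigma>2)) \<le> (of_nat (cost D) :: rat)" using opt(2) by (rule of_nat_mono)
    moreover have "of_nat (cost D) \<le> 12 * OPT I" using D(3) S(2) by (simp add: cost_def)
    ultimately show ?thesis unfolding ch by simp
  qed
  then show "\<exists>S. decodes_to es ys S \<and> feasible I S \<and> total_weight I S \<le> 12 / 5 * OPT I" using dec by blast
qed

end

theorem theorem2:
  fixes M :: nat
  shows "\<exists>p. polytime_approx_algorithm 2.4036 (bounded_weight M) p"
proof -
  \<comment> \<open>The loop bound is \<open>5 * m + ?k\<close>: the 3 leaves room for the source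
    arcs and for the epilogue, and \<open>5 * M\<close> makes it exceed every rounded cost, so all
    arcs together cost at most its square.\<close>
  let ?k = "3 + 5 * M" and ?c = "main (5 * M)"
  obtain p and q :: "nat poly" where pq: "\<And>xs. length xs = 2 + 5 * xs ! 1 \<Longrightarrow>
    (\<exists>\<sigma>. \<sigma> (Var 0) = 5 * xs ! 1 + ?k \<and> (\<forall>i. 1 \<le> i \<longrightarrow> i < length xs \<longrightarrow> \<sigma> (Arr 0 i) = xs ! i) \<and>
      (exec ?c \<sigma> (Var 1) < 5 * xs ! 1 + ?k \<longrightarrow>
        (\<exists>t. ram_computes p xs t (map (\<lambda>i. exec ?c \<sigma> (Arr 11 i)) [0..<exec ?c \<sigma> (Var 1)]) \<and>
          t \<le> poly q (input_size xs))))"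
    using ram_program_of_com[OF wf_main, of ?k "5 * M"] by auto
  have "\<exists>t ys. ram_computes p (encode_fgc I vs es) t ys \<and> t \<le> poly q (input_size (encode_fgc I vs es)) \<and>
      ((\<exists>S. feasible I S) \<longrightarrow> (\<exists>S. decodes_to es ys S \<and> feasible I S \<and> total_weight I S \<le> 2.4036 * OPT I))"
    if I: "fgc_instance I" "bounded_weight M I" "enumerates vs (verts I)" "enumerates es (edges I)"
    for I :: "(nat, nat) fgc" and vs es
  proof -
    let ?xs = "encode_fgc I vs es" and ?R = "5 * length es + ?k"
    interpret fgc_input I vs es by unfold_locales (use I in auto)
    interpret fgc_cover I vs es ?R by unfold_locales (simp add: m_def)
    have x1: "?xs ! 1 = length es" "length ?xs = 2 + 5 * length es" using encode_length by (simp_all add: m_def)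
    obtain \<sigma> where \<sigma>: "\<sigma> (Var 0) = ?R" "\<forall>i. 1 \<le> i \<longrightarrow> i < length ?xs \<longrightarrow> \<sigma> (Arr 0 i) = ?xs ! i"
      "exec ?c \<sigma> (Var 1) < ?R \<longrightarrow>
        (\<exists>t. ram_computes p ?xs t (map (\<lambda>i. exec ?c \<sigma> (Arr 11 i)) [0..<exec ?c \<sigma> (Var 1)]) \<and> t \<le> poly q (input_size ?xs))"
      using pq[of ?xs] x1 by auto
    have w: "\<forall>e\<in>edges I. 1 \<le> weight I e \<and> weight I e \<le> of_nat M" using I(2) by (simp add: bounded_weight_def)
    have input: "\<sigma> (Arr 0 i) = ?xs ! i" if "1 \<le> i" "i < 2 + 5 * m" for i
      using \<sigma>(2) that x1(2) by (simp add: m_def)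
    have RM: "5 * M \<le> ?R" by simp
    note ms = main_spec[OF w RM \<sigma>(1) input]
    obtain t where t: "ram_computes p ?xs t (map (\<lambda>i. exec ?c \<sigma> (Arr 11 i)) [0..<exec ?c \<sigma> (Var 1)])"
      "t \<le> poly q (input_size ?xs)" using \<sigma>(3) ms(1) by blast
    have "\<exists>S. decodes_to es (map (\<lambda>i. exec ?c \<sigma> (Arr 11 i)) [0..<exec ?c \<sigma> (Var 1)]) S \<and> feasible I S \<and>
       total_weight I S \<le> 2.4036 * OPT I" if ex: "\<exists>S. feasible I S"
    proof -
      obtain S where S: "decodes_to es (map (\<lambda>i. exec ?c \<sigma> (Arr 11 i)) [0..<exec ?c \<sigma> (Var 1)]) S"
        "feasible I S" "total_weight I S \<le> 12 / 5 * OPT I" using ms(2)[OF _ _ ex] by blast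
      obtain S' where "feasible I S'" "total_weight I S' = OPT I" using OPT_attained[OF I(1) ex] by blast
      then have "0 \<le> OPT I" using total_weight_nonneg[OF I(1), of S'] by (simp add: feasible_def)
      \<comment> \<open>12/5 is 2.4; \<open>OPT I\<close> must be nonnegative for the slack to point
        the right way.\<close>
      then have "12 / 5 * OPT I \<le> 2.4036 * OPT I" by (intro mult_right_mono) auto
      then show ?thesis using S by (meson order_trans)
    qed
    then show ?thesis using t by blast
  qed
  then show ?thesis unfolding polytime_approx_algorithm_def by blast
qed

end
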